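(* Let $N\ge2$ be an integer, $1<p<1+\frac{4}{N-2}$ (where $1+4/(N-2)$ stands for $\infty$ if $N=2$) and $\omega\in(-1,\infty)$. Then the set of ground states $\mathcal{G}_\omega$ is not empty, and it is characterized by $$\mathcal{G}_\omega=\{v\in X: S_\omega(v)=d(\omega),\ K_\omega(v)=0,\ v\ne0\},$$ where $$K_\omega(v)=\partial_\lambda S_\omega(\lambda v)|_{\lambda=1}=\|\nabla v\|_{L^2}^2+\|x_Nv\|_{L^2}^2+\omega\|v\|_{L^2}^2-\|v\|_{L^{p+1}}^{p+1}$$ is the Nehari functional and $$d(\omega)=\inf\{S_\omega(v): v\in X,\ K_\omega(v)=0,\ v\ne0\}.$$
   Context: Functions are complex-valued on $\mathbb{R}^N$, $x=(x_1,\dots,x_N)$. The space $X=\{v\in H^1(\mathbb{R}^N): x_Nv\in L^2(\mathbb{R}^N)\}$ has norm $\|v\|_X=(\|\nabla v\|_{L^2}^2+\|v\|_{L^2}^2+\|x_Nv\|_{L^2}^2)^{1/2}$. The action is $$S_\omega(v)=\tfrac12\|\nabla v\|_{L^2}^2+\tfrac12\|x_Nv\|_{L^2}^2+\tfrac{\omega}{2}\|v\|_{L^2}^2-\tfrac{1}{p+1}\|v\|_{L^{p+1}}^{p+1},\qquad v\in X.$$ Let $\mathcal{A}_\omega=\{v\in X: S_\omega'(v)=0,\ v\ne0\}$, the set of nontrivial solutions in $X$ of $-\Delta\phi+x_N^2\phi+\omega\phi-|\phi|^{p-1}\phi=0$. The set of ground states is $\mathcal{G}_\omega=\{\phi\in\mathcal{A}_\omega: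 S_\omega(\phi)\le S_\omega(v)\text{ for all }v\in\mathcal{A}_\omega\}$. *)

theory Defs
  imports "HOL-Analysis.Analysis"
begin

section \<open>Lebesgue spaces on Euclidean space\<close>

text \<open>Elements of function spaces are represented by functions; two functions that agree almost
  everywhere represent the same element, and all notions below are invariant under this relation.\<close>

definition in_Lp :: "real \<Rightarrow> ('a::euclidean_space \<Rightarrow> 'b::real_normed_vector) \<Rightarrow> bool" where
  "in_Lp q v \<longleftrightarrow> v \<in> borel_measurable lebesgue \<and> integrable lebesgue (\<lambda>x. norm (v x) powr q)"

definition Lp_norm :: "real \<Rightarrow> ('a::euclidean_space \<Rightarrow> 'b::real_normed_vector) \<Rightarrow> real" where
  "Lp_norm q v = (\<integral>x. norm (v x) powr q \<partial>lebesgue) powr (1 / q)"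

definition locally_integrable ::
    "('a::euclidean_space \<Rightarrow> 'b::{banach, second_countable_topology}) \<Rightarrow> bool" where
  "locally_integrable v \<longleftrightarrow> (\<forall>K. compact K \<longrightarrow> set_integrable lebesgue K v)"

definition ae_zero :: "('a::euclidean_space \<Rightarrow> 'b::real_normed_vector) \<Rightarrow> bool" where
  "ae_zero v \<longleftrightarrow> (AE x in lebesgue. v x = 0)"


section \<open>Test functions and weak gradients\<close>

definition partial_deriv :: "'n::finite \<Rightarrow> (real^'n \<Rightarrow> real) \<Rightarrow> real^'n \<Rightarrow> real" where
  "partial_deriv i f x = frechet_derivative f (at x) (axis i 1)"

text \<open>All iterated partial derivatives are (totally) differentiable, hence continuous; this is
  \<open>C\<^sup>\<infinity>\<close> regularity.\<close>

definition smooth :: "(real^'n::finite \<Rightarrow> real) \<Rightarrow> bool" where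
  "smooth f \<longleftrightarrow> (\<forall>js. foldr partial_deriv js f differentiable_on UNIV)"

definition test_function :: "(real^'n::finite \<Rightarrow> real) \<Rightarrow> bool" where
  "test_function f \<longleftrightarrow> smooth f \<and> compact (closure {x. f x \<noteq> 0})"

text \<open>The Euclidean norm of \<open>G x\<close> in \<open>complex^'n\<close> is the square root of the sum of the
  squared moduli of the weak partial derivatives.\<close>

definition has_weak_gradient ::
    "(real^'n::finite \<Rightarrow> complex) \<Rightarrow> (real^'n \<Rightarrow> complex^'n) \<Rightarrow> bool" where
  "has_weak_gradient v G \<longleftrightarrow>
     locally_integrable v \<and> locally_integrable G \<and>
     (\<forall>f i. test_function f \<longrightarrow>
        (\<integral>x. partial_deriv i f x *\<^sub>R v x \<partial>lebesgue) = - (\<integral>x. f x *\<^sub>R (G x $ i) \<partial>lebesgue))"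

text \<open>The weak gradient is unique up to null sets, so norms of it do not depend on the choice.\<close>

definition weak_gradient :: "(real^'n::finite \<Rightarrow> complex) \<Rightarrow> real^'n \<Rightarrow> complex^'n" where
  "weak_gradient v = (SOME G. has_weak_gradient v G)"

definition H1 :: "(real^'n::finite \<Rightarrow> complex) set" where
  "H1 = {v. in_Lp 2 v \<and> (\<exists>G. has_weak_gradient v G \<and> in_Lp 2 G)}"


section \<open>The energy space\<close>

text \<open>The index type \<open>'n\<close> carries no order; the parameter \<open>k\<close> is the index of the
  confined coordinate \<open>x\<^sub>N\<close>.\<close>

definition X_space :: "'n::finite \<Rightarrow> (real^'n \<Rightarrow> complex) set" where
  "X_space k = {v \<in> H1. in_Lp 2 (\<lambda>x. (x $ k) *\<^sub>R v x)}"

definition X_norm :: "'n::finite \<Rightarrow> (real^'n \<Rightarrow> complex) \<Rightarrow> real" where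
  "X_norm k v = sqrt ((Lp_norm 2 (weak_gradient v))\<^sup>2 + (Lp_norm 2 v)\<^sup>2
                      + (Lp_norm 2 (\<lambda>x. (x $ k) *\<^sub>R v x))\<^sup>2)"

text \<open>Frechet differentiability on the real normed space \<open>(X_space k, X_norm k)\<close>, which is not a
  type, so that the library's \<open>has_derivative\<close> does not apply to it.\<close>

definition X_bounded_linear :: "'n::finite \<Rightarrow> ((real^'n \<Rightarrow> complex) \<Rightarrow> real) \<Rightarrow> bool" where
  "X_bounded_linear k L \<longleftrightarrow>
     (\<forall>g \<in> X_space k. \<forall>h \<in> X_space k. L (\<lambda>x. g x + h x) = L g + L h) \<and>
     (\<forall>c. \<forall>h \<in> X_space k. L (\<lambda>x. c *\<^sub>R h x) = c * L h) \<and>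
     (\<exists>C. \<forall>h \<in> X_space k. \<bar>L h\<bar> \<le> C * X_norm k h)"

definition X_has_derivative ::
    "'n::finite \<Rightarrow> ((real^'n \<Rightarrow> complex) \<Rightarrow> real) \<Rightarrow> ((real^'n \<Rightarrow> complex) \<Rightarrow> real) \<Rightarrow>
     (real^'n \<Rightarrow> complex) \<Rightarrow> bool" where
  "X_has_derivative k F L v \<longleftrightarrow>
     X_bounded_linear k L \<and>
     (\<forall>\<epsilon>>0. \<exists>\<delta>>0. \<forall>h \<in> X_space k. X_norm k h < \<delta> \<longrightarrow>
        \<bar>F (\<lambda>x. v x + h x) - F v - L h\<bar> \<le> \<epsilon> * X_norm k h)"


section \<open>Action, Nehari functional and ground states\<close>

text \<open>For \<open>v \<in> X_space k\<close> and subcritical \<open>p\<close> the last term is finite by the Sobolev embedding.\<close>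

definition action :: "'n::finite \<Rightarrow> real \<Rightarrow> real \<Rightarrow> (real^'n \<Rightarrow> complex) \<Rightarrow> real" where
  "action k p \<omega> v =
     1 / 2 * (Lp_norm 2 (weak_gradient v))\<^sup>2
     + 1 / 2 * (Lp_norm 2 (\<lambda>x. (x $ k) *\<^sub>R v x))\<^sup>2
     + \<omega> / 2 * (Lp_norm 2 v)\<^sup>2
     - 1 / (p + 1) * Lp_norm (p + 1) v powr (p + 1)"

definition nehari :: "'n::finite \<Rightarrow> real \<Rightarrow> real \<Rightarrow> (real^'n \<Rightarrow> complex) \<Rightarrow> real" where
  "nehari k p \<omega> v =
     (Lp_norm 2 (weak_gradient v))\<^sup>2
     + (Lp_norm 2 (\<lambda>x. (x $ k) *\<^sub>R v x))\<^sup>2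
     + \<omega> * (Lp_norm 2 v)\<^sup>2
     - Lp_norm (p + 1) v powr (p + 1)"

definition critical_points :: "'n::finite \<Rightarrow> real \<Rightarrow> real \<Rightarrow> (real^'n \<Rightarrow> complex) set" where
  "critical_points k p \<omega> =
     {v \<in> X_space k. X_has_derivative k (action k p \<omega>) (\<lambda>_. 0) v \<and> \<not> ae_zero v}"

definition ground_states :: "'n::finite \<Rightarrow> real \<Rightarrow> real \<Rightarrow> (real^'n \<Rightarrow> complex) set" where
  "ground_states k p \<omega> =
     {\<phi> \<in> critical_points k p \<omega>. \<forall>v \<in> critical_points k p \<omega>. action k p \<omega> \<phi> \<le> action k p \<omega> v}"

text \<open>On the constraint set the action equals \<open>(1/2 - 1/(p+1)) * Lp_norm (p+1) v powr (p+1)\<close>, so the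
  set of values is bounded below for \<open>p > 1\<close> and this is a genuine infimum.\<close>

definition least_action :: "'n::finite \<Rightarrow> real \<Rightarrow> real \<Rightarrow> real" where
  "least_action k p \<omega> =
     Inf {action k p \<omega> v | v. v \<in> X_space k \<and> nehari k p \<omega> v = 0 \<and> \<not> ae_zero v}"

end

theory Submission imports Defs "HOL-Computational_Algebra.Polynomial" begin

text \<open>
  Write \<open>q = p + 1\<close>, \<open>Q\<close> for the quadratic part of the Nehari functional and \<open>I(v)\<close> for the integral of \<open>|v|\<^sup>q\<close>, so that
  the action is \<open>S = Q/2 - I/q\<close> and the Nehari functional is \<open>Q - I\<close>. On the Nehari set \<open>S = (1/2 - 1/q) I\<close>, and
  a nonzero function can be scaled onto it. Minimising \<open>S\<close> there is therefore the same as finding the best constant \<open>m\<close> in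
  \<open>m I(v)\<^sup>2\<^sup>/\<^sup>q \<le> Q(v)\<close>, and the value of the minimum is \<open>(1/2 - 1/q) m\<^sup>q\<^sup>/\<^sup>(\<^sup>q\<^sup>-\<^sup>2\<^sup>)\<close>.

  The proof has two parts. The constant \<open>m\<close> is attained (\<open>exists_minimiser\<close>), and every function on the Nehari set that
  attains it is a critical point of the action (\<open>minimiser_action_estimate\<close>). Conversely every nonzero critical point
  lies on the Nehari set, because the derivative of the action along the ray through \<open>v\<close> is the Nehari functional
  (\<open>action_scale_derivative\<close>). Hence the nonzero critical points of least action are exactly the minimisers.

  For the first part, the condition \<open>\<omega> > -1\<close> makes \<open>Q\<close> equivalent to the square of the norm of the energy space, by the
  uncertainty principle for the confined variable (\<open>uncertainty\<close>, \<open>coercive\<close>). A minimising sequence can lose compactness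
  only by translations in the unconfined variables. Since the power is subcritical, a function with \<open>I = 1\<close> has a cube on which its
  average is not small (\<open>nonvanishing_cube_average\<close>); after a translation this cube stays in a bounded region
  (\<open>tight_subsequence\<close>), so a limit exists and is not zero (\<open>local_compactness\<close>). The splitting of Brezis and Lieb
  (\<open>brezis_lieb\<close>) and the strict subadditivity of \<open>t \<mapsto> t\<^sup>2\<^sup>/\<^sup>q\<close> then show that no mass is lost.

  All estimates for Sobolev functions rest on one fact, \<open>\<parallel>v(\<cdot> + h) - v\<parallel> \<le> |h| \<parallel>\<nabla>v\<parallel>\<close> in \<open>L\<^sup>2\<close> (\<open>translation_estimate\<close>).
  Integrated over \<open>h\<close> it bounds the distance of a function from its averages over cubes of side \<open>l\<close> by a multiple of \<open>l\<close>
  (\<open>nn_integral_osc_le\<close>). Comparing a function with such averages gives the Sobolev inequality for all subcritical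
  exponents by a bootstrap (\<open>sobolev_bound_step\<close>), the non-vanishing of averages, and local compactness. Weak convergence
  in the energy space is replaced by strong convergence of iterated midpoints (\<open>mazur\<close>).

  The analysis is carried out for pairs of a Borel function and its weak gradient; the last sections transfer it to
  Lebesgue measurable functions (\<open>represents\<close>).
\<close>

section \<open>Square-integrable Borel functions\<close>

text \<open>Borel rather than Lebesgue measurability: Fubini's theorem is applied to functions of \<open>x\<close> and a
  translation parameter, and composition with addition keeps Borel functions measurable jointly in both.\<close>

definition L2 :: "('a::euclidean_space \<Rightarrow> 'b::euclidean_space) \<Rightarrow> bool" where
  "L2 f \<longleftrightarrow> f \<in> borel_measurable borel \<and> integrable lborel (\<lambda>x. (norm (f x))\<^sup>2)"

definition L2_sq :: "('a::euclidean_space \<Rightarrow> 'b::euclidean_space) \<Rightarrow> real" where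
  "L2_sq f = (\<integral>x. (norm (f x))\<^sup>2 \<partial>lborel)"

definition L2_inner :: "('a::euclidean_space \<Rightarrow> 'b::euclidean_space) \<Rightarrow> ('a \<Rightarrow> 'b) \<Rightarrow> real" where
  "L2_inner f g = (\<integral>x. f x \<bullet> g x \<partial>lborel)"

lemma L2_measurable [measurable_dest]: "L2 f \<Longrightarrow> f \<in> borel_measurable borel"
  by (simp add: L2_def)

lemma L2_integrable: "L2 f \<Longrightarrow> integrable lborel (\<lambda>x. (norm (f x))\<^sup>2)"
  by (simp add: L2_def)

lemma L2_sq_nonneg: "L2_sq f \<ge> 0"
  by (simp add: L2_sq_def)

lemma L2I_bound:
  assumes "f \<in> borel_measurable borel" "integrable lborel g" "AE x in lborel. (norm (f x))\<^sup>2 \<le> g x"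
  shows "L2 f"
  unfolding L2_def using assms by (auto intro!: Bochner_Integration.integrable_bound[OF assms(2)] elim!: eventually_mono)

lemma L2_inner_integrable:
  assumes "L2 f" "L2 g" shows "integrable lborel (\<lambda>x. f x \<bullet> g x)"
proof (rule Bochner_Integration.integrable_bound)
  show "integrable lborel (\<lambda>x. (norm (f x))\<^sup>2 + (norm (g x))\<^sup>2)"
    using assms by (auto intro: L2_integrable)
  show "(\<lambda>x. f x \<bullet> g x) \<in> borel_measurable lborel" using assms by (auto simp: L2_def)
  have "\<bar>f x \<bullet> g x\<bar> \<le> (norm (f x))\<^sup>2 + (norm (g x))\<^sup>2" for x
  proof -
    have "2 * (norm (f x) * norm (g x)) \<le> (norm (f x))\<^sup>2 + (norm (g x))\<^sup>2"
      using sum_squares_bound[of "norm (f x)" "norm (g x)"] by (simp add: algebra_simps)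
    moreover have "norm (f x) * norm (g x) \<ge> 0" by simp
    ultimately show ?thesis using Cauchy_Schwarz_ineq2[of "f x" "g x"] by linarith
  qed
  then show "AE x in lborel. norm (f x \<bullet> g x) \<le> norm ((norm (f x))\<^sup>2 + (norm (g x))\<^sup>2)"
    by auto
qed

lemma norm_sq_lincomb:
  fixes u w :: "'b::real_inner"
  shows "(norm (a *\<^sub>R u + b *\<^sub>R w))\<^sup>2 = a\<^sup>2 * (norm u)\<^sup>2 + 2 * a * b * (u \<bullet> w) + b\<^sup>2 * (norm w)\<^sup>2"
  unfolding power2_norm_eq_inner
  by (simp add: inner_add_left inner_add_right inner_commute[of w u]) (simp add: power2_eq_square algebra_simps)

lemma L2_lincomb:
  assumes "L2 f" "L2 g" shows "L2 (\<lambda>x. a *\<^sub>R f x + b *\<^sub>R g x)"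
  unfolding L2_def
proof
  show "(\<lambda>x. a *\<^sub>R f x + b *\<^sub>R g x) \<in> borel_measurable borel" using assms by (auto simp: L2_def)
  show "integrable lborel (\<lambda>x. (norm (a *\<^sub>R f x + b *\<^sub>R g x))\<^sup>2)"
    unfolding norm_sq_lincomb using L2_inner_integrable[OF assms] assms
    by (auto intro!: Bochner_Integration.integrable_add integrable_mult_right intro: L2_integrable)
qed

lemma L2_sq_lincomb:
  assumes "L2 f" "L2 g"
  shows "L2_sq (\<lambda>x. a *\<^sub>R f x + b *\<^sub>R g x) = a\<^sup>2 * L2_sq f + 2 * a * b * L2_inner f g + b\<^sup>2 * L2_sq g"
  unfolding L2_sq_def L2_inner_def norm_sq_lincomb using L2_inner_integrable[OF assms] assms
  by (subst Bochner_Integration.integral_add;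
      (subst Bochner_Integration.integral_add)?;
      (auto intro!: Bochner_Integration.integrable_add integrable_mult_right intro: L2_integrable))

lemma L2_add: "L2 f \<Longrightarrow> L2 g \<Longrightarrow> L2 (\<lambda>x. f x + g x)"
  using L2_lincomb[of f g 1 1] by simp
lemma L2_diff: "L2 f \<Longrightarrow> L2 g \<Longrightarrow> L2 (\<lambda>x. f x - g x)"
  using L2_lincomb[of f g 1 "-1"] by simp
lemma L2_scaleR: "L2 f \<Longrightarrow> L2 (\<lambda>x. c *\<^sub>R f x)"
  using L2_lincomb[of f f c 0] by simp
lemma L2_sq_scaleR: "L2_sq (\<lambda>x. c *\<^sub>R f x) = c\<^sup>2 * L2_sq f"
  by (simp add: L2_sq_def power_mult_distrib)

lemma L2_sq_diff:
  assumes "L2 f" "L2 g" shows "L2_sq (\<lambda>x. f x - g x) = L2_sq f - 2 * L2_inner f g + L2_sq g"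
  using L2_sq_lincomb[OF assms, of 1 "-1"] by simp

text \<open>The discriminant of a nonnegative binary quadratic form. It gives the Cauchy-Schwarz inequality both
  in \<open>L\<^sup>2\<close> and for the energy form.\<close>

lemma quadratic_form_Cauchy_Schwarz:
  fixes A B C :: real
  assumes p: "\<And>a b. a\<^sup>2 * A + 2 * a * b * B + b\<^sup>2 * C \<ge> 0"
  shows "B\<^sup>2 \<le> A * C"
proof (cases "C = 0")
  case True
  have "B = 0"
  proof (rule ccontr)
    assume ne: "B \<noteq> 0"
    from p[of 1 "- (A + 1) / (2 * B)"] True ne show False by (simp add: field_simps)
  qed
  then show ?thesis by (simp add: True)
next
  case False
  then have g: "C > 0" using p[of 0 1] by simp
  from p[of C "- B"] have "C * (A * C - B\<^sup>2) \<ge> 0" by (simp add: power2_eq_square algebra_simps)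
  then show ?thesis using g by (simp add: zero_le_mult_iff)
qed

lemma L2_inner_bound:
  assumes "L2 f" "L2 g" shows "(L2_inner f g)\<^sup>2 \<le> L2_sq f * L2_sq g"
  by (rule quadratic_form_Cauchy_Schwarz) (metis L2_sq_lincomb[OF assms] L2_sq_nonneg)

lemma L2_inner_bound_sqrt:
  assumes "L2 f" "L2 g" shows "\<bar>L2_inner f g\<bar> \<le> sqrt (L2_sq f) * sqrt (L2_sq g)"
  using L2_inner_bound[OF assms] by (metis real_sqrt_abs real_sqrt_le_mono real_sqrt_mult)

lemma nn_L2_sq:
  assumes "L2 f" shows "(\<integral>\<^sup>+x. ennreal ((norm (f x))\<^sup>2) \<partial>lborel) = ennreal (L2_sq f)"
  unfolding L2_sq_def by (rule nn_integral_eq_integral) (use assms in \<open>auto simp: L2_def\<close>)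

lemma L2_iff_nn:
  assumes "f \<in> borel_measurable borel"
  shows "L2 f \<longleftrightarrow> (\<integral>\<^sup>+x. ennreal ((norm (f x))\<^sup>2) \<partial>lborel) < \<infinity>"
  using assms by (auto simp: L2_def integrable_iff_bounded)

lemma L2_sq_eq_enn2real: "f \<in> borel_measurable borel \<Longrightarrow>
    L2_sq f = enn2real (\<integral>\<^sup>+x. ennreal ((norm (f x))\<^sup>2) \<partial>lborel)"
  unfolding L2_sq_def by (rule integral_eq_nn_integral) auto

lemma L2_sq_le_nn:
  assumes "f \<in> borel_measurable borel" "(\<integral>\<^sup>+x. ennreal ((norm (f x))\<^sup>2) \<partial>lborel) \<le> ennreal c" "c \<ge> 0"
  shows "L2 f" "L2_sq f \<le> c"
proof -
  show "L2 f" using assms(2) by (subst L2_iff_nn[OF assms(1)]) (metis ennreal_less_top infinity_ennreal_def le_less_trans)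
  show "L2_sq f \<le> c" using assms unfolding L2_sq_eq_enn2real[OF assms(1)]
    by (metis enn2real_ennreal enn2real_mono ennreal_less_top)
qed

lemma L2_sq_add_le:
  assumes "L2 f" "L2 g" shows "L2_sq (\<lambda>x. f x + g x) \<le> 2 * L2_sq f + 2 * L2_sq g"
proof -
  have "L2_sq (\<lambda>x. f x + g x) + L2_sq (\<lambda>x. f x - g x) = 2 * L2_sq f + 2 * L2_sq g"
    using L2_sq_lincomb[OF assms, of 1 1] L2_sq_diff[OF assms] by simp
  then show ?thesis using L2_sq_nonneg[of "\<lambda>x. f x - g x"] by linarith
qed

lemma L2_sq_cong_AE:
  assumes "f \<in> borel_measurable borel" "g \<in> borel_measurable borel" "AE x in lborel. f x = g x"
  shows "L2_sq f = L2_sq g"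
  unfolding L2_sq_def by (rule integral_cong_AE) (use assms in \<open>auto elim!: eventually_mono\<close>)

lemma L2_cong_AE:
  assumes "L2 f" "g \<in> borel_measurable borel" "AE x in lborel. f x = g x"
  shows "L2 g"
  by (rule L2I_bound[OF assms(2) L2_integrable[OF assms(1)]]) (use assms(3) in \<open>auto elim!: eventually_mono\<close>)

lemma lborel_translate: "distr lborel borel (\<lambda>x. x + c) = (lborel :: 'a::euclidean_space measure)"
  using lborel_distr_plus[of c] by (subst add.commute) simp

lemma integral_translate:
  fixes f :: "'a::euclidean_space \<Rightarrow> 'b::{banach, second_countable_topology}"
  assumes "f \<in> borel_measurable borel"
  shows "(\<integral>x. f (x + c) \<partial>lborel) = (\<integral>x. f x \<partial>lborel)"
  using integral_distr[of "\<lambda>x. x + c" lborel borel f] assms by (simp add: lborel_translate)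

lemma integrable_translate:
  fixes f :: "'a::euclidean_space \<Rightarrow> 'b::{banach, second_countable_topology}"
  assumes "f \<in> borel_measurable borel"
  shows "integrable lborel (\<lambda>x. f (x + c)) \<longleftrightarrow> integrable lborel f"
  using integrable_distr_eq[of "\<lambda>x. x + c" lborel borel f] assms by (simp add: lborel_translate)

lemma nn_integral_translate:
  assumes "f \<in> borel_measurable borel"
  shows "(\<integral>\<^sup>+x. f (x + c) \<partial>lborel) = (\<integral>\<^sup>+x. f x \<partial>(lborel :: 'a::euclidean_space measure))"
  using nn_integral_distr[of "\<lambda>x. x + c" lborel borel f] assms by (simp add: lborel_translate)

lemma L2_translate: "L2 f \<Longrightarrow> L2 (\<lambda>x. f (x + c))"
  using integrable_translate[of "\<lambda>x. (norm (f x))\<^sup>2" c] by (auto simp: L2_def)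

lemma L2_sq_translate: "L2 f \<Longrightarrow> L2_sq (\<lambda>x. f (x + c)) = L2_sq f"
  using integral_translate[of "\<lambda>x. (norm (f x))\<^sup>2" c] by (auto simp: L2_sq_def L2_def)

text \<open>Coordinatewise, from the corresponding fact for real functions.\<close>

lemma lebesgue_measurable_borel_representative:
  fixes f :: "'a::euclidean_space \<Rightarrow> 'b::euclidean_space"
  assumes f: "f \<in> borel_measurable lebesgue"
  obtains g where "g \<in> borel_measurable borel" "AE x in lborel. f x = g x"
proof -
  have "\<exists>g. g \<in> borel_measurable borel \<and> (AE x in lborel. f x \<bullet> b = g x)" for b
    using completion_ex_borel_measurable_real[of "\<lambda>x. f x \<bullet> b" lborel] f by auto
  then have "\<forall>b. \<exists>g. g \<in> borel_measurable borel \<and> (AE x in lborel. f x \<bullet> b = g x)" by blast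
  from choice[OF this] obtain h
    where h: "\<And>b. h b \<in> borel_measurable borel" "\<And>b. AE x in lborel. f x \<bullet> b = h b x"
    by blast
  show ?thesis
  proof
    show "(\<lambda>x. \<Sum>b\<in>Basis. h b x *\<^sub>R b) \<in> borel_measurable borel"
      using h(1) by (intro borel_measurable_sum borel_measurable_scaleR) auto
    have "AE x in lborel. \<forall>b\<in>Basis. f x \<bullet> b = h b x"
      using h(2) by (intro AE_finite_allI) auto
    then show "AE x in lborel. f x = (\<Sum>b\<in>Basis. h b x *\<^sub>R b)"
    proof eventually_elim
      case (elim x)
      have "(\<Sum>b\<in>Basis. (f x \<bullet> b) *\<^sub>R b) = (\<Sum>b\<in>Basis. h b x *\<^sub>R b)"
        by (rule sum.cong[OF refl]) (simp only: elim[rule_format])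
      then show ?case by (simp only: euclidean_representation)
    qed
  qed
qed

text \<open>Completeness of \<open>L\<^sup>2\<close>. By \<open>\<Sum>\<^sub>n 4\<^sup>n a\<^sub>n\<^sup>2 < \<infinity>\<close> almost everywhere, the increments \<open>a\<^sub>n\<close> of a rapidly
  convergent sequence are dominated by a geometric series, so the sequence converges pointwise; Fatou's
  lemma turns this into convergence in the mean. The pointwise convergence is part of the conclusion
  because it identifies the limit with limits obtained in other ways.\<close>

lemma L2_complete:
  fixes f :: "nat \<Rightarrow> 'a::euclidean_space \<Rightarrow> 'b::euclidean_space"
  assumes f: "\<And>n. L2 (f n)" and C: "\<And>n. L2_sq (\<lambda>x. f (Suc n) x - f n x) \<le> (1/8)^n"
  obtains g where "L2 g" "AE x in lborel. (\<lambda>n. f n x) \<longlonglongrightarrow> g x" "(\<lambda>n. L2_sq (\<lambda>x. f n x - g x)) \<longlonglongrightarrow> 0"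
proof -
  have fm[measurable]: "\<And>n. f n \<in> borel_measurable borel" using f by (auto simp: L2_def)
  define d where "d n x = (norm (f (Suc n) x - f n x))\<^sup>2" for n x
  have [measurable]: "d n \<in> borel_measurable borel" for n unfolding d_def by measurable
  have dn: "(\<integral>\<^sup>+x. ennreal (d n x) \<partial>lborel) \<le> ennreal ((1/8)^n)" for n
    unfolding d_def using nn_L2_sq[OF L2_diff[OF f f]] C by (simp add: ennreal_leI)
  \<comment> \<open>The weight \<open>4\<^sup>n\<close> still leaves a geometric series, and a bound for \<open>4\<^sup>n d\<^sub>n\<close> makes the increments \<open>O(2\<^sup>-\<^sup>n)\<close>.\<close>
  have "(\<integral>\<^sup>+x. (\<Sum>n. ennreal (4^n * d n x)) \<partial>lborel) = (\<Sum>n. \<integral>\<^sup>+x. ennreal (4^n * d n x) \<partial>lborel)"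
    by (rule nn_integral_suminf) auto
  also have "\<dots> \<le> (\<Sum>n. ennreal ((1/2)^n))"
  proof (rule suminf_le)
    fix n
    have "(\<integral>\<^sup>+x. ennreal (4^n * d n x) \<partial>lborel) = ennreal (4^n) * (\<integral>\<^sup>+x. ennreal (d n x) \<partial>lborel)"
      by (subst nn_integral_cmult[symmetric]) (auto simp: ennreal_mult' d_def)
    also have "\<dots> \<le> ennreal (4^n) * ennreal ((1/8)^n)" by (intro mult_left_mono dn) auto
    also have "\<dots> = ennreal ((1/2)^n)" by (simp add: ennreal_mult'[symmetric] power_mult_distrib[symmetric])
    finally show "(\<integral>\<^sup>+x. ennreal (4^n * d n x) \<partial>lborel) \<le> ennreal ((1/2)^n)" .
  qed auto
  also have "\<dots> = ennreal (\<Sum>n. (1/2)^n)" by (intro suminf_ennreal_eq) (auto intro!: summable_sums)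
  also have "\<dots> < \<infinity>" by simp
  finally have fin: "(\<integral>\<^sup>+x. (\<Sum>n. ennreal (4^n * d n x)) \<partial>lborel) < \<infinity>" .
  have "AE x in lborel. (\<Sum>n. ennreal (4^n * d n x)) \<noteq> \<infinity>"
    by (rule nn_integral_PInf_AE) (use fin in auto)
  then have conv: "AE x in lborel. convergent (\<lambda>n. f n x)"
  proof eventually_elim
    case (elim x)
    have "summable (\<lambda>n. 4^n * d n x)"
      using elim by (intro summable_suminf_not_top) (auto simp: d_def)
    then have "(\<lambda>n. 4^n * d n x) \<longlonglongrightarrow> 0" by (rule summable_LIMSEQ_zero)
    then have "Bseq (\<lambda>n. 4^n * d n x)" by (intro convergent_imp_Bseq convergentI)
    then obtain B where B: "\<And>n. 4^n * d n x \<le> B" "B > 0"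
      unfolding Bseq_def by (metis abs_le_D1 real_norm_def)
    have nb: "norm (f (Suc n) x - f n x) \<le> sqrt B * (1/2)^n" for n
    proof (rule power2_le_imp_le)
      have "(2::real) ^ n * 2 ^ n = 4 ^ n" by (simp flip: power_mult_distrib)
      then have "(sqrt B * (1/2)^n)\<^sup>2 = B / 4^n"
        using B(2) by (simp add: power_mult_distrib power_divide power2_eq_square)
      moreover have "(norm (f (Suc n) x - f n x))\<^sup>2 \<le> B / 4^n"
        using B(1)[of n] by (simp add: d_def field_simps)
      ultimately show "(norm (f (Suc n) x - f n x))\<^sup>2 \<le> (sqrt B * (1/2)^n)\<^sup>2" by simp
    qed (use B in auto)
    have "summable (\<lambda>n. f (Suc n) x - f n x)"
      by (rule summable_comparison_test'[where g="\<lambda>n. sqrt B * (1/2)^n"]) (auto intro!: summable_mult nb)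
    then have "convergent (\<lambda>n. (f n x - f 0 x) + f 0 x)"
      by (intro convergent_add convergent_const) (simp add: summable_iff_convergent sum_lessThan_telescope[of "\<lambda>n. f n x"])
    then show "convergent (\<lambda>n. f n x)" by simp
  qed
  define g where "g x = lim (\<lambda>n. f n x)" for x
  have gm: "g \<in> borel_measurable borel" unfolding g_def by (rule borel_measurable_lim_metric) simp
  have gl: "AE x in lborel. (\<lambda>n. f n x) \<longlonglongrightarrow> g x"
    using conv by eventually_elim (auto simp: g_def convergent_LIMSEQ_iff)
  have far: "L2_sq (\<lambda>x. f (n+m) x - f n x) \<le> 16 * (1/4)^n * (1 - (1/4)^m)" for n m
  proof (induction m arbitrary: n)
    case 0 show ?case by (simp add: L2_sq_def)
  next
    case (Suc m)
    have "L2_sq (\<lambda>x. f (n+Suc m) x - f n x) = L2_sq (\<lambda>x. (f (Suc n + m) x - f (Suc n) x) + (f (Suc n) x - f n x))" by simp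
    also have "\<dots> \<le> 2 * L2_sq (\<lambda>x. f (Suc n + m) x - f (Suc n) x) + 2 * L2_sq (\<lambda>x. f (Suc n) x - f n x)"
      by (intro L2_sq_add_le L2_diff f)
    also have "\<dots> \<le> 2 * (16 * (1/4)^(Suc n) * (1 - (1/4)^m)) + 2 * (1/8)^n"
      using Suc.IH[of "Suc n"] C[of n] by linarith
    also have "\<dots> \<le> 2 * (16 * (1/4)^(Suc n) * (1 - (1/4)^m)) + 2 * (1/4)^n"
      by (intro add_left_mono mult_left_mono power_mono) auto
    also have "\<dots> \<le> 16 * (1/4)^n * (1 - (1/4)^Suc m)" 
    proof -
      have "(1/4)^n * (1/4)^m \<ge> (0::real)" "(1/4)^n \<ge> (0::real)" by auto
      then show ?thesis by (simp add: algebra_simps)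
    qed
    finally show ?case .
  qed
  have lim: "(\<integral>\<^sup>+x. ennreal ((norm (f n x - g x))\<^sup>2) \<partial>lborel) \<le> ennreal (16 * (1/4)^n)" for n
  proof -
    have "(\<integral>\<^sup>+x. ennreal ((norm (f n x - g x))\<^sup>2) \<partial>lborel)
        = (\<integral>\<^sup>+x. liminf (\<lambda>m. ennreal ((norm (f n x - f (n + m) x))\<^sup>2)) \<partial>lborel)"
    proof (rule nn_integral_cong_AE, use gl in eventually_elim)
      case (elim x)
      have lim: "(\<lambda>m. ennreal ((norm (f n x - f (n + m) x))\<^sup>2)) \<longlonglongrightarrow> ennreal ((norm (f n x - g x))\<^sup>2)"
        using LIMSEQ_ignore_initial_segment[OF elim, of n] by (intro tendsto_intros) (simp add: add.commute)
      show ?case by (rule lim_imp_Liminf[symmetric, OF sequentially_bot lim])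
    qed
    also have "\<dots> \<le> liminf (\<lambda>m. \<integral>\<^sup>+x. ennreal ((norm (f n x - f (n + m) x))\<^sup>2) \<partial>lborel)"
      by (rule nn_integral_liminf) auto
    also have "\<dots> \<le> liminf (\<lambda>m::nat. ennreal (16 * (1/4)^n))"
    proof (intro Liminf_mono always_eventually allI)
      fix m
      have "(\<integral>\<^sup>+x. ennreal ((norm (f n x - f (n + m) x))\<^sup>2) \<partial>lborel) = ennreal (L2_sq (\<lambda>x. f (n+m) x - f n x))"
        using nn_L2_sq[OF L2_diff[OF f f], of "n+m" n] by (simp add: norm_minus_commute)
      also have "\<dots> \<le> ennreal (16 * (1/4)^n)" 
      proof (rule ennreal_leI)
        have "16 * (1/4)^n * (1 - (1/4)^m) \<le> 16 * (1/4::real)^n * 1" by (intro mult_left_mono) auto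
        then show "L2_sq (\<lambda>x. f (n+m) x - f n x) \<le> 16 * (1/4)^n" using far[of n m] by linarith
      qed
      finally show "(\<integral>\<^sup>+x. ennreal ((norm (f n x - f (n + m) x))\<^sup>2) \<partial>lborel) \<le> ennreal (16 * (1/4)^n)" .
    qed
    finally show ?thesis by (simp add: Liminf_const)
  qed
  have d: "L2 (\<lambda>x. f n x - g x)" "L2_sq (\<lambda>x. f n x - g x) \<le> 16 * (1/4)^n" for n
    using L2_sq_le_nn[OF _ lim[of n]] gm fm[of n] by auto
  have "L2 (\<lambda>x. f 0 x - (f 0 x - g x))" by (intro L2_diff d f)
  then have "L2 g" by simp
  moreover have "(\<lambda>n. L2_sq (\<lambda>x. f n x - g x)) \<longlonglongrightarrow> 0"
  proof (rule tendsto_sandwich[of "\<lambda>_. 0" _ _ "\<lambda>n. 16 * (1/4)^n"])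
    show "(\<lambda>n. 16 * (1/4::real)^n) \<longlonglongrightarrow> 0" by (intro tendsto_mult_right_zero LIMSEQ_realpow_zero) auto
    show "\<forall>\<^sub>F n in sequentially. L2_sq (\<lambda>x. f n x - g x) \<le> 16 * (1/4)^n" using d(2) by auto
  qed (auto simp: L2_sq_nonneg)
  ultimately show ?thesis using gl that by blast
qed

section \<open>Test functions\<close>

text \<open>The functions \<open>P(1/x) exp(-1/x)\<close>, continued by zero to \<open>x \<le> 0\<close>. With all polynomials \<open>P\<close> the family is
  closed under differentiation, which makes its members smooth.\<close>

definition flat_exp :: "real poly \<Rightarrow> real \<Rightarrow> real" where
  "flat_exp P x = (if x > 0 then poly P (1 / x) * exp (- (1 / x)) else 0)"

lemma poly_times_exp_tendsto_0:
  "((\<lambda>t. t ^ m * poly P t * exp (- t)) \<longlongrightarrow> (0::real)) at_top"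
proof (induction P arbitrary: m)
  case 0 then show ?case by simp
next
  case (pCons a P)
  have 1: "((\<lambda>t::real. a * (t ^ m / exp t)) \<longlongrightarrow> a * 0) at_top"
    by (intro tendsto_mult_left tendsto_power_div_exp_0)
  have "((\<lambda>t::real. a * (t ^ m / exp t) + t ^ Suc m * poly P t * exp (- t)) \<longlongrightarrow> a * 0 + 0) at_top"
    by (intro tendsto_add 1 pCons.IH)
  then show ?case by (simp add: algebra_simps exp_minus divide_inverse)
qed

lemma flat_exp_tendsto_0: "(flat_exp P \<longlongrightarrow> 0) (at_right 0)"
proof -
  have "((\<lambda>x. poly P (1/x) * exp (- (1/x))) \<longlongrightarrow> 0) (at_right (0::real))"
    using poly_times_exp_tendsto_0[of 0 P] filterlim_compose[of "\<lambda>t. poly P t * exp (- t)" "nhds 0" at_top "\<lambda>x. 1/x" "at_right 0"]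
    by (simp add: filterlim_inverse_at_top_right divide_inverse)
  then show ?thesis
    by (rule Lim_transform_eventually)
      (auto simp: flat_exp_def eventually_at_filter)
qed

lemma flat_exp_deriv:
  "(flat_exp P has_real_derivative flat_exp ([:0,0,1:] * (P - pderiv P)) x) (at x)"
proof (cases x "0::real" rule: linorder_cases)
  case less
  have "((\<lambda>_. 0) has_real_derivative 0) (at x)" by simp
  then have "(flat_exp P has_real_derivative 0) (at x)"
    by (rule DERIV_cong_ev[THEN iffD1, rotated -1])
       (use less in \<open>auto simp: flat_exp_def intro!: eventually_mono[OF eventually_nhds_in_open[of "{..<0}" x]]\<close>)
  then show ?thesis using less by (simp add: flat_exp_def)
next
  case greater
  have "((\<lambda>x. poly P (1/x) * exp (- (1/x))) has_real_derivative
      (flat_exp ([:0,0,1:] * (P - pderiv P)) x)) (at x)"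
    using greater
    by (auto intro!: derivative_eq_intros simp: flat_exp_def power2_eq_square divide_simps algebra_simps)
  then show ?thesis
    by (rule DERIV_cong_ev[THEN iffD1, rotated -1])
       (use greater in \<open>auto simp: flat_exp_def intro!: eventually_mono[OF eventually_nhds_in_open[of "{0<..}" x]]\<close>)
next
  case equal
  have l: "((\<lambda>h. flat_exp P h / h) \<longlongrightarrow> 0) (at_left 0)"
    by (rule tendsto_eventually) (auto simp: flat_exp_def eventually_at_filter)
  have r: "((\<lambda>h. flat_exp P h / h) \<longlongrightarrow> 0) (at_right 0)"
    by (rule Lim_transform_eventually[OF flat_exp_tendsto_0[of "pCons 0 P"]])
       (auto simp: flat_exp_def eventually_at_filter field_simps)
  have "((\<lambda>h. flat_exp P h / h) \<longlongrightarrow> 0) (at 0)"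
    by (rule filterlim_split_at[OF l r])
  then show ?thesis using equal by (simp add: has_field_derivative_iff flat_exp_def)
qed

text \<open>An algebra of functions that is closed under partial derivatives, so that smoothness of its members
  needs no computation of higher derivatives. It contains the product bumps.\<close>

inductive smooth_alg :: "(real^'n::finite \<Rightarrow> real) \<Rightarrow> bool" where
  base: "smooth_alg (\<lambda>x. flat_exp P (c * x $ i + d))"
| const: "smooth_alg (\<lambda>_. c)"
| add: "smooth_alg f \<Longrightarrow> smooth_alg g \<Longrightarrow> smooth_alg (\<lambda>x. f x + g x)"
| mult: "smooth_alg f \<Longrightarrow> smooth_alg g \<Longrightarrow> smooth_alg (\<lambda>x. f x * g x)"

lemma partial_derivI:
  "(f has_derivative f') (at x) \<Longrightarrow> partial_deriv i f x = f' (axis i 1)"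
  unfolding partial_deriv_def by (metis frechet_derivative_at)

lemma smooth_alg_closed:
  fixes f :: "real^'n::finite \<Rightarrow> real"
  shows "smooth_alg f \<Longrightarrow> f differentiable_on UNIV \<and> (\<forall>i. smooth_alg (partial_deriv i f))"
proof (induction rule: smooth_alg.induct)
  case (base P c i d)
  let ?D = "[:0,0,1:] * (P - pderiv P)"
  have D: "((\<lambda>x. flat_exp P (c * x $ i + d)) has_derivative (\<lambda>h. flat_exp ?D (c * x $ i + d) * (c * h $ i))) (at x)" for x
    by (rule has_derivative_compose[of "\<lambda>x. c * x $ i + d" "\<lambda>h. c * h $ i" x UNIV "flat_exp P" "\<lambda>y. flat_exp ?D (c * x $ i + d) * y"])
       (use flat_exp_deriv[of P "c * x $ i + d"] in \<open>auto intro!: derivative_eq_intros bounded_linear_imp_has_derivative bounded_linear_vec_nth simp: has_field_derivative_def\<close>)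
  have "partial_deriv j (\<lambda>x. flat_exp P (c * x $ i + d)) = (\<lambda>x. (c * axis j 1 $ i) * flat_exp ?D (c * x $ i + d))" for j
    by (rule ext) (simp add: partial_derivI[OF D] mult.commute)
  then show ?case using D
    by (auto simp: differentiable_on_def differentiable_def intro: has_derivative_at_withinI
        intro!: smooth_alg.mult smooth_alg.const smooth_alg.base)
next
  case (const c)
  have "partial_deriv j (\<lambda>x::real^'n. c) = (\<lambda>x. 0)" for j :: 'n
    by (rule ext, rule partial_derivI) auto
  then show ?case by (auto intro: smooth_alg.const)
next
  case (add f g)
  then have D: "(f has_derivative frechet_derivative f (at x)) (at x)" "(g has_derivative frechet_derivative g (at x)) (at x)" for x
    by (auto simp: differentiable_on_def frechet_derivative_works)
  have "partial_deriv j (\<lambda>x. f x + g x) = (\<lambda>x. partial_deriv j f x + partial_deriv j g x)" for j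
    by (rule ext) (subst partial_derivI[OF has_derivative_add[OF D]], simp add: partial_deriv_def)
  then show ?case using add by (auto intro: smooth_alg.add)
next
  case (mult f g)
  then have D: "(f has_derivative frechet_derivative f (at x)) (at x)" "(g has_derivative frechet_derivative g (at x)) (at x)" for x
    by (auto simp: differentiable_on_def frechet_derivative_works)
  have "partial_deriv j (\<lambda>x. f x * g x) = (\<lambda>x. f x * partial_deriv j g x + partial_deriv j f x * g x)" for j
    by (rule ext) (subst partial_derivI[OF has_derivative_mult[OF D]], simp add: partial_deriv_def)
  moreover have "(\<lambda>x. f x * g x) differentiable_on UNIV"
    using has_derivative_mult[OF D] by (auto simp: differentiable_on_def differentiable_def)
  ultimately show ?case using mult
    by (simp add: smooth_alg.add[OF smooth_alg.mult smooth_alg.mult])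
qed

lemma smooth_alg_imp_smooth: "smooth_alg f \<Longrightarrow> smooth f"
proof -
  assume f: "smooth_alg f"
  have "smooth_alg (foldr partial_deriv js f)" for js
    by (induction js) (use f smooth_alg_closed in auto)
  then show ?thesis using smooth_alg_closed by (auto simp: smooth_def)
qed

lemma smooth_alg_prod:
  "finite A \<Longrightarrow> (\<And>i. i \<in> A \<Longrightarrow> smooth_alg (f i)) \<Longrightarrow> smooth_alg (\<lambda>x. \<Prod>i\<in>A. f i x)"
  by (induction rule: finite_induct) (auto intro: smooth_alg.const smooth_alg.mult)

text \<open>A product of one-dimensional flat exponentials. As \<open>m\<close> grows it increases to the indicator of the open
  box, which gives enough test functions without mollification.\<close>

definition bump :: "real \<Rightarrow> real^'n::finite \<Rightarrow> real^'n \<Rightarrow> real^'n \<Rightarrow> real" where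
  "bump m a b x = (\<Prod>i\<in>UNIV. flat_exp 1 (m * x $ i + - (m * a $ i)) * flat_exp 1 (- m * x $ i + m * b $ i))"

lemma flat_exp_1_bounds: "0 \<le> flat_exp 1 y" "flat_exp 1 y \<le> 1"
  by (auto simp: flat_exp_def)

lemma bump_bounds: "0 \<le> bump m a b x" "bump m a b x \<le> 1"
  unfolding bump_def
  by (auto intro!: prod_nonneg prod_le_1 mult_nonneg_nonneg mult_le_one flat_exp_1_bounds)

lemma bump_outside:
  assumes "m > 0" "x \<notin> box a b" shows "bump m a b x = 0"
proof -
  from assms(2) obtain i where "x $ i \<le> a $ i \<or> b $ i \<le> x $ i" by (auto simp: mem_box_cart not_less)
  then have "flat_exp 1 (m * x $ i + - (m * a $ i)) * flat_exp 1 (- m * x $ i + m * b $ i) = 0"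
    using assms(1) by (auto simp: flat_exp_def)
  then show ?thesis unfolding bump_def by (meson UNIV_I finite prod_zero)
qed

lemma test_function_bump:
  assumes "m > 0" shows "test_function (bump m a b)"
  unfolding test_function_def
proof
  show "smooth (bump m a b)"
    unfolding bump_def[abs_def]
    by (intro smooth_alg_imp_smooth smooth_alg_prod smooth_alg.mult smooth_alg.base) auto
  have "{x. bump m a b x \<noteq> 0} \<subseteq> cbox a b"
    using bump_outside[OF assms, of _ a b] box_subset_cbox[of a b] by auto
  then show "compact (closure {x. bump m a b x \<noteq> 0})"
    by (meson bounded_cbox bounded_subset compact_closure)
qed

lemma bump_tendsto: "(\<lambda>m. bump (real (Suc m)) a b x) \<longlonglongrightarrow> indicator (box a b) x"
proof (cases "x \<in> box a b")
  case False
  then show ?thesis by (simp add: bump_outside)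
next
  case True
  have 1: "(\<lambda>m. flat_exp 1 (real (Suc m) * y)) \<longlonglongrightarrow> 1" if "y > 0" for y
  proof -
    have "(\<lambda>m. exp (- ((1/y) * inverse (real (Suc m))))) \<longlonglongrightarrow> exp (- ((1/y) * 0))"
      by (intro tendsto_intros LIMSEQ_inverse_real_of_nat)
    moreover have "flat_exp 1 (real (Suc m) * y) = exp (- ((1/y) * inverse (real (Suc m))))" for m
      using that by (simp add: flat_exp_def divide_inverse mult_ac)
    ultimately show ?thesis by simp
  qed
  have "(\<lambda>m. bump (real (Suc m)) a b x) \<longlonglongrightarrow> (\<Prod>i\<in>(UNIV::'a set). 1 * 1)"
    unfolding bump_def
  proof (intro tendsto_prod tendsto_mult)
    fix i
    show "(\<lambda>m. flat_exp 1 (real (Suc m) * x $ i + - (real (Suc m) * a $ i))) \<longlonglongrightarrow> 1"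
      using 1[of "x $ i - a $ i"] True by (simp add: mem_box_cart algebra_simps)
    show "(\<lambda>m. flat_exp 1 (- real (Suc m) * x $ i + real (Suc m) * b $ i)) \<longlonglongrightarrow> 1"
      using 1[of "b $ i - x $ i"] True by (simp add: mem_box_cart algebra_simps)
  qed
  then show ?thesis using True by simp
qed

lemma smooth_partial_deriv: "smooth f \<Longrightarrow> smooth (partial_deriv i f)"
  unfolding smooth_def
proof
  fix js assume "\<forall>js. foldr partial_deriv js f differentiable_on UNIV"
  then have "foldr partial_deriv (js @ [i]) f differentiable_on UNIV" by blast
  then show "foldr partial_deriv js (partial_deriv i f) differentiable_on UNIV" by simp
qed

lemma smooth_differentiable: "smooth f \<Longrightarrow> f differentiable (at x)"
  unfolding smooth_def by (drule spec[of _ "[]"]) (simp add: differentiable_on_def)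

lemma smooth_continuous: "smooth f \<Longrightarrow> continuous_on UNIV f"
  unfolding smooth_def by (drule spec[of _ "[]"]) (simp add: differentiable_imp_continuous_on)

lemma smooth_has_derivative:
  assumes "smooth f"
  shows "(f has_derivative (\<lambda>h. \<Sum>i\<in>UNIV. h $ i * partial_deriv i f x)) (at x)"
proof -
  have D: "(f has_derivative frechet_derivative f (at x)) (at x)"
    using smooth_differentiable[OF assms] by (simp add: frechet_derivative_works)
  then have lin: "linear (frechet_derivative f (at x))" by (rule has_derivative_linear)
  have "frechet_derivative f (at x) h = (\<Sum>i\<in>UNIV. h $ i * partial_deriv i f x)" for h
  proof -
    have "frechet_derivative f (at x) h = frechet_derivative f (at x) (\<Sum>i\<in>UNIV. h $ i *\<^sub>R axis i 1)"
      by (simp add: basis_expansion flip: scalar_mult_eq_scaleR)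
    also have "\<dots> = (\<Sum>i\<in>UNIV. h $ i * partial_deriv i f x)"
      by (simp add: linear_sum[OF lin] linear_scale[OF lin] partial_deriv_def)
    finally show ?thesis .
  qed
  then have "frechet_derivative f (at x) = (\<lambda>h. \<Sum>i\<in>UNIV. h $ i * partial_deriv i f x)" by blast
  with D show ?thesis by simp
qed

lemma test_function_support:
  assumes "test_function f"
  obtains r where "r > 0" "\<And>x. norm x \<ge> r \<Longrightarrow> f x = 0" "\<And>x i. norm x \<ge> r \<Longrightarrow> partial_deriv i f x = 0"
proof -
  have "bounded (closure {x. f x \<noteq> 0})" using assms compact_imp_bounded by (auto simp: test_function_def)
  then have "bounded {x. f x \<noteq> 0}" using bounded_subset closure_subset by blast
  then obtain r where r: "\<And>x. f x \<noteq> 0 \<Longrightarrow> norm x \<le> r" by (auto simp: bounded_iff)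
  have z: "f x = 0" if "norm x > r" for x using r[of x] that by fastforce
  have "partial_deriv i f x = 0" if "norm x > r" for x i
  proof -
    have "open {x::real^'a. r < norm x}" by (intro open_Collect_less continuous_intros)
    then have "\<forall>\<^sub>F y in nhds x. f y = 0"
      using that z by (intro eventually_mono[OF eventually_nhds_in_open[of "{x. norm x > r}" x]]) auto
    then have "(f has_derivative (\<lambda>_. 0)) (at x)"
      using has_derivative_transform_eventually[of "\<lambda>_. 0" "\<lambda>_. 0" x UNIV f] that z
      by (auto simp: eventually_nhds_conv_at elim!: eventually_mono)
    then show ?thesis by (simp add: partial_derivI)
  qed
  with z show ?thesis by (intro that[of "max 1 (r + 1)"]) auto
qed

lemma test_function_partial_deriv:
  assumes "test_function f" shows "test_function (partial_deriv i f)"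
proof -
  obtain r where r: "\<And>x. norm x \<ge> r \<Longrightarrow> partial_deriv i f x = 0"
    using test_function_support[OF assms] by metis
  have "{x. partial_deriv i f x \<noteq> 0} \<subseteq> cball 0 r" 
  proof
    fix x assume "x \<in> {x. partial_deriv i f x \<noteq> 0}"
    then have "\<not> norm x \<ge> r" using r by auto
    then show "x \<in> cball 0 r" by simp
  qed
  then have "bounded {x. partial_deriv i f x \<noteq> 0}" using bounded_cball bounded_subset by blast
  then show ?thesis using assms smooth_partial_deriv unfolding test_function_def by auto
qed

lemma test_function_bounded:
  assumes "test_function f" obtains M where "M \<ge> 0" "\<And>x. \<bar>f x\<bar> \<le> M"
proof -
  obtain r where r: "r > 0" "\<And>x. norm x \<ge> r \<Longrightarrow> f x = 0" using test_function_support[OF assms] by metis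
  have "continuous_on (cball 0 r) f"
    using assms smooth_continuous continuous_on_subset unfolding test_function_def by blast
  then have "bounded (f ` cball 0 r)" by (intro compact_imp_bounded compact_continuous_image) auto
  then have "\<exists>M. \<forall>x. norm x \<le> r \<longrightarrow> \<bar>f x\<bar> \<le> M"
    unfolding bounded_iff by (metis imageI mem_cball_0 real_norm_def)
  then obtain M where M: "\<And>x. norm x \<le> r \<Longrightarrow> \<bar>f x\<bar> \<le> M" by blast
  show ?thesis
  proof (rule that[of "max M 0"])
    show "\<bar>f x\<bar> \<le> max M 0" for x using M[of x] r(2)[of x] by (cases "norm x \<le> r") auto
  qed auto
qed

lemma test_function_measurable: "test_function f \<Longrightarrow> f \<in> borel_measurable borel"
  using smooth_continuous borel_measurable_continuous_onI by (auto simp: test_function_def)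

text \<open>The Frechet derivative is chosen among the linear maps with the derivative property, and translation does not change which maps have it.\<close>

lemma foldr_partial_deriv_translate:
  "foldr partial_deriv js (\<lambda>x. f (x + c)) = (\<lambda>x. foldr partial_deriv js f (x + c))"
proof (induction js)
  case (Cons i js)
  have "partial_deriv i (\<lambda>x. g (x + c)) = (\<lambda>x. partial_deriv i g (x + c))" for g :: "real^'a \<Rightarrow> real"
  proof
    fix x
    have "(g has_derivative D) (at (x + c)) \<longleftrightarrow> ((\<lambda>x. g (x + c)) has_derivative D) (at x)" for D
    proof -
      have s: "((\<lambda>x. x + e) has_derivative (\<lambda>h. h)) (at y)" for e y :: "real^'a"
        by (rule has_derivative_eq_rhs[OF has_derivative_add[OF has_derivative_ident has_derivative_const]]) simp
      show ?thesis
        using has_derivative_compose[OF s, of g D x c]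
          has_derivative_compose[OF s, of "\<lambda>x. g (x + c)" D "x + c" "- c"] by auto
    qed
    then show "partial_deriv i (\<lambda>x. g (x + c)) x = partial_deriv i g (x + c)"
      by (simp add: partial_deriv_def frechet_derivative_def)
  qed
  then show ?case using Cons by simp
qed simp

lemma test_function_translate:
  assumes "test_function f" shows "test_function (\<lambda>x. f (x + c))"
proof -
  have "smooth (\<lambda>x. f (x + c))"
    unfolding smooth_def foldr_partial_deriv_translate
  proof
    fix js
    have "foldr partial_deriv js f differentiable (at (x + c))" for x
      using assms by (auto simp: test_function_def smooth_def differentiable_on_def)
    then show "(\<lambda>x. foldr partial_deriv js f (x + c)) differentiable_on UNIV"
      unfolding differentiable_on_def
      by (intro ballI differentiable_compose[of "foldr partial_deriv js f" "\<lambda>x. x + c"]) auto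
  qed
  moreover
  obtain r where r: "\<And>x. norm x \<ge> r \<Longrightarrow> f x = 0" using test_function_support[OF assms] by metis
  have "norm x \<le> r + norm c" if "f (x + c) \<noteq> 0" for x
  proof -
    have "norm (x + c) < r" using r that by (meson not_less)
    then show ?thesis using norm_triangle_ineq4[of "x + c" c] by simp
  qed
  then have "bounded {x. f (x + c) \<noteq> 0}" unfolding bounded_iff by blast
  ultimately show ?thesis unfolding test_function_def by auto
qed

lemma partial_deriv_translate: "partial_deriv i (\<lambda>x. f (x + c)) x = partial_deriv i f (x + c)"
  using foldr_partial_deriv_translate[of "[i]" f c] by (simp add: fun_eq_iff)

section \<open>The fundamental lemma of the calculus of variations\<close>

text \<open>The sets over which the integral vanishes form a Dynkin system that contains the boxes, and boxes are
  stable under intersection.\<close>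

lemma AE_zero_if_box_integrals_zero:
  fixes w :: "real^'n::finite \<Rightarrow> 'b::euclidean_space"
  assumes w: "integrable lborel w" and 0: "\<And>a b. (\<integral>x. indicator (box a b) x *\<^sub>R w x \<partial>lborel) = 0"
  shows "AE x in lborel. w x = 0"
proof (rule sigma_finite_measure.density_zero[OF sigma_finite_lborel w])
  fix A :: "(real^'n) set" assume "A \<in> sets lborel"
  then have A: "A \<in> sigma_sets UNIV (range (\<lambda>(a, b). box a b))" by (simp add: borel_eq_box)
  have int: "integrable lborel (\<lambda>x. indicator B x *\<^sub>R w x)" if "B \<in> sets borel" for B
    using that w by (intro integrable_mult_indicator) auto
  have univ: "(\<integral>x. w x \<partial>lborel) = 0"
  proof -
    let ?B = "\<lambda>n::nat. box (- real n *\<^sub>R (1::real^'n)) (real n *\<^sub>R 1)"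
    have "(\<lambda>n. \<integral>x. indicator (?B n) x *\<^sub>R w x \<partial>lborel) \<longlonglongrightarrow> (\<integral>x. w x \<partial>lborel)"
    proof (rule integral_dominated_convergence[where w="\<lambda>x. norm (w x)"])
      show "AE x in lborel. (\<lambda>n. indicator (?B n) x *\<^sub>R w x) \<longlonglongrightarrow> w x"
      proof (rule AE_I2, rule tendsto_eventually)
        fix x :: "real^'n"
        have "x \<in> ?B n" if "n > norm x" for n
          using that component_le_norm_cart[of x] by (auto simp: mem_box_cart abs_less_iff) (smt (verit))+
        then show "\<forall>\<^sub>F n in sequentially. indicator (?B n) x *\<^sub>R w x = w x"
        proof (intro eventually_mono[OF eventually_gt_at_top[of "nat \<lceil>norm x\<rceil>"]])
          fix n :: nat assume "nat \<lceil>norm x\<rceil> < n"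
          then have "norm x < n" by linarith
          then have "x \<in> ?B n" using \<open>\<And>n. norm x < real n \<Longrightarrow> x \<in> ?B n\<close> by blast
          then show "indicator (?B n) x *\<^sub>R w x = w x" by (simp only: indicator_simps scaleR_one)
        qed
      qed
      show "AE x in lborel. norm (indicator (?B n) x *\<^sub>R w x) \<le> norm (w x)" for n
        by (auto simp: indicator_def)
    qed (use w in auto)
    then show ?thesis by (simp add: 0 LIMSEQ_const_iff)
  qed
  have int_stable: "Int_stable (range (\<lambda>(a, b). box a b :: (real^'n) set))"
    by (auto simp: Int_stable_def box_Int_box)
  have "(\<integral>x. indicator A x *\<^sub>R w x \<partial>lborel) = 0"
    using int_stable subset_UNIV[of "range (\<lambda>(a, b). box a b :: (real^'n) set)", folded Pow_UNIV] A
  proof (induction rule: sigma_sets_induct_disjoint)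
    case (basic A) then show ?case using 0 by auto
  next
    case empty show ?case by simp
  next
    case (compl A)
    then have A: "A \<in> sets borel" by (simp add: borel_eq_box)
    have "(\<integral>x. indicator (UNIV - A) x *\<^sub>R w x \<partial>lborel) = (\<integral>x. w x - indicator A x *\<^sub>R w x \<partial>lborel)"
      by (intro Bochner_Integration.integral_cong) (auto simp: indicator_def)
    also have "\<dots> = 0" using compl univ int[OF A] w by simp
    finally show ?case .
  next
    case (union A)
    then have A: "\<And>i. A i \<in> sets borel" by (simp add: borel_eq_box image_subset_iff)
    have "(\<integral>x. indicator (\<Union>i. A i) x *\<^sub>R w x \<partial>lborel) = (\<Sum>i. \<integral>x. indicator (A i) x *\<^sub>R w x \<partial>lborel)"
      using lebesgue_integral_countable_add[of A lborel w] A union(1) int[of "\<Union>i. A i"]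
      by (auto simp: set_lebesgue_integral_def set_integrable_def disjoint_family_on_def)
    then show ?case using union by simp
  qed
  then show "set_lebesgue_integral lborel A w = 0" by (simp add: set_lebesgue_integral_def)
qed

text \<open>Bumps converge to indicators of boxes, hence the integrals over all boxes vanish.\<close>

lemma AE_zero_if_test_integrals_zero:
  fixes w :: "real^'n::finite \<Rightarrow> 'b::euclidean_space"
  assumes w[measurable]: "w \<in> borel_measurable borel"
    and loc: "\<And>a b. integrable lborel (\<lambda>x. indicator (cbox a b) x *\<^sub>R w x)"
    and 0: "\<And>f. test_function f \<Longrightarrow> (\<integral>x. f x *\<^sub>R w x \<partial>lborel) = 0"
  shows "AE x in lborel. w x = 0"
proof -
  have box0: "(\<integral>x. indicator (box a b) x *\<^sub>R w x \<partial>lborel) = 0" for a b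
  proof -
    have "(\<lambda>m. \<integral>x. bump (real (Suc m)) a b x *\<^sub>R w x \<partial>lborel) \<longlonglongrightarrow> (\<integral>x. indicator (box a b) x *\<^sub>R w x \<partial>lborel)"
    proof (rule integral_dominated_convergence[where w="\<lambda>x. norm (indicator (cbox a b) x *\<^sub>R w x)"])
      show "integrable lborel (\<lambda>x. norm (indicator (cbox a b) x *\<^sub>R w x))" using loc by (intro integrable_norm)
      show "AE x in lborel. (\<lambda>m. bump (real (Suc m)) a b x *\<^sub>R w x) \<longlonglongrightarrow> indicator (box a b) x *\<^sub>R w x"
        by (intro AE_I2 tendsto_scaleR bump_tendsto tendsto_const)
      show "AE x in lborel. norm (bump (real (Suc m)) a b x *\<^sub>R w x) \<le> norm (indicator (cbox a b) x *\<^sub>R w x)" for m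
      proof (rule AE_I2)
        fix x
        show "norm (bump (real (Suc m)) a b x *\<^sub>R w x) \<le> norm (indicator (cbox a b) x *\<^sub>R w x)"
        proof (cases "x \<in> box a b")
          case True
          then have "x \<in> cbox a b" using box_subset_cbox by blast
          then show ?thesis using bump_bounds[of "real (Suc m)" a b x]
            by (simp add: mult_left_le_one_le)
        qed (simp add: bump_outside)
      qed
      have [measurable]: "bump (real (Suc m)) a b \<in> borel_measurable borel" for m
        by (intro test_function_measurable test_function_bump) auto
      show "(\<lambda>x. bump (real (Suc m)) a b x *\<^sub>R w x) \<in> borel_measurable lborel" for m by measurable
    qed measurable
    moreover have "(\<integral>x. bump (real (Suc m)) a b x *\<^sub>R w x \<partial>lborel) = 0" for m
      by (intro 0 test_function_bump) auto
    ultimately show ?thesis by (simp add: LIMSEQ_const_iff)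
  qed
  let ?B = "\<lambda>n::nat. box (- real n *\<^sub>R (1::real^'n)) (real n *\<^sub>R 1)"
  have "AE x in lborel. indicator (?B n) x *\<^sub>R w x = 0" for n
  proof (rule AE_zero_if_box_integrals_zero)
    have "integrable lborel (\<lambda>x. indicator (?B n) x *\<^sub>R indicator (cbox (- real n *\<^sub>R (1::real^'n)) (real n *\<^sub>R 1)) x *\<^sub>R w x)"
      by (intro integrable_mult_indicator loc) auto
    moreover have "(\<lambda>x. indicator (?B n) x *\<^sub>R indicator (cbox (- real n *\<^sub>R (1::real^'n)) (real n *\<^sub>R 1)) x *\<^sub>R w x) = (\<lambda>x. indicator (?B n) x *\<^sub>R w x)"
      using box_subset_cbox by (auto simp: fun_eq_iff indicator_def)
    ultimately show "integrable lborel (\<lambda>x. indicator (?B n) x *\<^sub>R w x)" by simp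
    fix a b :: "real^'n"
    obtain c d where cd: "box a b \<inter> ?B n = box c d" using box_Int_box by blast
    have "(\<lambda>x. indicator (box a b) x *\<^sub>R indicator (?B n) x *\<^sub>R w x) = (\<lambda>x. indicator (box c d) x *\<^sub>R w x)"
      unfolding cd[symmetric] by (auto simp: fun_eq_iff indicator_def)
    then show "(\<integral>x. indicator (box a b) x *\<^sub>R indicator (?B n) x *\<^sub>R w x \<partial>lborel) = 0" using box0 by simp
  qed
  then have "AE x in lborel. \<forall>n. indicator (?B n) x *\<^sub>R w x = 0" by (subst AE_all_countable) blast
  then show ?thesis
  proof eventually_elim
    case (elim x)
    have "x \<in> ?B n" if "n > norm x" for n
      using that component_le_norm_cart[of x] by (auto simp: mem_box_cart abs_less_iff) (smt (verit))+
    moreover obtain n::nat where "n > norm x" using reals_Archimedean2 by blast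
    ultimately have "indicator (?B n) x = (1::real)" by simp
    with elim show ?case by (metis scaleR_one)
  qed
qed

section \<open>Square-integrable weak gradients\<close>

lemma test_function_L2: assumes "test_function f" shows "L2 f"
proof -
  obtain r where r: "\<And>x. norm x \<ge> r \<Longrightarrow> f x = 0" using test_function_support[OF assms] by metis
  obtain M where M: "M \<ge> 0" "\<And>x. \<bar>f x\<bar> \<le> M" using test_function_bounded[OF assms] by metis
  have "(f x)\<^sup>2 \<le> M\<^sup>2 * indicator (cball 0 r) x" for x
  proof (cases "norm x \<ge> r")
    case True then show ?thesis using r by simp
  next
    case False
    have "\<bar>f x\<bar>\<^sup>2 \<le> M\<^sup>2" using M by (intro power_mono) auto
    then show ?thesis using False by (simp add: indicator_def)
  qed
  then show ?thesis
    by (intro L2I_bound[where g="\<lambda>x. M\<^sup>2 * indicator (cball 0 r) x"] test_function_measurable assms)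
       (auto intro!: integrable_mult_right integrable_real_indicator simp: emeasure_bounded_finite[OF bounded_cball, unfolded infinity_ennreal_def])
qed

lemma L2_indicator: "bounded A \<Longrightarrow> A \<in> sets borel \<Longrightarrow> L2 (indicator A :: 'a::euclidean_space \<Rightarrow> real)"
proof -
  assume A: "bounded A" "A \<in> sets borel"
  have "(\<lambda>x. (norm (indicator A x :: real))\<^sup>2) = indicator A" by (auto simp: fun_eq_iff indicator_def)
  then show ?thesis unfolding L2_def using A emeasure_bounded_finite[OF A(1)]
    by (auto intro!: integrable_real_indicator)
qed

lemma scaleR_le_squares: "norm (a *\<^sub>R b) \<le> a\<^sup>2 + (norm b)\<^sup>2"
  for a :: real and b :: "'b::real_normed_vector"
proof -
  have "2 * (\<bar>a\<bar> * norm b) \<le> \<bar>a\<bar>\<^sup>2 + (norm b)\<^sup>2"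
    using sum_squares_bound[of "\<bar>a\<bar>" "norm b"] by (simp add: algebra_simps)
  moreover have "\<bar>a\<bar> * norm b \<ge> 0" by simp
  ultimately have "\<bar>a\<bar> * norm b \<le> \<bar>a\<bar>\<^sup>2 + (norm b)\<^sup>2" by linarith
  then show ?thesis by simp
qed

lemma L2_scaleR_integrable:
  fixes a :: "'a::euclidean_space \<Rightarrow> real"
  assumes "L2 a" "L2 b" shows "integrable lborel (\<lambda>x. a x *\<^sub>R b x)"
proof (rule Bochner_Integration.integrable_bound)
  show "integrable lborel (\<lambda>x. (norm (a x))\<^sup>2 + (norm (b x))\<^sup>2)"
    by (intro Bochner_Integration.integrable_add L2_integrable assms)
  show "(\<lambda>x. a x *\<^sub>R b x) \<in> borel_measurable lborel" using assms by (auto simp: L2_def)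
  show "AE x in lborel. norm (a x *\<^sub>R b x) \<le> norm ((norm (a x))\<^sup>2 + (norm (b x))\<^sup>2)"
  proof (rule AE_I2)
    fix x
    have "norm (a x *\<^sub>R b x) \<le> (norm (a x))\<^sup>2 + (norm (b x))\<^sup>2" using scaleR_le_squares[of "a x" "b x"] by simp
    also have "\<dots> \<le> norm ((norm (a x))\<^sup>2 + (norm (b x))\<^sup>2)" unfolding real_norm_def by (rule abs_ge_self)
    finally show "norm (a x *\<^sub>R b x) \<le> norm ((norm (a x))\<^sup>2 + (norm (b x))\<^sup>2)" .
  qed
qed

lemma L2_AE_zero_if_test_integrals_zero:
  fixes w :: "real^'n::finite \<Rightarrow> 'b::euclidean_space"
  assumes "L2 w" "\<And>f. test_function f \<Longrightarrow> (\<integral>x. f x *\<^sub>R w x \<partial>lborel) = 0"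
  shows "AE x in lborel. w x = 0"
  using assms by (intro AE_zero_if_test_integrals_zero L2_scaleR_integrable L2_indicator) (auto simp: L2_def)

lemma L2_nth: "L2 G \<Longrightarrow> L2 (\<lambda>x. G x $ i)"
  for G :: "'a::euclidean_space \<Rightarrow> ('b::euclidean_space)^'n::finite"
  by (rule L2I_bound[where g="\<lambda>x. (norm (G x))\<^sup>2"])
     (auto simp: L2_def intro!: power_mono Finite_Cartesian_Product.norm_nth_le
        measurable_compose[OF _ borel_measurable_continuous_onI[OF linear_continuous_on[OF bounded_linear_vec_nth]]])

text \<open>A pair of Borel functions, so that the sum of two pairs is again a pair and no choice of a gradient
  is involved.\<close>

definition weak_grad :: "(real^'n::finite \<Rightarrow> complex) \<Rightarrow> (real^'n \<Rightarrow> complex^'n) \<Rightarrow> bool" where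
  "weak_grad v G \<longleftrightarrow> L2 v \<and> L2 G \<and>
     (\<forall>f i. test_function f \<longrightarrow>
        (\<integral>x. partial_deriv i f x *\<^sub>R v x \<partial>lborel) = - (\<integral>x. f x *\<^sub>R (G x $ i) \<partial>lborel))"

lemma weak_grad_L2: "weak_grad v G \<Longrightarrow> L2 v" "weak_grad v G \<Longrightarrow> L2 G"
  by (auto simp: weak_grad_def)

lemma weak_gradD: "weak_grad v G \<Longrightarrow> test_function f \<Longrightarrow>
    (\<integral>x. partial_deriv i f x *\<^sub>R v x \<partial>lborel) = - (\<integral>x. f x *\<^sub>R (G x $ i) \<partial>lborel)"
  by (auto simp: weak_grad_def)

lemma integral_test_lincomb:
  fixes f :: "'a::euclidean_space \<Rightarrow> real"
  assumes "L2 f" "L2 v" "L2 w"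
  shows "(\<integral>x. f x *\<^sub>R (a *\<^sub>R v x + b *\<^sub>R w x) \<partial>lborel) =
     a *\<^sub>R (\<integral>x. f x *\<^sub>R v x \<partial>lborel) + b *\<^sub>R (\<integral>x. f x *\<^sub>R w x \<partial>lborel)"
proof -
  have "(\<integral>x. f x *\<^sub>R (a *\<^sub>R v x + b *\<^sub>R w x) \<partial>lborel) = (\<integral>x. a *\<^sub>R (f x *\<^sub>R v x) + b *\<^sub>R (f x *\<^sub>R w x) \<partial>lborel)"
    by (simp add: scaleR_add_right mult.commute)
  also have "\<dots> = (\<integral>x. a *\<^sub>R (f x *\<^sub>R v x) \<partial>lborel) + (\<integral>x. b *\<^sub>R (f x *\<^sub>R w x) \<partial>lborel)"
    by (intro Bochner_Integration.integral_add integrable_scaleR_right L2_scaleR_integrable assms)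
  finally show ?thesis by (simp only: integral_scaleR_right)
qed

lemma weak_grad_lincomb:
  assumes "weak_grad v G" "weak_grad w H"
  shows "weak_grad (\<lambda>x. a *\<^sub>R v x + b *\<^sub>R w x) (\<lambda>x. a *\<^sub>R G x + b *\<^sub>R H x)"
  unfolding weak_grad_def
proof (intro conjI allI impI L2_lincomb weak_grad_L2[OF assms(1)] weak_grad_L2[OF assms(2)])
  fix f :: "real^'a \<Rightarrow> real" and i assume f: "test_function f"
  have "(\<integral>x. partial_deriv i f x *\<^sub>R (a *\<^sub>R v x + b *\<^sub>R w x) \<partial>lborel)
      = a *\<^sub>R (\<integral>x. partial_deriv i f x *\<^sub>R v x \<partial>lborel) + b *\<^sub>R (\<integral>x. partial_deriv i f x *\<^sub>R w x \<partial>lborel)"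
    by (intro integral_test_lincomb test_function_L2 test_function_partial_deriv f weak_grad_L2[OF assms(1)] weak_grad_L2[OF assms(2)])
  also have "\<dots> = - (a *\<^sub>R (\<integral>x. f x *\<^sub>R (G x $ i) \<partial>lborel) + b *\<^sub>R (\<integral>x. f x *\<^sub>R (H x $ i) \<partial>lborel))"
    by (simp add: weak_gradD[OF assms(1) f] weak_gradD[OF assms(2) f])
  also have "\<dots> = - (\<integral>x. f x *\<^sub>R (a *\<^sub>R (G x $ i) + b *\<^sub>R (H x $ i)) \<partial>lborel)"
    by (subst integral_test_lincomb) (auto intro!: test_function_L2 f L2_nth weak_grad_L2[OF assms(1)] weak_grad_L2[OF assms(2)])
  finally show "(\<integral>x. partial_deriv i f x *\<^sub>R (a *\<^sub>R v x + b *\<^sub>R w x) \<partial>lborel)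
      = - (\<integral>x. f x *\<^sub>R ((a *\<^sub>R G x + b *\<^sub>R H x) $ i) \<partial>lborel)" by simp
qed

lemma weak_grad_translate:
  assumes "weak_grad v G" shows "weak_grad (\<lambda>x. v (x + c)) (\<lambda>x. G (x + c))"
  unfolding weak_grad_def
proof (intro conjI allI impI L2_translate weak_grad_L2[OF assms])
  fix f :: "real^'a \<Rightarrow> real" and i assume f: "test_function f"
  have [measurable]: "v \<in> borel_measurable borel" "(\<lambda>x. G x $ i) \<in> borel_measurable borel" "f \<in> borel_measurable borel"
      "partial_deriv i f \<in> borel_measurable borel"
    using weak_grad_L2[OF assms] L2_nth[of G i] test_function_measurable[OF f] test_function_measurable[OF test_function_partial_deriv[OF f]]
    by (auto simp: L2_def)
  have "(\<integral>x. partial_deriv i f x *\<^sub>R v (x + c) \<partial>lborel) = (\<integral>x. partial_deriv i f ((x + c) - c) *\<^sub>R v (x + c) \<partial>lborel)" by simp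
  also have "\<dots> = (\<integral>x. partial_deriv i f (x - c) *\<^sub>R v x \<partial>lborel)"
    by (rule integral_translate[of "\<lambda>x. partial_deriv i f (x - c) *\<^sub>R v x"]) measurable
  also have "\<dots> = (\<integral>x. partial_deriv i (\<lambda>x. f (x - c)) x *\<^sub>R v x \<partial>lborel)"
    using partial_deriv_translate[of i f "- c"] by simp
  also have "\<dots> = - (\<integral>x. f (x - c) *\<^sub>R (G x $ i) \<partial>lborel)"
    using weak_gradD[OF assms test_function_translate[OF f, of "- c"], of i] by simp
  also have "(\<integral>x. f (x - c) *\<^sub>R (G x $ i) \<partial>lborel) = (\<integral>x. f ((x + c) - c) *\<^sub>R (G (x + c) $ i) \<partial>lborel)"
    by (rule integral_translate[of "\<lambda>x. f (x - c) *\<^sub>R (G x $ i)", symmetric]) measurable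
  finally show "(\<integral>x. partial_deriv i f x *\<^sub>R v (x + c) \<partial>lborel) = - (\<integral>x. f x *\<^sub>R (G (x + c) $ i) \<partial>lborel)" by simp
qed

lemma integral_scaleR_bound:
  fixes a :: "'a::euclidean_space \<Rightarrow> real" and b :: "'a \<Rightarrow> complex"
  assumes "L2 a" "L2 b"
  shows "norm (\<integral>x. a x *\<^sub>R b x \<partial>lborel) \<le> sqrt (L2_sq a) * sqrt (L2_sq b)"
proof -
  have "norm (\<integral>x. a x *\<^sub>R b x \<partial>lborel) \<le> (\<integral>x. norm (a x *\<^sub>R b x) \<partial>lborel)"
    by (rule integral_norm_bound)
  also have "\<dots> = L2_inner (\<lambda>x. \<bar>a x\<bar>) (\<lambda>x. norm (b x))" by (simp add: L2_inner_def)
  also have "\<dots> \<le> sqrt (L2_sq (\<lambda>x. \<bar>a x\<bar>)) * sqrt (L2_sq (\<lambda>x. norm (b x)))"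
    using L2_inner_bound_sqrt[of "\<lambda>x. \<bar>a x\<bar>" "\<lambda>x. norm (b x)"] assms by (auto simp: L2_def)
  also have "\<dots> = sqrt (L2_sq a) * sqrt (L2_sq b)" by (simp add: L2_sq_def)
  finally show ?thesis .
qed

lemma tendsto_integral_scaleR:
  fixes a :: "'a::euclidean_space \<Rightarrow> real" and b :: "'a \<Rightarrow> complex"
  assumes a: "L2 a" and b: "L2 b" "\<And>n. L2 (bn n)" and lim: "(\<lambda>n. L2_sq (\<lambda>x. bn n x - b x)) \<longlonglongrightarrow> 0"
  shows "(\<lambda>n. \<integral>x. a x *\<^sub>R bn n x \<partial>lborel) \<longlonglongrightarrow> (\<integral>x. a x *\<^sub>R b x \<partial>lborel)"
proof (rule LIM_zero_cancel, rule Lim_null_comparison)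
  have "norm ((\<integral>x. a x *\<^sub>R bn n x \<partial>lborel) - (\<integral>x. a x *\<^sub>R b x \<partial>lborel)) \<le> sqrt (L2_sq a) * sqrt (L2_sq (\<lambda>x. bn n x - b x))" for n
  proof -
    have "(\<integral>x. a x *\<^sub>R bn n x \<partial>lborel) - (\<integral>x. a x *\<^sub>R b x \<partial>lborel) = (\<integral>x. a x *\<^sub>R (bn n x - b x) \<partial>lborel)"
      using integral_test_lincomb[OF a b(2)[of n] b(1), of 1 "-1"] by simp
    then show ?thesis using integral_scaleR_bound[OF a L2_diff[OF b(2) b(1)], of n] by simp
  qed
  then show "\<forall>\<^sub>F n in sequentially. norm ((\<integral>x. a x *\<^sub>R bn n x \<partial>lborel) - (\<integral>x. a x *\<^sub>R b x \<partial>lborel)) \<le> sqrt (L2_sq a) * sqrt (L2_sq (\<lambda>x. bn n x - b x))"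
    by auto
  show "(\<lambda>n. sqrt (L2_sq a) * sqrt (L2_sq (\<lambda>x. bn n x - b x))) \<longlonglongrightarrow> 0"
    using tendsto_real_sqrt[OF lim] by (intro tendsto_mult_right_zero) simp
qed

lemma L2_sq_nth_le: "L2 G \<Longrightarrow> L2_sq (\<lambda>x. G x $ i) \<le> L2_sq G"
  for G :: "'a::euclidean_space \<Rightarrow> ('b::euclidean_space)^'n::finite"
  unfolding L2_sq_def by (intro integral_mono L2_integrable L2_nth) (auto intro!: power_mono Finite_Cartesian_Product.norm_nth_le)

text \<open>The gradient is a closed operator: both sides of the defining identity are continuous in \<open>L\<^sup>2\<close>.\<close>

lemma weak_grad_closed:
  assumes w: "\<And>n. weak_grad (vn n) (Gn n)" and L: "L2 v" "L2 G"
    and v: "(\<lambda>n. L2_sq (\<lambda>x. vn n x - v x)) \<longlonglongrightarrow> 0" and G: "(\<lambda>n. L2_sq (\<lambda>x. Gn n x - G x)) \<longlonglongrightarrow> 0"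
  shows "weak_grad v G"
  unfolding weak_grad_def
proof (intro conjI L allI impI)
  fix f :: "real^'a \<Rightarrow> real" and i assume f: "test_function f"
  have "(\<lambda>n. L2_sq (\<lambda>x. Gn n x $ i - G x $ i)) \<longlonglongrightarrow> 0"
  proof (rule tendsto_sandwich[OF _ _ tendsto_const G])
    show "\<forall>\<^sub>F n in sequentially. L2_sq (\<lambda>x. Gn n x $ i - G x $ i) \<le> L2_sq (\<lambda>x. Gn n x - G x)"
      using L2_sq_nth_le[OF L2_diff[OF weak_grad_L2(2)[OF w] L(2)]] by auto
  qed (auto simp: L2_sq_nonneg)
  then have "(\<lambda>n. \<integral>x. f x *\<^sub>R (Gn n x $ i) \<partial>lborel) \<longlonglongrightarrow> (\<integral>x. f x *\<^sub>R (G x $ i) \<partial>lborel)"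
    by (intro tendsto_integral_scaleR test_function_L2 f L2_nth L weak_grad_L2(2)[OF w])
  from tendsto_minus[OF this]
  have "(\<lambda>n. \<integral>x. partial_deriv i f x *\<^sub>R vn n x \<partial>lborel) \<longlonglongrightarrow> - (\<integral>x. f x *\<^sub>R (G x $ i) \<partial>lborel)"
    by (simp add: weak_gradD[OF w f])
  moreover have "(\<lambda>n. \<integral>x. partial_deriv i f x *\<^sub>R vn n x \<partial>lborel) \<longlonglongrightarrow> (\<integral>x. partial_deriv i f x *\<^sub>R v x \<partial>lborel)"
    by (intro tendsto_integral_scaleR test_function_L2 test_function_partial_deriv f L weak_grad_L2(1)[OF w] v)
  ultimately show "(\<integral>x. partial_deriv i f x *\<^sub>R v x \<partial>lborel) = - (\<integral>x. f x *\<^sub>R (G x $ i) \<partial>lborel)"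
    using LIMSEQ_unique by blast
qed

section \<open>The translation estimate and the uncertainty principle\<close>

text \<open>Jensen's inequality for the square, in a form that also covers functions that are not integrable (their
  Bochner integral is zero).\<close>

lemma norm_set_integral_square_le:
  fixes g :: "'a \<Rightarrow> 'b::{banach, second_countable_topology}"
  assumes [measurable]: "g \<in> borel_measurable M" "A \<in> sets M"
  shows "ennreal ((norm (\<integral>x. indicator A x *\<^sub>R g x \<partial>M))\<^sup>2)
     \<le> emeasure M A * (\<integral>\<^sup>+x. indicator A x * ennreal ((norm (g x))\<^sup>2) \<partial>M)"
proof -
  have "ennreal (norm (\<integral>x. indicator A x *\<^sub>R g x \<partial>M)) \<le> (\<integral>\<^sup>+x. ennreal (norm (indicator A x *\<^sub>R g x)) \<partial>M)"
  proof (cases "integrable M (\<lambda>x. indicator A x *\<^sub>R g x)")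
    case True then show ?thesis by (rule integral_norm_bound_ennreal)
  next
    case False then show ?thesis by (simp add: not_integrable_integral_eq)
  qed
  also have "\<dots> = (\<integral>\<^sup>+x. indicator A x * (indicator A x * ennreal (norm (g x))) \<partial>M)"
    by (intro nn_integral_cong) (auto simp: indicator_def)
  finally have "(ennreal (norm (\<integral>x. indicator A x *\<^sub>R g x \<partial>M)))\<^sup>2 \<le>
      (\<integral>\<^sup>+x. indicator A x * (indicator A x * ennreal (norm (g x))) \<partial>M)\<^sup>2"
    by (intro power_mono) auto
  also have "\<dots> \<le> (\<integral>\<^sup>+x. (indicator A x)\<^sup>2 \<partial>M) * (\<integral>\<^sup>+x. (indicator A x * ennreal (norm (g x)))\<^sup>2 \<partial>M)"
    by (rule Cauchy_Schwarz_nn_integral) auto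
  also have "(\<integral>\<^sup>+x. (indicator A x)\<^sup>2 \<partial>M) = emeasure M A"
  proof -
    have "(\<lambda>x. (indicator A x)\<^sup>2) = (indicator A :: 'a \<Rightarrow> ennreal)" by (auto simp: indicator_def fun_eq_iff)
    then show ?thesis by simp
  qed
  also have "(\<integral>\<^sup>+x. (indicator A x * ennreal (norm (g x)))\<^sup>2 \<partial>M) = (\<integral>\<^sup>+x. indicator A x * ennreal ((norm (g x))\<^sup>2) \<partial>M)"
    by (intro nn_integral_cong) (auto simp: indicator_def ennreal_power)
  finally show ?thesis by (simp add: ennreal_power)
qed

text \<open>Justifies the exchanges of integration in the proof of the translation estimate.\<close>

lemma integrable_moving_product:
  fixes a :: "real^'n::finite \<Rightarrow> real" and b :: "real^'n \<Rightarrow> complex"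
  assumes a: "L2 a" and b: "L2 b"
  shows "integrable (lborel \<Otimes>\<^sub>M lborel) (\<lambda>(s, x). indicator {0..1::real} s *\<^sub>R (a (x + s *\<^sub>R k) *\<^sub>R b (x + s *\<^sub>R l)))"
  unfolding integrable_iff_bounded
proof
  have [measurable]: "a \<in> borel_measurable borel" "b \<in> borel_measurable borel" using a b by (auto simp: L2_def)
  show m: "(\<lambda>(s, x). indicator {0..1::real} s *\<^sub>R (a (x + s *\<^sub>R k) *\<^sub>R b (x + s *\<^sub>R l))) \<in> borel_measurable (lborel \<Otimes>\<^sub>M lborel)"
    by measurable
  have "(\<integral>\<^sup>+z. ennreal (norm (case z of (s, x) \<Rightarrow> indicator {0..1::real} s *\<^sub>R (a (x + s *\<^sub>R k) *\<^sub>R b (x + s *\<^sub>R l)))) \<partial>(lborel \<Otimes>\<^sub>M lborel))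
      = (\<integral>\<^sup>+s. \<integral>\<^sup>+x. ennreal (norm (indicator {0..1::real} s *\<^sub>R (a (x + s *\<^sub>R k) *\<^sub>R b (x + s *\<^sub>R l)))) \<partial>lborel \<partial>lborel)"
    using lborel.nn_integral_fst[OF measurable_compose[OF m, of "\<lambda>y. ennreal (norm y)" borel]] by simp
  also have "\<dots> \<le> (\<integral>\<^sup>+s. indicator {0..1::real} s * ennreal (L2_sq a + L2_sq b) \<partial>lborel)"
  proof (rule nn_integral_mono)
    fix s :: real
    have "(\<integral>\<^sup>+x. ennreal (norm (indicator {0..1::real} s *\<^sub>R (a (x + s *\<^sub>R k) *\<^sub>R b (x + s *\<^sub>R l)))) \<partial>lborel)
        \<le> (\<integral>\<^sup>+x. indicator {0..1} s * (ennreal ((norm (a (x + s *\<^sub>R k)))\<^sup>2) + ennreal ((norm (b (x + s *\<^sub>R l)))\<^sup>2)) \<partial>lborel)"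
      using scaleR_le_squares[of "a (x + s *\<^sub>R k)" "b (x + s *\<^sub>R l)" for x]
      by (intro nn_integral_mono) (auto simp: indicator_def ennreal_plus[symmetric] intro!: ennreal_leI simp del: ennreal_plus)
    also have "\<dots> = indicator {0..1} s * (ennreal (L2_sq a) + ennreal (L2_sq b))"
      by (subst nn_integral_cmult, measurable, subst nn_integral_add, measurable)
         (simp only: nn_L2_sq[OF L2_translate[OF a]] nn_L2_sq[OF L2_translate[OF b]] L2_sq_translate[OF a] L2_sq_translate[OF b])
    also have "\<dots> = indicator {0..1} s * ennreal (L2_sq a + L2_sq b)" by (simp add: L2_sq_nonneg)
    finally show "(\<integral>\<^sup>+x. ennreal (norm (indicator {0..1::real} s *\<^sub>R (a (x + s *\<^sub>R k) *\<^sub>R b (x + s *\<^sub>R l)))) \<partial>lborel)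
       \<le> indicator {0..1::real} s * ennreal (L2_sq a + L2_sq b)" .
  qed
  also have "\<dots> = ennreal (L2_sq a + L2_sq b)"
    by (subst nn_integral_multc) (auto simp del: ennreal_plus)
  also have "\<dots> < \<infinity>" by simp
  finally show "(\<integral>\<^sup>+z. ennreal (norm (case z of (s, x) \<Rightarrow> indicator {0..1::real} s *\<^sub>R (a (x + s *\<^sub>R k) *\<^sub>R b (x + s *\<^sub>R l)))) \<partial>(lborel \<Otimes>\<^sub>M lborel)) < \<infinity>" .
qed

lemma smooth_line_integral:
  fixes f :: "real^'n::finite \<Rightarrow> real"
  assumes f: "test_function f"
  shows "integrable lborel (\<lambda>s. indicator {0..1} s *\<^sub>R (\<Sum>i\<in>UNIV. h $ i * partial_deriv i f (x - s *\<^sub>R h)))"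
    and "f (x - h) - f x = - (\<integral>s. indicator {0..1} s *\<^sub>R (\<Sum>i\<in>UNIV. h $ i * partial_deriv i f (x - s *\<^sub>R h)) \<partial>lborel)"
proof -
  let ?D = "\<lambda>y. \<Sum>i\<in>UNIV. h $ i * partial_deriv i f y"
  have "smooth f" using f by (simp add: test_function_def)
  have d: "((\<lambda>s. f (x - s *\<^sub>R h)) has_real_derivative - ?D (x - s *\<^sub>R h)) (at s)" for s
  proof -
    have "((\<lambda>s. f (x - s *\<^sub>R h)) has_derivative (\<lambda>t. \<Sum>i\<in>UNIV. (- t *\<^sub>R h) $ i * partial_deriv i f (x - s *\<^sub>R h))) (at s)"
      by (rule has_derivative_compose[OF _ smooth_has_derivative[OF \<open>smooth f\<close>]]) (auto intro!: derivative_eq_intros)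
    moreover have "(\<lambda>t. \<Sum>i\<in>UNIV. (- t *\<^sub>R h) $ i * partial_deriv i f (x - s *\<^sub>R h)) = (*) (- ?D (x - s *\<^sub>R h))"
    proof
      fix t
      have "(\<Sum>i\<in>UNIV. (- t *\<^sub>R h) $ i * partial_deriv i f (x - s *\<^sub>R h)) = (\<Sum>i\<in>UNIV. (- t) * (h $ i * partial_deriv i f (x - s *\<^sub>R h)))"
        by (intro sum.cong) auto
      also have "\<dots> = (- t) * ?D (x - s *\<^sub>R h)" by (simp only: sum_distrib_left)
      finally show "(\<Sum>i\<in>UNIV. (- t *\<^sub>R h) $ i * partial_deriv i f (x - s *\<^sub>R h)) = (- ?D (x - s *\<^sub>R h)) * t" by simp
    qed
    ultimately show ?thesis by (simp add: has_field_derivative_def)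
  qed
  have "continuous_on {0..1} (\<lambda>s. partial_deriv i f (x - s *\<^sub>R h))" for i
    by (rule continuous_on_compose2[OF smooth_continuous[OF smooth_partial_deriv[OF \<open>smooth f\<close>]]])
       (auto intro!: continuous_intros)
  then have c: "continuous_on {0..1} (\<lambda>s. - ?D (x - s *\<^sub>R h))"
    by (intro continuous_on_minus continuous_on_sum continuous_on_mult continuous_on_const)
  have "(\<integral>s. indicator {0..1} s *\<^sub>R - ?D (x - s *\<^sub>R h) \<partial>lborel) = f (x - 1 *\<^sub>R h) - f (x - 0 *\<^sub>R h)"
  proof (rule integral_FTC_atLeastAtMost[of 0 1 "\<lambda>s. f (x - s *\<^sub>R h)"])
    show "((\<lambda>s. f (x - s *\<^sub>R h)) has_vector_derivative - ?D (x - s *\<^sub>R h)) (at s within {0..1})" for s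
      using has_field_derivative_at_within[OF d[of s]] by (simp only: has_real_derivative_iff_has_vector_derivative)
  qed (use c in simp_all)
  moreover have "(\<integral>s. indicator {0..1} s *\<^sub>R - ?D (x - s *\<^sub>R h) \<partial>lborel) = - (\<integral>s. indicator {0..1} s *\<^sub>R ?D (x - s *\<^sub>R h) \<partial>lborel)"
    by (simp only: scaleR_minus_right Bochner_Integration.integral_minus)
  ultimately show "f (x - h) - f x = - (\<integral>s. indicator {0..1} s *\<^sub>R ?D (x - s *\<^sub>R h) \<partial>lborel)" by simp
  have "integrable lborel (\<lambda>s. indicator {0..1} s *\<^sub>R - ?D (x - s *\<^sub>R h))"
    by (rule borel_integrable_compact[OF _ c]) simp
  from Bochner_Integration.integrable_minus[OF this]
  show "integrable lborel (\<lambda>s. indicator {0..1} s *\<^sub>R ?D (x - s *\<^sub>R h))"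
    by (simp only: scaleR_minus_right minus_minus)
qed

text \<open>The increment \<open>v(x+h) - v(x)\<close> is the integral of \<open>h \<bullet> G\<close> along the segment from \<open>x\<close> to \<open>x+h\<close>, for almost
  every \<open>x\<close>. To see this, integrate against a test function, move the translation to the test function, where
  the fundamental theorem of calculus applies, and use the definition of the weak gradient on each translate.
  This estimate is the only way in which derivatives enter the compactness and embedding results.\<close>

lemma translation_estimate:
  assumes wg: "weak_grad v G" shows "L2_sq (\<lambda>x. v (x + h) - v x) \<le> (norm h)\<^sup>2 * L2_sq G"
proof -
  have v: "L2 v" and G: "L2 G" using weak_grad_L2[OF wg] by auto
  define g where "g x = (\<Sum>i\<in>UNIV. h $ i *\<^sub>R (G x $ i))" for x
  have [measurable]: "v \<in> borel_measurable borel" using v by (simp add: L2_def)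
  have [measurable]: "(\<lambda>x. G x $ i) \<in> borel_measurable borel" for i using L2_nth[OF G] by (simp add: L2_def)
  have gm[measurable]: "g \<in> borel_measurable borel" unfolding g_def by measurable
  have gb: "(norm (g x))\<^sup>2 \<le> (norm h)\<^sup>2 * (norm (G x))\<^sup>2" for x
  proof -
    have "norm (g x) \<le> (\<Sum>i\<in>UNIV. \<bar>h $ i\<bar> * norm (G x $ i))"
      unfolding g_def using norm_sum[of "\<lambda>i. h $ i *\<^sub>R (G x $ i)" UNIV] by simp
    also have "\<dots> \<le> norm h * norm (G x)"
      using L2_set_mult_ineq[of "\<lambda>i. h $ i" "\<lambda>i. norm (G x $ i)" UNIV]
      by (simp add: norm_vec_def L2_set_def)
    finally have "(norm (g x))\<^sup>2 \<le> (norm h * norm (G x))\<^sup>2" by (intro power_mono) auto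
    then show ?thesis by (simp add: power_mult_distrib)
  qed
  have g: "L2 g"
    by (rule L2I_bound[OF gm _ AE_I2[OF gb]]) (use L2_integrable[OF G] in auto)
  have ng: "L2_sq g \<le> (norm h)\<^sup>2 * L2_sq G"
  proof -
    have "L2_sq g \<le> (\<integral>x. (norm h)\<^sup>2 * (norm (G x))\<^sup>2 \<partial>lborel)"
      unfolding L2_sq_def by (intro integral_mono gb L2_integrable[OF g] integrable_mult_right L2_integrable[OF G])
    then show ?thesis by (simp add: L2_sq_def)
  qed
  \<comment> \<open>The candidate for the increment of \<open>v\<close> from \<open>x\<close> to \<open>x + h\<close>.\<close>
  define u where "u x = (\<integral>s. indicator {0..1::real} s *\<^sub>R g (x + s *\<^sub>R h) \<partial>lborel)" for x
  have [measurable]: "u \<in> borel_measurable borel" unfolding u_def by measurable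
  have nu: "(\<integral>\<^sup>+x. ennreal ((norm (u x))\<^sup>2) \<partial>lborel) \<le> ennreal (L2_sq g)"
  proof -
    have "ennreal ((norm (u x))\<^sup>2) \<le> (\<integral>\<^sup>+s. indicator {0..1::real} s * ennreal ((norm (g (x + s *\<^sub>R h)))\<^sup>2) \<partial>lborel)" for x
      unfolding u_def using norm_set_integral_square_le[of "\<lambda>s. g (x + s *\<^sub>R h)" lborel "{0..1}"] by simp
    then have "(\<integral>\<^sup>+x. ennreal ((norm (u x))\<^sup>2) \<partial>lborel) \<le>
        (\<integral>\<^sup>+x. \<integral>\<^sup>+s. indicator {0..1::real} s * ennreal ((norm (g (x + s *\<^sub>R h)))\<^sup>2) \<partial>lborel \<partial>lborel)"
      by (intro nn_integral_mono)
    also have "\<dots> = (\<integral>\<^sup>+s. \<integral>\<^sup>+x. indicator {0..1::real} s * ennreal ((norm (g (x + s *\<^sub>R h)))\<^sup>2) \<partial>lborel \<partial>lborel)"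
      by (rule lborel_pair.Fubini'[of "\<lambda>s x. indicator {0..1::real} s * ennreal ((norm (g (x + s *\<^sub>R h)))\<^sup>2)"]) measurable
    also have "\<dots> = (\<integral>\<^sup>+s. indicator {0..1::real} s * ennreal (L2_sq g) \<partial>lborel)"
      by (intro nn_integral_cong) (subst nn_integral_cmult, measurable, simp add: nn_L2_sq[OF L2_translate[OF g]] L2_sq_translate[OF g])
    also have "\<dots> = ennreal (L2_sq g)" by (subst nn_integral_multc) auto
    finally show ?thesis .
  qed
  have u: "L2 u" "L2_sq u \<le> L2_sq g" using L2_sq_le_nn[OF _ nu L2_sq_nonneg] by auto
  have "AE x in lborel. (v (x + h) - v x) - u x = 0"
  proof (rule L2_AE_zero_if_test_integrals_zero)
    show "L2 (\<lambda>x. (v (x + h) - v x) - u x)" by (intro L2_diff L2_translate v u)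
    fix f :: "real^'a \<Rightarrow> real" assume f: "test_function f"
    note fL = test_function_L2[OF f]
    have [measurable]: "f \<in> borel_measurable borel" by (rule test_function_measurable[OF f])
    let ?D = "\<lambda>y. \<Sum>i\<in>UNIV. h $ i * partial_deriv i f y"
    have DL: "L2 ?D"
    proof -
      have "L2 (\<lambda>y. \<Sum>i\<in>I. h $ i * partial_deriv i f y)" if "finite I" for I
        using that
      proof (induction I)
        case empty show ?case by (simp add: L2_def)
      next
        case (insert i I)
        then show ?case
          using L2_add[OF L2_scaleR[OF test_function_L2[OF test_function_partial_deriv[OF f]]], of _ "h $ i" i] by simp
      qed
      then show ?thesis by simp
    qed
    have [measurable]: "?D \<in> borel_measurable borel" using DL by (simp add: L2_def)
    have weak: "(\<integral>x. ?D x *\<^sub>R w x \<partial>lborel) = - (\<integral>x. f x *\<^sub>R (\<Sum>i\<in>UNIV. h $ i *\<^sub>R (H x $ i)) \<partial>lborel)"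
      if "weak_grad w H" for w H
    proof -
      have i: "integrable lborel (\<lambda>x. (h $ i * partial_deriv i f x) *\<^sub>R w x)" for i
        using L2_scaleR_integrable[OF L2_scaleR[OF test_function_L2[OF test_function_partial_deriv[OF f]]] weak_grad_L2(1)[OF that], of "h $ i" i]
        by simp
      have j: "integrable lborel (\<lambda>x. f x *\<^sub>R (h $ i *\<^sub>R (H x $ i)))" for i
        by (intro L2_scaleR_integrable fL L2_scaleR L2_nth weak_grad_L2(2)[OF that])
      have "(\<integral>x. ?D x *\<^sub>R w x \<partial>lborel) = (\<Sum>i\<in>UNIV. \<integral>x. (h $ i * partial_deriv i f x) *\<^sub>R w x \<partial>lborel)"
        using i by (simp add: scaleR_sum_left)
      also have "\<dots> = (\<Sum>i\<in>UNIV. h $ i *\<^sub>R (\<integral>x. partial_deriv i f x *\<^sub>R w x \<partial>lborel))"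
        by (simp flip: scaleR_scaleR)
      also have "\<dots> = (\<Sum>i\<in>UNIV. - (\<integral>x. f x *\<^sub>R (h $ i *\<^sub>R (H x $ i)) \<partial>lborel))"
      proof (rule sum.cong[OF refl])
        fix i
        have "(\<lambda>x. f x *\<^sub>R (h $ i *\<^sub>R (H x $ i))) = (\<lambda>x. h $ i *\<^sub>R (f x *\<^sub>R (H x $ i)))"
          by (simp add: mult.commute)
        then show "h $ i *\<^sub>R (\<integral>x. partial_deriv i f x *\<^sub>R w x \<partial>lborel) = - (\<integral>x. f x *\<^sub>R (h $ i *\<^sub>R (H x $ i)) \<partial>lborel)"
          by (simp only: weak_gradD[OF that f] integral_scaleR_right scaleR_minus_right)
      qed
      also have "\<dots> = - (\<integral>x. f x *\<^sub>R (\<Sum>i\<in>UNIV. h $ i *\<^sub>R (H x $ i)) \<partial>lborel)"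
        using j by (simp add: scaleR_sum_right sum_negf)
      finally show ?thesis .
    qed
    have "(\<integral>x. f x *\<^sub>R (v (x + h) - v x) \<partial>lborel) = (\<integral>x. f x *\<^sub>R v (x + h) \<partial>lborel) - (\<integral>x. f x *\<^sub>R v x \<partial>lborel)"
      using integral_test_lincomb[OF fL L2_translate[OF v, of h] v, of 1 "-1"] by simp
    also have "(\<integral>x. f x *\<^sub>R v (x + h) \<partial>lborel) = (\<integral>x. f (x - h) *\<^sub>R v x \<partial>lborel)"
      using integral_translate[of "\<lambda>x. f (x - h) *\<^sub>R v x" h] by simp
    also have "(\<integral>x. f (x - h) *\<^sub>R v x \<partial>lborel) - (\<integral>x. f x *\<^sub>R v x \<partial>lborel) = (\<integral>x. (f (x - h) - f x) *\<^sub>R v x \<partial>lborel)"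
      using L2_scaleR_integrable[OF L2_translate[OF fL, of "- h"] v] L2_scaleR_integrable[OF fL v]
      by (simp add: scaleR_diff_left)
    also have "\<dots> = (\<integral>x. - (\<integral>s. indicator {0..1} s *\<^sub>R (?D (x + s *\<^sub>R (-h)) *\<^sub>R v (x + s *\<^sub>R 0)) \<partial>lborel) \<partial>lborel)"
    proof (rule Bochner_Integration.integral_cong[OF refl])
      fix x
      have "(f (x - h) - f x) *\<^sub>R v x = - ((\<integral>s. indicator {0..1} s *\<^sub>R ?D (x - s *\<^sub>R h) \<partial>lborel) *\<^sub>R v x)"
        by (subst smooth_line_integral(2)[OF f]) simp
      also have "(\<integral>s. indicator {0..1} s *\<^sub>R ?D (x - s *\<^sub>R h) \<partial>lborel) *\<^sub>R v x
          = (\<integral>s. (indicator {0..1} s *\<^sub>R ?D (x - s *\<^sub>R h)) *\<^sub>R v x \<partial>lborel)"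
        by (rule integral_scaleR_left[symmetric]) (rule smooth_line_integral(1)[OF f])
      finally show "(f (x - h) - f x) *\<^sub>R v x
          = - (\<integral>s. indicator {0..1} s *\<^sub>R (?D (x + s *\<^sub>R (-h)) *\<^sub>R v (x + s *\<^sub>R 0)) \<partial>lborel)"
        by simp
    qed
    also have "\<dots> = - (\<integral>s. \<integral>x. indicator {0..1} s *\<^sub>R (?D (x + s *\<^sub>R (-h)) *\<^sub>R v (x + s *\<^sub>R 0)) \<partial>lborel \<partial>lborel)"
      using lborel_pair.Fubini_integral[OF integrable_moving_product[OF DL v, of "-h" 0]] by simp
    also have "\<dots> = (\<integral>s. \<integral>x. indicator {0..1} s *\<^sub>R (f (x + s *\<^sub>R 0) *\<^sub>R g (x + s *\<^sub>R h)) \<partial>lborel \<partial>lborel)"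
    proof -
      have "- (\<integral>x. ?D (x + s *\<^sub>R (-h)) *\<^sub>R v (x + s *\<^sub>R 0) \<partial>lborel) = (\<integral>x. f (x + s *\<^sub>R 0) *\<^sub>R g (x + s *\<^sub>R h) \<partial>lborel)" for s
      proof -
        have "(\<integral>x. ?D (x + s *\<^sub>R (-h)) *\<^sub>R v (x + s *\<^sub>R 0) \<partial>lborel) = (\<integral>x. ?D x *\<^sub>R v (x + s *\<^sub>R h) \<partial>lborel)"
          using integral_translate[of "\<lambda>x. ?D (x - s *\<^sub>R h) *\<^sub>R v x" "s *\<^sub>R h"] by simp
        then show ?thesis using weak[OF weak_grad_translate[OF wg, of "s *\<^sub>R h"]] by (simp add: g_def)
      qed
      then have "- (\<integral>x. indicator {0..1} s *\<^sub>R (?D (x + s *\<^sub>R (-h)) *\<^sub>R v (x + s *\<^sub>R 0)) \<partial>lborel)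
          = (\<integral>x. indicator {0..1} s *\<^sub>R (f (x + s *\<^sub>R 0) *\<^sub>R g (x + s *\<^sub>R h)) \<partial>lborel)" for s :: real
        by (simp only: integral_scaleR_right scaleR_minus_right[symmetric])
      then show ?thesis by (simp only: Bochner_Integration.integral_minus[symmetric])
    qed
    also have "\<dots> = (\<integral>x. \<integral>s. indicator {0..1} s *\<^sub>R (f (x + s *\<^sub>R 0) *\<^sub>R g (x + s *\<^sub>R h)) \<partial>lborel \<partial>lborel)"
      using lborel_pair.Fubini_integral[OF integrable_moving_product[OF fL g, of 0 h]] by simp
    also have "\<dots> = (\<integral>x. f x *\<^sub>R u x \<partial>lborel)"
    proof (rule Bochner_Integration.integral_cong[OF refl])
      fix x
      have "(\<lambda>s. indicator {0..1::real} s *\<^sub>R (f (x + s *\<^sub>R 0) *\<^sub>R g (x + s *\<^sub>R h))) = (\<lambda>s. f x *\<^sub>R (indicator {0..1} s *\<^sub>R g (x + s *\<^sub>R h)))"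
        by (simp add: mult.commute)
      then show "(\<integral>s. indicator {0..1} s *\<^sub>R (f (x + s *\<^sub>R 0) *\<^sub>R g (x + s *\<^sub>R h)) \<partial>lborel) = f x *\<^sub>R u x"
        unfolding u_def by (simp only: integral_scaleR_right)
    qed
    finally have "(\<integral>x. f x *\<^sub>R (v (x + h) - v x) \<partial>lborel) = (\<integral>x. f x *\<^sub>R u x \<partial>lborel)" .
    then show "(\<integral>x. f x *\<^sub>R ((v (x + h) - v x) - u x) \<partial>lborel) = 0"
      using integral_test_lincomb[OF fL L2_diff[OF L2_translate[OF v, of h] v] u(1), of 1 "-1"] by simp
  qed
  then have "L2_sq (\<lambda>x. v (x + h) - v x) = L2_sq u" by (intro L2_sq_cong_AE) auto
  then show ?thesis using u ng by simp
qed

text \<open>Formally \<open>\<parallel>v\<parallel>\<^sup>2 = -2 Re \<langle>x\<^sub>k v, \<partial>\<^sub>k v\<rangle>\<close>. With a difference quotient in place of the derivative this becomes an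
  exact identity: translating one factor of \<open>\<langle>x\<^sub>k v, v(\<cdot> - h)\<rangle>\<close> by \<open>h\<close> changes the weight \<open>x\<^sub>k\<close> into \<open>x\<^sub>k + t\<close>, so the
  difference of the pairings with the translates by \<open>-h\<close> and \<open>h\<close> is \<open>t \<langle>v, v(\<cdot> + h)\<rangle>\<close>. The translation
  estimate bounds the difference of the translates by \<open>2t \<parallel>G\<parallel>\<close>.\<close>

lemma uncertainty:
  assumes wg: "weak_grad v G" and A: "L2 (\<lambda>x. (x $ k) *\<^sub>R v x)"
  shows "L2_sq v \<le> L2_sq G + L2_sq (\<lambda>x. (x $ k) *\<^sub>R v x)"
proof (rule field_le_epsilon)
  fix e :: real assume e: "e > 0"
  let ?A = "\<lambda>x. (x $ k) *\<^sub>R v x"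
  have v: "L2 v" using weak_grad_L2[OF wg] by auto
  have [measurable]: "v \<in> borel_measurable borel" using v by (simp add: L2_def)
  \<comment> \<open>The step is so small that replacing \<open>\<langle>v, v(\<cdot> + h)\<rangle>\<close> by \<open>\<parallel>v\<parallel>\<^sup>2\<close> costs at most \<open>e\<close>.\<close>
  define t where "t = sqrt (2 * e / (L2_sq G + 1))"
  have t: "t > 0" unfolding t_def using e L2_sq_nonneg[of G] by (auto intro!: divide_pos_pos add_nonneg_pos)
  have t2: "t\<^sup>2 * L2_sq G \<le> 2 * e"
  proof -
    have "t\<^sup>2 = 2 * e / (L2_sq G + 1)" unfolding t_def using e L2_sq_nonneg[of G] by (intro real_sqrt_pow2) auto
    then have "t\<^sup>2 * (L2_sq G + 1) = 2 * e" using L2_sq_nonneg[of G] by simp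
    moreover have "t\<^sup>2 * (L2_sq G + 1) = t\<^sup>2 * L2_sq G + t\<^sup>2" by (simp add: distrib_left)
    ultimately show ?thesis using zero_le_power2[of t] by linarith
  qed
  define h where "h = t *\<^sub>R (axis k 1 :: real^'a)"
  have nh: "norm h = t" using t by (simp add: h_def norm_axis_1)
  have hk: "h $ k = t" by (simp add: h_def)
  let ?p = "\<lambda>x. v (x + h)" and ?m = "\<lambda>x. v (x + - h)"
  have pL: "L2 ?p" "L2 ?m" by (intro L2_translate v)+
  have "L2_inner ?A ?m = (\<integral>x. ?A (x + h) \<bullet> ?m (x + h) \<partial>lborel)"
    unfolding L2_inner_def by (rule integral_translate[symmetric]) measurable
  also have "\<dots> = (\<integral>x. ?A x \<bullet> ?p x + t * (v x \<bullet> ?p x) \<partial>lborel)"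
    by (intro Bochner_Integration.integral_cong refl) (simp add: hk inner_commute[of "v (_ + h)"] algebra_simps)
  also have "\<dots> = L2_inner ?A ?p + t * L2_inner v ?p"
    unfolding L2_inner_def using L2_inner_integrable[OF A pL(1)] L2_inner_integrable[OF v pL(1)] by simp
  finally have 1: "t * L2_inner v ?p = L2_inner ?A ?m - L2_inner ?A ?p" by simp
  have "L2_inner ?A ?m - L2_inner ?A ?p = L2_inner ?A (\<lambda>x. ?m x - ?p x)"
    unfolding L2_inner_def using L2_inner_integrable[OF A pL(1)] L2_inner_integrable[OF A pL(2)] by (simp add: inner_diff_right)
  also have "\<dots> \<le> sqrt (L2_sq ?A) * sqrt (L2_sq (\<lambda>x. ?m x - ?p x))"
    using L2_inner_bound_sqrt[OF A L2_diff[OF pL(2) pL(1)]] by simp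
  also have "L2_sq (\<lambda>x. ?m x - ?p x) = L2_sq (\<lambda>x. v (x + 2 *\<^sub>R h) - v x)"
  proof -
    have "L2_sq (\<lambda>x. ?m x - ?p x) = L2_sq (\<lambda>x. ?m (x + h) - ?p (x + h))"
      by (rule L2_sq_translate[OF L2_diff[OF pL(2) pL(1)], symmetric])
    then show ?thesis by (simp add: L2_sq_def norm_minus_commute scaleR_2 add.assoc)
  qed
  also have "sqrt (L2_sq ?A) * sqrt (L2_sq (\<lambda>x. v (x + 2 *\<^sub>R h) - v x)) \<le> sqrt (L2_sq ?A) * (2 * t * sqrt (L2_sq G))"
  proof (rule mult_left_mono)
    have "L2_sq (\<lambda>x. v (x + 2 *\<^sub>R h) - v x) \<le> (2 * t)\<^sup>2 * L2_sq G"
      using translation_estimate[OF wg, of "2 *\<^sub>R h"] nh by simp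
    then have "sqrt (L2_sq (\<lambda>x. v (x + 2 *\<^sub>R h) - v x)) \<le> sqrt ((2 * t)\<^sup>2 * L2_sq G)" by (rule real_sqrt_le_mono)
    then show "sqrt (L2_sq (\<lambda>x. v (x + 2 *\<^sub>R h) - v x)) \<le> 2 * t * sqrt (L2_sq G)" using t by (simp add: real_sqrt_mult)
  qed (simp add: L2_sq_nonneg)
  finally have "t * L2_inner v ?p \<le> t * (2 * sqrt (L2_sq ?A) * sqrt (L2_sq G))" using 1 by (simp add: algebra_simps)
  then have 2: "L2_inner v ?p \<le> 2 * sqrt (L2_sq ?A) * sqrt (L2_sq G)" using t by simp
  have 3: "2 * sqrt (L2_sq ?A) * sqrt (L2_sq G) \<le> L2_sq ?A + L2_sq G"
    using sum_squares_bound[of "sqrt (L2_sq ?A)" "sqrt (L2_sq G)"] by (simp add: L2_sq_nonneg)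
  have "L2_sq (\<lambda>x. ?p x - v x) = L2_sq ?p - 2 * L2_inner ?p v + L2_sq v" by (rule L2_sq_diff[OF pL(1) v])
  moreover have "L2_inner ?p v = L2_inner v ?p" by (simp add: L2_inner_def inner_commute)
  moreover have "L2_sq (\<lambda>x. ?p x - v x) \<le> 2 * e" using translation_estimate[OF wg, of h] nh t2 by simp
  ultimately have "L2_sq v \<le> L2_inner v ?p + e" using L2_sq_translate[OF v, of h] by simp
  with 2 3 show "L2_sq v \<le> L2_sq G + L2_sq ?A + e" by simp
qed

section \<open>Oscillation around cube averages\<close>

definition cube :: "real \<Rightarrow> ('n::finite \<Rightarrow> int) \<Rightarrow> (real^'n) set" where
  "cube l z = {y. \<forall>i. \<lfloor>y $ i / l\<rfloor> = z i}"

definition cube_index :: "real \<Rightarrow> real^'n::finite \<Rightarrow> 'n \<Rightarrow> int" where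
  "cube_index l x = (\<lambda>i. \<lfloor>x $ i / l\<rfloor>)"

definition cube_avg :: "real \<Rightarrow> (real^'n::finite \<Rightarrow> complex) \<Rightarrow> ('n \<Rightarrow> int) \<Rightarrow> complex" where
  "cube_avg l v z = (1 / l ^ CARD('n)) *\<^sub>R (\<integral>y. indicator (cube l z) y *\<^sub>R v y \<partial>lborel)"

text \<open>The mean square difference between \<open>v(x)\<close> and the values of \<open>v\<close> at the points \<open>x + h\<close>, where \<open>h\<close> runs through
  the box of half-width \<open>l\<close>; the normalisation is by the volume of a cube of side \<open>l\<close>, which lies in \<open>x\<close> plus
  that box whenever it contains \<open>x\<close>.\<close>

definition osc :: "real \<Rightarrow> (real^'n::finite \<Rightarrow> complex) \<Rightarrow> real^'n \<Rightarrow> ennreal" where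
  "osc l v x = ennreal (1 / l ^ CARD('n)) *
     (\<integral>\<^sup>+h. indicator (cbox (- l *\<^sub>R 1) (l *\<^sub>R 1)) h * ennreal ((norm (v (x + h) - v x))\<^sup>2) \<partial>lborel)"

lemma mem_cube_index: "x \<in> cube l (cube_index l x)"
  by (simp add: cube_def cube_index_def)

lemma cube_iff: "l > 0 \<Longrightarrow> y \<in> cube l z \<longleftrightarrow> (\<forall>i. l * z i \<le> y $ i \<and> y $ i < l * (z i + 1))"
  by (auto simp: cube_def floor_eq_iff field_simps)

lemma cube_measurable [measurable]:
  fixes z :: "'n::finite \<Rightarrow> int"
  shows "cube l z \<in> sets borel"
proof -
  have [measurable]: "(\<lambda>y::real^'n. y $ i) \<in> borel_measurable borel" for i
    by (intro borel_measurable_continuous_onI continuous_intros)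
  have "(\<lambda>y::real^'n. real_of_int \<lfloor>y $ i / l\<rfloor>) \<in> borel_measurable borel" for i by measurable
  then have "{y \<in> space borel. \<forall>i. real_of_int \<lfloor>y $ i / l\<rfloor> = real_of_int (z i)} \<in> sets (borel :: (real^'n) measure)"
    by measurable
  then show ?thesis by (simp add: cube_def)
qed

lemma emeasure_scaled_box:
  fixes a :: "real^'n::finite"
  assumes "l \<ge> 0"
  shows "emeasure lborel (cbox a (a + l *\<^sub>R 1)) = ennreal (l ^ CARD('n))"
    "emeasure lborel (box a (a + l *\<^sub>R 1)) = ennreal (l ^ CARD('n))"
proof -
  have b: "(1 :: real^'n) \<bullet> b = 1" if "b \<in> Basis" for b
    using that by (auto simp: Basis_vec_def inner_axis)
  have p: "(\<Prod>b\<in>(Basis::(real^'n) set). (a + l *\<^sub>R 1 - a) \<bullet> b) = l ^ CARD('n)"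
    by (simp add: b)
  show "emeasure lborel (cbox a (a + l *\<^sub>R 1)) = ennreal (l ^ CARD('n))"
    unfolding p[symmetric] using assms by (intro emeasure_lborel_cbox) (simp add: inner_add_left b)
  show "emeasure lborel (box a (a + l *\<^sub>R 1)) = ennreal (l ^ CARD('n))"
    unfolding p[symmetric] using assms by (intro emeasure_lborel_box) (simp add: inner_add_left b)
qed

lemma emeasure_cube:
  fixes z :: "'n::finite \<Rightarrow> int"
  assumes "l > 0" shows "emeasure lborel (cube l z) = ennreal (l ^ CARD('n))"
proof -
  define a :: "real^'n" where "a = (\<chi> i. l * z i)"
  have "box a (a + l *\<^sub>R 1) \<subseteq> cube l z" "cube l z \<subseteq> cbox a (a + l *\<^sub>R 1)"
    using assms by (auto simp: cube_iff mem_box_cart a_def algebra_simps less_imp_le)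
  then have "emeasure lborel (box a (a + l *\<^sub>R 1)) \<le> emeasure lborel (cube l z)"
      "emeasure lborel (cube l z) \<le> emeasure lborel (cbox a (a + l *\<^sub>R 1))"
    by (auto intro!: emeasure_mono)
  then show ?thesis using emeasure_scaled_box[of l a] assms by simp
qed

lemma bounded_cube:
  fixes z :: "'n::finite \<Rightarrow> int"
  assumes "l > 0" shows "bounded (cube l z)"
proof -
  define a :: "real^'n" where "a = (\<chi> i. l * z i)"
  have "cube l z \<subseteq> cbox a (a + l *\<^sub>R 1)"
    using assms by (auto simp: cube_iff mem_box_cart a_def algebra_simps less_imp_le)
  then show ?thesis by (meson bounded_cbox bounded_subset)
qed

lemma integrable_on_cube: "L2 v \<Longrightarrow> l > 0 \<Longrightarrow> integrable lborel (\<lambda>y. indicator (cube l z) y *\<^sub>R v y)"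
  by (intro L2_scaleR_integrable L2_indicator bounded_cube cube_measurable)

lemma osc_measurable [measurable]:
  fixes v :: "real^'n::finite \<Rightarrow> complex"
  assumes "L2 v" shows "osc l v \<in> borel_measurable borel"
proof -
  have [measurable]: "v \<in> borel_measurable borel" using assms by (simp add: L2_def)
  show ?thesis unfolding osc_def by measurable
qed

text \<open>The difference from an average is the average of the differences, and Jensen's inequality applies.\<close>

lemma norm_diff_cube_avg_le_osc:
  fixes v :: "real^'n::finite \<Rightarrow> complex"
  assumes v: "L2 v" and l: "l > 0"
  shows "ennreal ((norm (v x - cube_avg l v (cube_index l x)))\<^sup>2) \<le> osc l v x"
proof -
  have [measurable]: "v \<in> borel_measurable borel" using v by (simp add: L2_def)
  let ?Q = "cube l (cube_index l x)"
  let ?c = "1 / l ^ CARD('n)"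
  have c: "?c > 0" using l by simp
  have iQ: "integrable lborel (indicator ?Q :: _ \<Rightarrow> real)"
    by (rule integrable_real_indicator) (use emeasure_cube[OF l, of "cube_index l x"] in auto)
  have "(\<integral>y. indicator ?Q y *\<^sub>R v x \<partial>lborel) = (l ^ CARD('n)) *\<^sub>R v x"
  proof -
    have "measure lborel ?Q = l ^ CARD('n)"
      using emeasure_cube[OF l, of "cube_index l x"] l by (simp add: measure_def)
    then show ?thesis using iQ by simp
  qed
  then have vx: "?c *\<^sub>R (\<integral>y. indicator ?Q y *\<^sub>R v x \<partial>lborel) = v x" using l by simp
  have "v x - cube_avg l v (cube_index l x) =
      ?c *\<^sub>R ((\<integral>y. indicator ?Q y *\<^sub>R v x \<partial>lborel) - (\<integral>y. indicator ?Q y *\<^sub>R v y \<partial>lborel))"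
    unfolding cube_avg_def by (simp only: scaleR_diff_right vx)
  also have "(\<integral>y. indicator ?Q y *\<^sub>R v x \<partial>lborel) - (\<integral>y. indicator ?Q y *\<^sub>R v y \<partial>lborel) = (\<integral>y. indicator ?Q y *\<^sub>R (v x - v y) \<partial>lborel)"
    using integrable_on_cube[OF v l] iQ by (simp add: scaleR_diff_right)
  finally have eq: "v x - cube_avg l v (cube_index l x) = ?c *\<^sub>R (\<integral>y. indicator ?Q y *\<^sub>R (v x - v y) \<partial>lborel)" .
  have "ennreal ((norm (v x - cube_avg l v (cube_index l x)))\<^sup>2) =
      ennreal (?c\<^sup>2) * ennreal ((norm (\<integral>y. indicator ?Q y *\<^sub>R (v x - v y) \<partial>lborel))\<^sup>2)"
    unfolding eq by (subst ennreal_mult[symmetric]) (auto simp: power_mult_distrib power_divide)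
  also have "\<dots> \<le> ennreal (?c\<^sup>2) * (emeasure lborel ?Q * (\<integral>\<^sup>+y. indicator ?Q y * ennreal ((norm (v x - v y))\<^sup>2) \<partial>lborel))"
    by (intro mult_left_mono norm_set_integral_square_le) auto
  also have "\<dots> = ennreal ?c * (\<integral>\<^sup>+y. indicator ?Q y * ennreal ((norm (v x - v y))\<^sup>2) \<partial>lborel)"
  proof -
    have "ennreal (?c\<^sup>2) * ennreal (l ^ CARD('n)) = ennreal ?c"
      using l by (subst ennreal_mult'[symmetric]) (auto simp: power2_eq_square)
    then show ?thesis by (simp add: emeasure_cube[OF l] mult.assoc[symmetric])
  qed
  also have "(\<integral>\<^sup>+y. indicator ?Q y * ennreal ((norm (v x - v y))\<^sup>2) \<partial>lborel)
      = (\<integral>\<^sup>+h. indicator ?Q (h + x) * ennreal ((norm (v x - v (h + x)))\<^sup>2) \<partial>lborel)"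
    by (rule nn_integral_translate[symmetric]) measurable
  also have "\<dots> \<le> (\<integral>\<^sup>+h. indicator (cbox (- l *\<^sub>R 1) (l *\<^sub>R 1)) h * ennreal ((norm (v (x + h) - v x))\<^sup>2) \<partial>lborel)"
  proof (rule nn_integral_mono)
    fix h :: "real^'n"
    have "h \<in> cbox (- l *\<^sub>R 1) (l *\<^sub>R 1)" if "h + x \<in> ?Q"
    proof -
      have "l * cube_index l x i \<le> (h + x) $ i" "(h + x) $ i < l * (cube_index l x i + 1)"
        "l * cube_index l x i \<le> x $ i" "x $ i < l * (cube_index l x i + 1)" for i
        using that mem_cube_index[of x l] l by (auto simp: cube_iff)
      then have "- l \<le> h $ i \<and> h $ i \<le> l" for i
        unfolding of_int_add of_int_1 distrib_left vector_add_component mult_1_right by (smt (verit, best))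
      then show ?thesis by (simp add: mem_box_cart)
    qed
    then show "indicator ?Q (h + x) * ennreal ((norm (v x - v (h + x)))\<^sup>2)
        \<le> indicator (cbox (- l *\<^sub>R 1) (l *\<^sub>R 1)) h * ennreal ((norm (v (x + h) - v x))\<^sup>2)"
      by (auto simp: indicator_def norm_minus_commute add.commute)
  qed
  finally show ?thesis unfolding osc_def by (simp add: mult_left_mono)
qed

definition osc_const :: "'n::finite itself \<Rightarrow> real" where
  "osc_const _ = 2 ^ CARD('n) * real CARD('n)"

lemma osc_const_pos: "osc_const TYPE('n::finite) > 0"
  by (simp add: osc_const_def)

text \<open>A Poincare inequality, obtained by integrating the translation estimate over the translations.\<close>

lemma nn_integral_osc_le:
  fixes v :: "real^'n::finite \<Rightarrow> complex"
  assumes w: "weak_grad v G" and l: "l > 0"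
  shows "(\<integral>\<^sup>+x. osc l v x \<partial>lborel) \<le> ennreal (osc_const TYPE('n) * l\<^sup>2 * L2_sq G)"
proof -
  have v: "L2 v" using weak_grad_L2[OF w] by simp
  have [measurable]: "v \<in> borel_measurable borel" using v by (simp add: L2_def)
  let ?B = "cbox (- l *\<^sub>R 1) (l *\<^sub>R 1) :: (real^'n) set"
  have eB: "emeasure lborel ?B = ennreal ((2 * l) ^ CARD('n))"
  proof -
    have "- l *\<^sub>R 1 + (2 * l) *\<^sub>R 1 = l *\<^sub>R (1 :: real^'n)" by (simp add: vec_eq_iff)
    from emeasure_scaled_box(1)[of "2 * l" "- l *\<^sub>R 1 :: real^'n", unfolded this] l show ?thesis by simp
  qed
  have "(\<integral>\<^sup>+x. osc l v x \<partial>lborel) = ennreal (1 / l ^ CARD('n)) *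
     (\<integral>\<^sup>+x. \<integral>\<^sup>+h. indicator ?B h * ennreal ((norm (v (x + h) - v x))\<^sup>2) \<partial>lborel \<partial>lborel)"
    unfolding osc_def by (rule nn_integral_cmult) measurable
  also have "(\<integral>\<^sup>+x. \<integral>\<^sup>+h. indicator ?B h * ennreal ((norm (v (x + h) - v x))\<^sup>2) \<partial>lborel \<partial>lborel)
      = (\<integral>\<^sup>+h. \<integral>\<^sup>+x. indicator ?B h * ennreal ((norm (v (x + h) - v x))\<^sup>2) \<partial>lborel \<partial>lborel)"
    by (rule lborel_pair.Fubini'[of "\<lambda>h x. indicator ?B h * ennreal ((norm (v (x + h) - v x))\<^sup>2)"]) measurable
  also have "\<dots> \<le> (\<integral>\<^sup>+h. indicator ?B h * ennreal (real CARD('n) * l\<^sup>2 * L2_sq G) \<partial>lborel)"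
  proof (rule nn_integral_mono)
    fix h :: "real^'n"
    have "(\<integral>\<^sup>+x. indicator ?B h * ennreal ((norm (v (x + h) - v x))\<^sup>2) \<partial>lborel) = indicator ?B h * ennreal (L2_sq (\<lambda>x. v (x + h) - v x))"
      by (subst nn_integral_cmult) (auto simp: nn_L2_sq[OF L2_diff[OF L2_translate[OF v] v]])
    also have "\<dots> \<le> indicator ?B h * ennreal (real CARD('n) * l\<^sup>2 * L2_sq G)"
    proof (cases "h \<in> ?B")
      case True
      have "(norm h)\<^sup>2 = (\<Sum>i\<in>UNIV. (h $ i)\<^sup>2)" by (simp add: norm_vec_def L2_set_def sum_nonneg)
      also have "\<dots> \<le> (\<Sum>i\<in>(UNIV::'n set). l\<^sup>2)"
        using True l by (intro sum_mono) (auto simp: mem_box_cart abs_le_square_iff[symmetric] abs_le_iff minus_le_iff)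
      finally have "(norm h)\<^sup>2 \<le> real CARD('n) * l\<^sup>2" by simp
      then have "(norm h)\<^sup>2 * L2_sq G \<le> real CARD('n) * l\<^sup>2 * L2_sq G" by (intro mult_right_mono L2_sq_nonneg)
      then show ?thesis using translation_estimate[OF w, of h] True by (auto intro!: ennreal_leI)
    qed simp
    finally show "(\<integral>\<^sup>+x. indicator ?B h * ennreal ((norm (v (x + h) - v x))\<^sup>2) \<partial>lborel) \<le> indicator ?B h * ennreal (real CARD('n) * l\<^sup>2 * L2_sq G)" .
  qed
  also have "\<dots> = ennreal ((2 * l) ^ CARD('n)) * ennreal (real CARD('n) * l\<^sup>2 * L2_sq G)"
    by (subst nn_integral_multc) (use eB in auto)
  also have "ennreal (1 / l ^ CARD('n)) * \<dots> = ennreal (osc_const TYPE('n) * l\<^sup>2 * L2_sq G)"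
    using l L2_sq_nonneg[of G] by (simp add: ennreal_mult'[symmetric] osc_const_def power_mult_distrib mult_ac)
  finally show ?thesis by (simp add: mult_left_mono)
qed

definition nn_power_int :: "real \<Rightarrow> (real^'n::finite \<Rightarrow> complex) \<Rightarrow> ennreal" where
  "nn_power_int q v = (\<integral>\<^sup>+x. ennreal (norm (v x) powr q) \<partial>lborel)"

lemma nn_power_int_2: "L2 v \<Longrightarrow> nn_power_int 2 v = ennreal (L2_sq v)"
  by (simp add: nn_power_int_def nn_L2_sq)

text \<open>Up to the factor two this is Jensen's inequality for the power \<open>q\<close>. It follows from the elementary
  inequality \<open>t \<le> c + c\<^sup>1\<^sup>-\<^sup>q t\<^sup>q\<close>.\<close>

lemma norm_cube_avg_le:
  fixes v :: "real^'n::finite \<Rightarrow> complex"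
  assumes v: "L2 v" and l: "l > 0" and q: "q \<ge> 1" and I: "nn_power_int q v \<le> ennreal C" and C: "C \<ge> 0"
    and c: "c > 0" "C / l ^ CARD('n) \<le> c powr q"
  shows "norm (cube_avg l v z) \<le> 2 * c"
proof -
  have [measurable]: "v \<in> borel_measurable borel" using v by (simp add: L2_def)
  let ?Q = "cube l z"
  have pt: "t \<le> c + c powr (1 - q) * t powr q" if "t \<ge> 0" for t
  proof (cases "t \<le> c")
    case True
    have "0 \<le> c powr (1 - q) * t powr q" by simp
    with True show ?thesis by linarith
  next
    case False
    have "t = t powr (1 - q) * t powr q" using False c by (simp add: powr_add[symmetric])
    also have "\<dots> \<le> c powr (1 - q) * t powr q"
      using False c q by (intro mult_right_mono powr_mono2') auto
    finally show ?thesis using c by simp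
  qed
  have "ennreal (norm (\<integral>y. indicator ?Q y *\<^sub>R v y \<partial>lborel)) \<le> (\<integral>\<^sup>+y. ennreal (norm (indicator ?Q y *\<^sub>R v y)) \<partial>lborel)"
    by (rule integral_norm_bound_ennreal[OF integrable_on_cube[OF v l]])
  also have "\<dots> \<le> (\<integral>\<^sup>+y. ennreal c * indicator ?Q y + ennreal (c powr (1 - q)) * ennreal (norm (v y) powr q) \<partial>lborel)"
  proof (rule nn_integral_mono)
    fix y
    have "ennreal (norm (v y)) \<le> ennreal c + ennreal (c powr (1 - q)) * ennreal (norm (v y) powr q)"
      using pt[of "norm (v y)"] c by (simp add: ennreal_mult'[symmetric] ennreal_plus[symmetric] ennreal_leI del: ennreal_plus)
    then show "ennreal (norm (indicator ?Q y *\<^sub>R v y)) \<le> ennreal c * indicator ?Q y + ennreal (c powr (1 - q)) * ennreal (norm (v y) powr q)"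
      by (auto simp: indicator_def)
  qed
  also have "\<dots> = ennreal c * ennreal (l ^ CARD('n)) + ennreal (c powr (1 - q)) * nn_power_int q v"
    unfolding nn_power_int_def
    by (subst nn_integral_add, measurable, subst nn_integral_cmult, measurable,
        subst nn_integral_cmult, measurable, simp add: emeasure_cube[OF l])
  also have "\<dots> \<le> ennreal c * ennreal (l ^ CARD('n)) + ennreal (c powr (1 - q)) * ennreal C"
    by (intro add_left_mono mult_left_mono I) auto
  also have "\<dots> = ennreal (c * l ^ CARD('n) + c powr (1 - q) * C)"
    using c l C by (simp add: ennreal_mult' ennreal_plus)
  finally have "norm (\<integral>y. indicator ?Q y *\<^sub>R v y \<partial>lborel) \<le> c * l ^ CARD('n) + c powr (1 - q) * C"
    using c l C by (subst (asm) ennreal_le_iff) auto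
  also have "C \<le> c powr q * l ^ CARD('n)" using c(2) l by (simp add: field_simps)
  then have "c powr (1 - q) * C \<le> c powr (1 - q) * (c powr q * l ^ CARD('n))" by (intro mult_left_mono) auto
  also have "c powr (1 - q) * (c powr q * l ^ CARD('n)) = c * l ^ CARD('n)"
    using c by (simp add: mult.assoc[symmetric] powr_add[symmetric])
  finally have "norm (\<integral>y. indicator ?Q y *\<^sub>R v y \<partial>lborel) \<le> 2 * c * l ^ CARD('n)" by simp
  then show ?thesis using l by (simp add: cube_avg_def field_simps)
qed

text \<open>Where the value is large and the average is small, the value is controlled by the oscillation.\<close>

lemma square_le_osc_if_avg_small:
  fixes v :: "real^'n::finite \<Rightarrow> complex"
  assumes v: "L2 v" and l: "l > 0" and s: "norm (cube_avg l v (cube_index l x)) \<le> norm (v x) / 2"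
  shows "ennreal ((norm (v x))\<^sup>2) \<le> 4 * osc l v x"
proof -
  have "norm (v x) \<le> 2 * norm (v x - cube_avg l v (cube_index l x))"
    using s norm_triangle_ineq2[of "v x" "cube_avg l v (cube_index l x)"] by linarith
  then have "(norm (v x))\<^sup>2 \<le> (2 * norm (v x - cube_avg l v (cube_index l x)))\<^sup>2" by (intro power_mono) auto
  then have "ennreal ((norm (v x))\<^sup>2) \<le> ennreal (4 * (norm (v x - cube_avg l v (cube_index l x)))\<^sup>2)"
    by (intro ennreal_leI) (simp add: power_mult_distrib)
  also have "\<dots> = 4 * ennreal ((norm (v x - cube_avg l v (cube_index l x)))\<^sup>2)" by (simp add: ennreal_mult')
  also have "\<dots> \<le> 4 * osc l v x" by (intro mult_left_mono norm_diff_cube_avg_le_osc v l) auto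
  finally show ?thesis .
qed

section \<open>The subcritical Sobolev inequality\<close>

text \<open>The type argument only carries the dimension.\<close>

definition sobolev_bound :: "'n::finite itself \<Rightarrow> real \<Rightarrow> bool" where
  "sobolev_bound _ q \<longleftrightarrow> (\<exists>C>0. \<forall>(v::real^'n \<Rightarrow> complex) G. weak_grad v G \<longrightarrow> L2_sq v + L2_sq G \<le> 1 \<longrightarrow> nn_power_int q v \<le> ennreal C)"

lemma powr_step_bound:
  fixes t r :: real and i :: nat
  assumes "2 ^ i < t" "t \<le> 2 ^ Suc i" "r \<ge> 2"
  shows "t powr r \<le> 2 powr (real (Suc i) * (r - 2)) * t\<^sup>2"
proof -
  have t: "t > 0" using assms(1) by (meson less_trans zero_less_numeral zero_less_power)
  have "t powr r = t powr (r - 2) * t\<^sup>2" using t by (simp add: powr_add[symmetric] flip: powr_numeral)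
  also have "t powr (r - 2) \<le> (2 ^ Suc i) powr (r - 2)" using assms t by (intro powr_mono2) auto
  also have "(2 ^ Suc i) powr (r - 2) = (2::real) powr (real (Suc i) * (r - 2))"
  proof -
    have "(2::real) ^ Suc i = 2 powr real (Suc i)" by (rule powr_realpow[symmetric]) simp
    then show ?thesis by (simp only: powr_powr)
  qed
  finally show ?thesis by (simp add: mult_right_mono)
qed

text \<open>A bound for exponent \<open>q\<close> makes the averages over cubes of side \<open>l\<close> at most a constant times \<open>l\<^sup>-\<^sup>N\<^sup>/\<^sup>q\<close>. On the set where
  \<open>|v|\<close> is about \<open>2\<^sup>i\<close>, choose \<open>l\<close> so that this is at most half of \<open>2\<^sup>i\<close>: there \<open>|v|\<^sup>2\<close> is at most four times the
  oscillation, whose integral is of order \<open>l\<^sup>2\<close>. Multiplying by \<open>2\<^sup>i\<^sup>(\<^sup>r\<^sup>-\<^sup>2\<^sup>)\<close> and summing over \<open>i\<close> gives a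
  geometric series, which converges exactly for \<open>r < 2 + 2q/N\<close>.\<close>

lemma sobolev_bound_step:
  assumes q: "q \<ge> 2" and B: "sobolev_bound TYPE('n::finite) q" and r: "2 \<le> r" "r < 2 + 2 * q / real CARD('n)"
  shows "sobolev_bound TYPE('n) r"
proof -
  let ?N = "real CARD('n)"
  have N: "?N > 0" by simp
  obtain C where C: "C > 0" "\<And>(v::real^'n \<Rightarrow> complex) G. weak_grad v G \<Longrightarrow> L2_sq v + L2_sq G \<le> 1 \<Longrightarrow> nn_power_int q v \<le> ennreal C"
    using B unfolding sobolev_bound_def by metis
  \<comment> \<open>Averages will be at most \<open>2 c\<^sub>i\<close>, half of the level \<open>2\<^sup>i\<close>; the side \<open>l\<^sub>i\<close> is the one for which \<open>C / l\<^sub>i\<^sup>N = c\<^sub>i\<^sup>q\<close>.\<close>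
  define c where "c i = 2 ^ i / (4::real)" for i :: nat
  define l where "l i = (C / c i powr q) powr (1 / ?N)" for i
  have c: "c i > 0" for i by (simp add: c_def)
  have l: "l i > 0" for i using C c[of i] by (simp add: l_def)
  have lN: "l i ^ CARD('n) = C / c i powr q" for i
  proof -
    have "l i ^ CARD('n) = l i powr ?N" using l by (simp add: powr_realpow)
    also have "\<dots> = (C / c i powr q) powr 1" unfolding l_def using C by (subst powr_powr) simp
    finally show ?thesis using C c[of i] by simp
  qed
  define K where "K = (C * 4 powr q) powr (2 / ?N)"
  have l2: "(l i)\<^sup>2 = K * 2 powr (- (real i * (2 * q / ?N)))" for i
  proof -
    have "(l i)\<^sup>2 = (C / c i powr q) powr (2 / ?N)"
      unfolding l_def using C by (simp add: powr_powr flip: powr_numeral)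
    also have "C / c i powr q = (C * 4 powr q) * 2 powr (- (real i * q))"
    proof -
      have "c i powr q = 2 powr (real i * q) / 4 powr q"
        unfolding c_def powr_realpow[symmetric, of 2 i, simplified] by (simp add: powr_divide powr_powr)
      then show ?thesis by (simp add: powr_minus divide_inverse)
    qed
    also have "\<dots> powr (2 / ?N) = K * 2 powr (- (real i * q) * (2 / ?N))"
      unfolding K_def using C by (subst powr_mult) (auto simp: powr_powr)
    finally show ?thesis by (simp add: algebra_simps)
  qed
  \<comment> \<open>The ratio of the geometric series; it is below one by the assumption on \<open>r\<close>.\<close>
  define \<rho> where "\<rho> = (2::real) powr (r - 2 - 2 * q / ?N)"
  have \<rho>: "0 < \<rho>" "\<rho> < 1" using r by (auto simp: \<rho>_def powr_less_one)
  let ?O = "osc_const TYPE('n)"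
  define A where "A = 4 * 2 powr (r - 2) * ?O * K"
  have A: "A \<ge> 0" using osc_const_pos[where 'n='n] by (simp add: A_def K_def less_imp_le)
  have trm: "2 powr (real (Suc i) * (r - 2)) * 4 * (?O * (l i)\<^sup>2) = A * \<rho> ^ i" for i
  proof -
    have "2 powr (real (Suc i) * (r - 2)) * 2 powr (- (real i * (2 * q / ?N))) = 2 powr (r - 2) * \<rho> ^ i"
      unfolding \<rho>_def
      by (simp add: powr_realpow[symmetric] powr_powr powr_add[symmetric]) (simp add: algebra_simps)
    then show ?thesis unfolding l2 A_def by (simp add: mult_ac)
  qed
  show ?thesis unfolding sobolev_bound_def
  proof (intro exI[of _ "1 + A / (1 - \<rho>)"] conjI allI impI)
    show "1 + A / (1 - \<rho>) > 0" using A \<rho> by (simp add: add_pos_nonneg)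
    fix v :: "real^'n \<Rightarrow> complex" and G assume w: "weak_grad v G" and n: "L2_sq v + L2_sq G \<le> 1"
    have v: "L2 v" using weak_grad_L2[OF w] by simp
    note [measurable] = L2_measurable[OF v] osc_measurable[OF v]
    have I: "nn_power_int q v \<le> ennreal C" by (rule C(2)[OF w n])
    have avg: "norm (cube_avg (l i) v z) \<le> 2 ^ i / 2" for i z
      using norm_cube_avg_le[OF v l[of i] _ I _ c[of i], of z] q C(1) by (simp add: lN c_def)
    have pt: "ennreal (norm (v x) powr r) \<le> ennreal ((norm (v x))\<^sup>2) +
        (\<Sum>i. ennreal (2 powr (real (Suc i) * (r - 2)) * 4) * osc (l i) v x)" for x
    proof (cases "norm (v x) \<le> 1")
      case True
      have "norm (v x) powr r \<le> (norm (v x))\<^sup>2"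
      proof (cases "v x = 0")
        case False
        then have "norm (v x) powr r \<le> norm (v x) powr 2" using True r by (intro powr_mono') auto
        then show ?thesis by simp
      qed simp
      then show ?thesis by (intro add_increasing2) (auto intro!: ennreal_leI)
    next
      case False
      then have "norm (v x) > 1" by simp
      define i where "i = (LEAST i. norm (v x) \<le> 2 ^ Suc i)"
      obtain j where "norm (v x) < 2 ^ j" using real_arch_pow[of 2 "norm (v x)"] by auto
      moreover have "(2::real) ^ j \<le> 2 ^ Suc j" by (rule power_increasing) auto
      ultimately have ex: "norm (v x) \<le> 2 ^ Suc j" by linarith
      have i1: "norm (v x) \<le> 2 ^ Suc i" unfolding i_def by (rule LeastI[of "\<lambda>i. norm (v x) \<le> 2 ^ Suc i", OF ex])
      have i2: "2 ^ i < norm (v x)"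
      proof (cases i)
        case 0 then show ?thesis using \<open>norm (v x) > 1\<close> by simp
      next
        case (Suc k)
        then have "k < i" by simp
        from not_less_Least[OF this[unfolded i_def]] show ?thesis using Suc by simp
      qed
      have "norm (v x) powr r \<le> 2 powr (real (Suc i) * (r - 2)) * (norm (v x))\<^sup>2"
        by (rule powr_step_bound[OF i2 i1 r(1)])
      then have "ennreal (norm (v x) powr r) \<le> ennreal (2 powr (real (Suc i) * (r - 2))) * ennreal ((norm (v x))\<^sup>2)"
        by (simp add: ennreal_mult'[symmetric] ennreal_leI)
      also have "\<dots> \<le> ennreal (2 powr (real (Suc i) * (r - 2))) * (4 * osc (l i) v x)"
        using avg[of i "cube_index (l i) x"] i2
        by (intro mult_left_mono square_le_osc_if_avg_small v l) auto
      also have "\<dots> = ennreal (2 powr (real (Suc i) * (r - 2)) * 4) * osc (l i) v x"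
        by (simp add: ennreal_mult' mult.assoc)
      also have "\<dots> \<le> (\<Sum>i. ennreal (2 powr (real (Suc i) * (r - 2)) * 4) * osc (l i) v x)"
        using sum_le_suminf[of "\<lambda>i. ennreal (2 powr (real (Suc i) * (r - 2)) * 4) * osc (l i) v x" "{i}"] by simp
      finally show ?thesis by (rule add_increasing[rotated]) simp
    qed
    have "nn_power_int r v \<le> (\<integral>\<^sup>+x. ennreal ((norm (v x))\<^sup>2) + (\<Sum>i. ennreal (2 powr (real (Suc i) * (r - 2)) * 4) * osc (l i) v x) \<partial>lborel)"
      unfolding nn_power_int_def by (rule nn_integral_mono) (rule pt)
    also have "\<dots> = ennreal (L2_sq v) + (\<Sum>i. ennreal (2 powr (real (Suc i) * (r - 2)) * 4) * (\<integral>\<^sup>+x. osc (l i) v x \<partial>lborel))"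
      by (subst nn_integral_add, measurable, subst nn_integral_suminf, measurable, subst nn_integral_cmult, measurable)
         (simp add: nn_L2_sq[OF v])
    also have "\<dots> \<le> ennreal 1 + (\<Sum>i. ennreal (A * \<rho> ^ i))"
    proof (intro add_mono suminf_le)
      show "ennreal (L2_sq v) \<le> ennreal 1" using n L2_sq_nonneg[of G] by (intro ennreal_leI) simp
      fix i
      have "ennreal (2 powr (real (Suc i) * (r - 2)) * 4) * (\<integral>\<^sup>+x. osc (l i) v x \<partial>lborel)
          \<le> ennreal (2 powr (real (Suc i) * (r - 2)) * 4) * ennreal (?O * (l i)\<^sup>2 * L2_sq G)"
        by (intro mult_left_mono nn_integral_osc_le w l) auto
      also have "\<dots> \<le> ennreal (2 powr (real (Suc i) * (r - 2)) * 4) * ennreal (?O * (l i)\<^sup>2 * 1)"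
        using n L2_sq_nonneg[of v] osc_const_pos[where 'n='n]
        by (intro mult_left_mono ennreal_leI) (auto intro!: mult_left_mono)
      also have "\<dots> = ennreal (A * \<rho> ^ i)"
        using trm[of i] by (simp add: ennreal_mult'[symmetric] del: of_nat_Suc)
      finally show "ennreal (2 powr (real (Suc i) * (r - 2)) * 4) * (\<integral>\<^sup>+x. osc (l i) v x \<partial>lborel) \<le> ennreal (A * \<rho> ^ i)" .
    qed auto
    also have "(\<Sum>i. ennreal (A * \<rho> ^ i)) = ennreal (A / (1 - \<rho>))"
    proof (rule suminf_ennreal_eq)
      show "(\<lambda>i. A * \<rho> ^ i) sums (A / (1 - \<rho>))"
        using sums_mult[OF geometric_sums[of \<rho>], of A] \<rho> by simp
    qed (use A \<rho> in auto)
    also have "ennreal 1 + ennreal (A / (1 - \<rho>)) = ennreal (1 + A / (1 - \<rho>))"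
      using A \<rho> by (subst ennreal_plus) auto
    finally show "nn_power_int r v \<le> ennreal (1 + A / (1 - \<rho>))" .
  qed
qed

text \<open>Iteration of the previous step from \<open>q = 2\<close>. The map \<open>q \<mapsto> 2 + 2q/N\<close> has the critical exponent as its fixed point,
  so below a subcritical \<open>r\<close> each step gains at least a fixed amount \<open>d\<close>.\<close>

lemma sobolev_bound_subcritical:
  assumes N: "CARD('n::finite) \<ge> 2" and r: "2 \<le> r" "r < 2 + 2 * r / real CARD('n)"
  shows "sobolev_bound TYPE('n) r"
proof -
  let ?N = "real CARD('n)"
  have Np: "?N \<ge> 2" using N by simp
  \<comment> \<open>Half of the gap \<open>2 + 2q/N - q\<close> at \<open>q = r\<close>; the gap is at least as large for smaller \<open>q\<close>.\<close>
  define d where "d = (2 + 2 * r / ?N - r) / 2"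
  have d: "d > 0" using r by (simp add: d_def)
  have "sobolev_bound TYPE('n) (min r (2 + real j * d))" for j
  proof (induction j)
    case 0
    have "sobolev_bound TYPE('n) 2" unfolding sobolev_bound_def
    proof (intro exI[of _ 1] conjI allI impI)
      fix v :: "real^'n \<Rightarrow> complex" and G assume "weak_grad v G" "L2_sq v + L2_sq G \<le> 1"
      then show "nn_power_int 2 v \<le> ennreal 1" using weak_grad_L2(1)[of v G] L2_sq_nonneg[of G] by (subst nn_power_int_2) (auto intro!: ennreal_leI)
    qed simp
    then show ?case using r by simp
  next
    case (Suc j)
    let ?q = "min r (2 + real j * d)"
    have q: "?q \<ge> 2" using r d by simp
    have "?q + d < 2 + 2 * ?q / ?N"
    proof -
      have "?q * (1 - 2 / ?N) \<le> r * (1 - 2 / ?N)" using Np by (intro mult_right_mono) auto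
      moreover have "r * (1 - 2 / ?N) = 2 - 2 * d" by (simp add: d_def field_simps)
      ultimately show ?thesis using d by (simp add: algebra_simps)
    qed
    moreover have "min r (2 + real (Suc j) * d) \<le> ?q + d" using d by (simp add: min_def algebra_simps)
    ultimately have "min r (2 + real (Suc j) * d) < 2 + 2 * ?q / ?N" by linarith
    then show ?case using q r d by (intro sobolev_bound_step[OF q Suc.IH]) auto
  qed
  moreover obtain j :: nat where "r / d < real j" using reals_Archimedean2 by blast
  then have "min r (2 + real j * d) = r" using d by (simp add: field_simps min_def)
  ultimately show ?thesis by metis
qed

lemma weak_grad_scaleR: "weak_grad v G \<Longrightarrow> weak_grad (\<lambda>x. c *\<^sub>R v x) (\<lambda>x. c *\<^sub>R G x)"
  using weak_grad_lincomb[of v G v G c 0] by simp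

lemma nn_power_int_scaleR: "v \<in> borel_measurable borel \<Longrightarrow> nn_power_int q (\<lambda>x. c *\<^sub>R v x) = ennreal (\<bar>c\<bar> powr q) * nn_power_int q v"
  unfolding nn_power_int_def by (subst nn_integral_cmult[symmetric]) (auto simp: powr_mult ennreal_mult')

text \<open>Homogeneous form. The bound \<open>s\<close> is required to be positive but need not be attained, which includes
  functions that vanish almost everywhere.\<close>

lemma sobolev_inequality:
  assumes "sobolev_bound TYPE('n::finite) q" and q: "q > 0"
  obtains C where "C > 0"
    "\<And>(v::real^'n \<Rightarrow> complex) G s. weak_grad v G \<Longrightarrow> s > 0 \<Longrightarrow> L2_sq v + L2_sq G \<le> s \<Longrightarrow> nn_power_int q v \<le> ennreal (C * s powr (q / 2))"
proof -
  obtain C where C: "C > 0" "\<And>(v::real^'n \<Rightarrow> complex) G. weak_grad v G \<Longrightarrow> L2_sq v + L2_sq G \<le> 1 \<Longrightarrow> nn_power_int q v \<le> ennreal C"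
    using assms unfolding sobolev_bound_def by metis
  show ?thesis
  proof (rule that[OF C(1)])
    fix v :: "real^'n \<Rightarrow> complex" and G and s :: real
    assume w: "weak_grad v G" and s: "s > 0" "L2_sq v + L2_sq G \<le> s"
    have vm: "v \<in> borel_measurable borel" using weak_grad_L2[OF w] by (simp add: L2_def)
    have "L2_sq (\<lambda>x. (1 / sqrt s) *\<^sub>R v x) + L2_sq (\<lambda>x. (1 / sqrt s) *\<^sub>R G x) \<le> 1"
      using s unfolding L2_sq_scaleR by (simp add: power_divide field_simps)
    then have I: "nn_power_int q (\<lambda>x. (1 / sqrt s) *\<^sub>R v x) \<le> ennreal C" by (intro C(2)[OF weak_grad_scaleR[OF w]])
    have "v = (\<lambda>x. sqrt s *\<^sub>R ((1 / sqrt s) *\<^sub>R v x))" using s by simp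
    then have "nn_power_int q v = ennreal (\<bar>sqrt s\<bar> powr q) * nn_power_int q (\<lambda>x. (1 / sqrt s) *\<^sub>R v x)"
      using nn_power_int_scaleR[of "\<lambda>x. (1 / sqrt s) *\<^sub>R v x" q "sqrt s"] vm by simp
    also have "\<dots> \<le> ennreal (\<bar>sqrt s\<bar> powr q) * ennreal C" by (intro mult_left_mono I) auto
    also have "\<dots> = ennreal (C * s powr (q / 2))"
      using s C(1) by (simp add: ennreal_mult'[symmetric] powr_half_sqrt[symmetric] powr_powr mult.commute)
    finally show "nn_power_int q v \<le> ennreal (C * s powr (q / 2))" .
  qed
qed

section \<open>Non-vanishing and local compactness\<close>

lemma cball_measurable [measurable, simp]: "cball a r \<in> sets borel"
  by (intro borel_closed closed_cball)

lemma ennreal_add3: "0 \<le> a \<Longrightarrow> 0 \<le> b \<Longrightarrow> 0 \<le> c \<Longrightarrow> ennreal a + (ennreal b + ennreal c) = ennreal (a + (b + c))"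
  by simp

text \<open>Lions' lemma: if all cube averages were small, the power integral would be small. Values below \<open>lm\<close> contribute
  little by the \<open>L\<^sup>2\<close> bound, values above \<open>M\<close> by the bound for the larger exponent \<open>q1\<close>, and the values between
  them by the oscillation, which is small for small cubes.\<close>

lemma nonvanishing_cube_average:
  assumes q: "2 < q" "q < q1" and S: "sobolev_bound TYPE('n::finite) q1" and A: "A > 0"
  obtains l \<delta> where "l > 0" "\<delta> > 0"
    "\<And>(v::real^'n \<Rightarrow> complex) G. weak_grad v G \<Longrightarrow> L2_sq v + L2_sq G \<le> A \<Longrightarrow> nn_power_int q v \<ge> 1 \<Longrightarrow> \<exists>z. norm (cube_avg l v z) > \<delta>"
proof -
  obtain C where C: "C > 0"
    "\<And>(v::real^'n \<Rightarrow> complex) G s. weak_grad v G \<Longrightarrow> s > 0 \<Longrightarrow> L2_sq v + L2_sq G \<le> s \<Longrightarrow> nn_power_int q1 v \<le> ennreal (C * s powr (q1 / 2))"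
    using sobolev_inequality[OF S] q by (metis less_trans zero_less_numeral)
  define B where "B = C * A powr (q1 / 2)"
  have B: "B > 0" using A C by (simp add: B_def)
  \<comment> \<open>Each of the three constants makes its contribution to the integral equal to \<open>1/4\<close>.\<close>
  define lm where "lm = (1 / (4 * A)) powr (1 / (q - 2))"
  define M where "M = (4 * B) powr (1 / (q1 - q))"
  let ?K = "osc_const TYPE('n)"
  define l where "l = sqrt (1 / (16 * M powr (q - 2) * ?K * A))"
  have lam: "lm > 0" "lm powr (q - 2) * A = 1 / 4"
    using A q by (simp_all add: lm_def powr_powr)
  have M: "M > 0" "M powr (q - q1) * B = 1 / 4"
  proof -
    have "M powr (q - q1) = (4 * B) powr (-1)"
    proof -
      have "1 / (q1 - q) * (q - q1) = - 1" using q by (simp add: divide_simps)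
      then show ?thesis unfolding M_def by (simp only: powr_powr)
    qed
    then show "M powr (q - q1) * B = 1 / 4" using B by (simp add: powr_minus_divide)
    show "M > 0" using B by (simp add: M_def)
  qed
  have K: "?K > 0" by (rule osc_const_pos)
  have l: "l > 0" unfolding l_def using M A K by simp
  have l2: "M powr (q - 2) * 4 * (?K * l\<^sup>2 * A) = 1 / 4"
  proof -
    have "l\<^sup>2 = 1 / (16 * M powr (q - 2) * ?K * A)" unfolding l_def using M A K by (intro real_sqrt_pow2) simp
    moreover have "M powr (q - 2) > 0" using M by simp
    ultimately show ?thesis using M A K by simp
  qed
  show ?thesis
  proof (rule that[OF l, of "lm / 2"])
    show "lm / 2 > 0" using lam by simp
    fix v :: "real^'n \<Rightarrow> complex" and G
    assume w: "weak_grad v G" and n: "L2_sq v + L2_sq G \<le> A" and I: "nn_power_int q v \<ge> 1"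
    have v: "L2 v" using weak_grad_L2[OF w] by simp
    note [measurable] = L2_measurable[OF v] osc_measurable[OF v]
    show "\<exists>z. norm (cube_avg l v z) > lm / 2"
    proof (rule ccontr)
      assume "\<nexists>z. norm (cube_avg l v z) > lm / 2"
      then have avg: "norm (cube_avg l v z) \<le> lm / 2" for z by (meson not_less)
      have pt: "ennreal (norm (v x) powr q) \<le> ennreal (lm powr (q - 2)) * ennreal ((norm (v x))\<^sup>2)
          + (ennreal (M powr (q - q1)) * ennreal (norm (v x) powr q1) + ennreal (M powr (q - 2) * 4) * osc l v x)" for x
      proof -
        have split: "norm (v x) powr q = norm (v x) powr (q - 2) * (norm (v x))\<^sup>2" if "v x \<noteq> 0"
          using that by (simp add: powr_add[symmetric] flip: powr_numeral)
        consider "v x = 0" | "v x \<noteq> 0" "norm (v x) \<le> lm" | "v x \<noteq> 0" "lm < norm (v x)" "norm (v x) \<le> M" | "v x \<noteq> 0" "M < norm (v x)"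
          by (meson not_less)
        then show ?thesis
        proof cases
          case 1 then show ?thesis by simp
        next
          case 2
          have "norm (v x) powr q \<le> lm powr (q - 2) * (norm (v x))\<^sup>2"
            unfolding split[OF 2(1)] using 2 q by (intro mult_right_mono powr_mono2) auto
          then have "ennreal (norm (v x) powr q) \<le> ennreal (lm powr (q - 2)) * ennreal ((norm (v x))\<^sup>2)"
            by (simp add: ennreal_mult'[symmetric] ennreal_leI)
          then show ?thesis by (rule add_increasing2[rotated]) simp
        next
          case 3
          have "norm (v x) powr q \<le> M powr (q - 2) * (norm (v x))\<^sup>2"
            unfolding split[OF 3(1)] using 3 q by (intro mult_right_mono powr_mono2) auto
          then have "ennreal (norm (v x) powr q) \<le> ennreal (M powr (q - 2)) * ennreal ((norm (v x))\<^sup>2)"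
            by (simp add: ennreal_mult'[symmetric] ennreal_leI)
          also have "\<dots> \<le> ennreal (M powr (q - 2)) * (4 * osc l v x)"
            using avg[of "cube_index l x"] 3 by (intro mult_left_mono square_le_osc_if_avg_small v l) auto
          also have "\<dots> = ennreal (M powr (q - 2) * 4) * osc l v x" by (simp add: ennreal_mult' mult.assoc)
          finally show ?thesis by (intro add_increasing) auto
        next
          case 4
          have "norm (v x) powr q = norm (v x) powr (q - q1) * norm (v x) powr q1" using 4 by (simp add: powr_add[symmetric])
          also have "\<dots> \<le> M powr (q - q1) * norm (v x) powr q1"
            using 4 q M by (intro mult_right_mono powr_mono2') auto
          finally have "ennreal (norm (v x) powr q) \<le> ennreal (M powr (q - q1)) * ennreal (norm (v x) powr q1)"
            by (simp add: ennreal_mult'[symmetric] ennreal_leI)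
          then show ?thesis by (intro add_increasing add_increasing2) auto
        qed
      qed
      have "nn_power_int q v \<le> (\<integral>\<^sup>+x. ennreal (lm powr (q - 2)) * ennreal ((norm (v x))\<^sup>2)
          + (ennreal (M powr (q - q1)) * ennreal (norm (v x) powr q1) + ennreal (M powr (q - 2) * 4) * osc l v x) \<partial>lborel)"
        unfolding nn_power_int_def by (rule nn_integral_mono) (rule pt)
      also have "\<dots> = ennreal (lm powr (q - 2)) * ennreal (L2_sq v) + (ennreal (M powr (q - q1)) * nn_power_int q1 v
          + ennreal (M powr (q - 2) * 4) * (\<integral>\<^sup>+x. osc l v x \<partial>lborel))"
        unfolding nn_power_int_def
        by (subst nn_integral_add, measurable, subst nn_integral_add, measurable, subst nn_integral_cmult, measurable,
            subst nn_integral_cmult, measurable, subst nn_integral_cmult, measurable) (simp add: nn_L2_sq[OF v])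
      also have "\<dots> \<le> ennreal (1/4) + (ennreal (1/4) + ennreal (1/4))"
      proof (intro add_mono)
        have "ennreal (lm powr (q - 2)) * ennreal (L2_sq v) \<le> ennreal (lm powr (q - 2)) * ennreal A"
          using n L2_sq_nonneg[of G] by (intro mult_left_mono ennreal_leI) auto
        also have "\<dots> = ennreal (1/4)" by (subst ennreal_mult'[symmetric]) (auto simp: lam)
        finally show "ennreal (lm powr (q - 2)) * ennreal (L2_sq v) \<le> ennreal (1/4)" .
        have "ennreal (M powr (q - q1)) * nn_power_int q1 v \<le> ennreal (M powr (q - q1)) * ennreal B"
          unfolding B_def by (intro mult_left_mono C(2)[OF w A n]) auto
        also have "\<dots> = ennreal (1/4)" by (subst ennreal_mult'[symmetric]) (auto simp: M)
        finally show "ennreal (M powr (q - q1)) * nn_power_int q1 v \<le> ennreal (1/4)" .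
        have "ennreal (M powr (q - 2) * 4) * (\<integral>\<^sup>+x. osc l v x \<partial>lborel) \<le> ennreal (M powr (q - 2) * 4) * ennreal (?K * l\<^sup>2 * L2_sq G)"
          by (intro mult_left_mono nn_integral_osc_le w l) auto
        also have "\<dots> \<le> ennreal (M powr (q - 2) * 4) * ennreal (?K * l\<^sup>2 * A)"
          using n L2_sq_nonneg[of v] K by (intro mult_left_mono ennreal_leI) auto
        also have "\<dots> = ennreal (1/4)" by (subst ennreal_mult'[symmetric]) (auto simp: l2)
        finally show "ennreal (M powr (q - 2) * 4) * (\<integral>\<^sup>+x. osc l v x \<partial>lborel) \<le> ennreal (1/4)" .
      qed
      also have "\<dots> = ennreal (3/4)" by (subst ennreal_add3) simp_all
      finally have "ennreal 1 \<le> ennreal (3/4)" using I by (metis ennreal_1 order_trans)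
      then show False by (subst (asm) ennreal_le_iff) auto
    qed
  qed
qed

text \<open>Extracts from a Cauchy condition a subsequence to which completeness of \<open>L\<^sup>2\<close> applies.\<close>

lemma fast_subsequence:
  fixes D :: "nat \<Rightarrow> nat \<Rightarrow> real"
  assumes "\<And>e. e > 0 \<Longrightarrow> \<exists>N. \<forall>m\<ge>N. \<forall>n\<ge>N. D m n \<le> e"
  obtains s where "strict_mono s" "\<And>i. D (s (Suc i)) (s i) \<le> (1/8)^i"
proof -
  have "\<forall>i. \<exists>N. \<forall>m\<ge>N. \<forall>n\<ge>N. D m n \<le> (1/8)^i" using assms by simp
  then obtain N where N: "\<And>i m n. m \<ge> N i \<Longrightarrow> n \<ge> N i \<Longrightarrow> D m n \<le> (1/8)^i" by metis
  define s where "s i = (\<Sum>j\<le>i. N j) + i" for i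
  have ge: "s i \<ge> N i" for i unfolding s_def by (simp add: member_le_sum trans_le_add1)
  have sm: "strict_mono s" by (rule strict_mono_Suc_iff[THEN iffD2]) (simp add: s_def)
  have "s (Suc i) \<ge> N i" for i using ge[of i] sm by (meson le_trans less_imp_le lessI strict_monoD)
  then show ?thesis using that[OF sm] N ge by blast
qed

lemma norm3_square: "(norm (a + b + c))\<^sup>2 \<le> 3 * (norm a)\<^sup>2 + 3 * (norm b)\<^sup>2 + 3 * (norm c)\<^sup>2"
  for a b c :: "'b::real_normed_vector"
proof -
  have "norm (a + b + c) \<le> norm a + norm b + norm c" by (metis norm_triangle_mono norm_triangle_ineq order_refl)
  then have "(norm (a + b + c))\<^sup>2 \<le> (norm a + norm b + norm c)\<^sup>2" by (intro power_mono) auto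
  moreover have "0 \<le> (norm a - norm b)\<^sup>2 + (norm a - norm c)\<^sup>2 + (norm b - norm c)\<^sup>2" by simp
  ultimately show ?thesis by (simp add: power2_eq_square algebra_simps)
qed

text \<open>There are countably many cubes of sides \<open>1/(j+1)\<close>, and for each of them the averages are bounded. A product of
  closed balls is compact, and over a countable index set its topology is metrisable, so a subsequence converges.\<close>

lemma cube_averages_convergent_subsequence:
  fixes v :: "nat \<Rightarrow> real^'n::finite \<Rightarrow> complex"
  assumes v: "\<And>n. L2 (v n)" and A: "\<And>n. L2_sq (v n) \<le> A"
  shows "\<exists>r. strict_mono r \<and> (\<forall>j z. convergent (\<lambda>n. cube_avg (1 / real (Suc j)) (v (r n)) z))"
proof -
  define \<phi> where "\<phi> n = (\<lambda>(j, z). cube_avg (1 / real (Suc j)) (v n) z)" for n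
  have A0: "A \<ge> 0" using A[of 0] L2_sq_nonneg[of "v 0"] by linarith
  define M where "M j = 2 * ((A + 1) / (1 / real (Suc j)) ^ CARD('n)) powr (1/2)" for j
  have bd: "norm (cube_avg (1 / real (Suc j)) (v n) z) \<le> M j" for n j z
    unfolding M_def
  proof (rule norm_cube_avg_le[where q=2 and C="A + 1" and v="v n", OF v])
    show "nn_power_int 2 (v n) \<le> ennreal (A + 1)" unfolding nn_power_int_2[OF v] using A[of n] by (intro ennreal_leI) simp
    show "(A + 1) / (1 / real (Suc j)) ^ CARD('n) \<le> (((A + 1) / (1 / real (Suc j)) ^ CARD('n)) powr (1/2)) powr 2"
      using A0 by (subst powr_powr) (simp add: zero_le_power)
  qed (use A0 in auto)
  let ?S = "PiE UNIV (\<lambda>(j, z::'n \<Rightarrow> int). cball (0::complex) (M j))"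
  have "compactin (product_topology (\<lambda>_. euclidean) UNIV) ?S"
    by (subst compactin_PiE) auto
  then have "compact ?S" by (simp add: euclidean_product_topology)
  moreover have "\<phi> n \<in> ?S" for n using bd by (auto simp: \<phi>_def PiE_def Pi_def extensional_def)
  ultimately obtain L r where r: "strict_mono r" "(\<phi> \<circ> r) \<longlonglongrightarrow> L"
    unfolding compact_def by metis
  have "(\<lambda>n. (\<phi> \<circ> r) n (j, z)) \<longlonglongrightarrow> L (j, z)" for j z
    using continuous_on_tendsto_compose[OF continuous_on_product_coordinates[of "(j,z)"] r(2)] by auto
  then have "convergent (\<lambda>n. cube_avg (1 / real (Suc j)) (v (r n)) z)" for j z
    unfolding \<phi>_def comp_def convergent_def by auto
  then show ?thesis using r(1) by (intro exI[of _ r]) simp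
qed

lemma finite_cube_indices:
  fixes R :: real
  assumes "l > 0" shows "finite (cube_index l ` (cball (0::real^'n::finite) R))"
proof -
  have "cube_index l ` (cball (0::real^'n) R) \<subseteq> PiE UNIV (\<lambda>_. {\<lfloor>- R / l\<rfloor>..\<lfloor>R / l\<rfloor>})"
  proof (clarsimp simp: PiE_def Pi_def extensional_def cube_index_def)
    fix x :: "real^'n" and i assume "norm x \<le> R"
    then have "- R \<le> x $ i \<and> x $ i \<le> R" using component_le_norm_cart[of x i] by linarith
    then show "\<lfloor>- (R / l)\<rfloor> \<le> \<lfloor>x $ i / l\<rfloor> \<and> \<lfloor>x $ i / l\<rfloor> \<le> \<lfloor>R / l\<rfloor>"
      using assms by (intro conjI floor_mono) (auto simp: field_simps)
  qed
  then show ?thesis by (rule finite_subset) (intro finite_PiE, auto)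
qed

text \<open>A function differs little from its averages over small cubes, uniformly along the sequence, and a ball meets only
  finitely many cubes of a given side.\<close>

lemma local_L2_Cauchy:
  fixes v :: "nat \<Rightarrow> real^'n::finite \<Rightarrow> complex"
  assumes w: "\<And>n. weak_grad (v n) (G n)" and A: "\<And>n. L2_sq (v n) + L2_sq (G n) \<le> A" "A > 0"
    and conv: "\<And>j z. convergent (\<lambda>n. cube_avg (1 / real (Suc j)) (v n) z)" and e: "e > 0"
  shows "\<exists>n0. \<forall>m\<ge>n0. \<forall>n\<ge>n0. (\<integral>\<^sup>+x. indicator (cball 0 R) x * ennreal ((norm (v m x - v n x))\<^sup>2) \<partial>lborel) \<le> ennreal e"
proof -
  let ?K = "osc_const TYPE('n)"
  have K: "?K > 0" by (rule osc_const_pos)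
  \<comment> \<open>The side is small enough for the two oscillation terms to contribute at most \<open>e/4\<close> each.\<close>
  obtain j :: nat where j: "12 * ?K * A / e < real j" using reals_Archimedean2 by blast
  define l where "l = 1 / real (Suc j)"
  have l: "l > 0" "l \<le> 1" by (auto simp: l_def)
  have l2: "3 * (?K * l\<^sup>2 * A) \<le> e / 4"
  proof -
    have "l\<^sup>2 \<le> l * 1" unfolding power2_eq_square using l by (intro mult_left_mono) auto
    then have "12 * (?K * A) * l\<^sup>2 \<le> 12 * (?K * A) * l" using K A(2) by (intro mult_left_mono) auto
    also have "\<dots> \<le> e" using j e by (simp add: l_def field_simps)
    finally show ?thesis by (simp add: algebra_simps)
  qed
  define \<mu> where "\<mu> = measure lborel (cball (0::real^'n) R)"
  have em: "emeasure lborel (cball (0::real^'n) R) = ennreal \<mu>"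
    unfolding \<mu>_def using emeasure_bounded_finite[of "cball (0::real^'n) R"]
    by (intro emeasure_eq_ennreal_measure) auto
  have mu0: "\<mu> \<ge> 0" by (simp add: \<mu>_def)
  \<comment> \<open>Averages within \<open>\<eta>\<close> of their limits contribute at most \<open>e/2\<close> on the ball, whose measure is \<open>\<mu>\<close>.\<close>
  define \<eta> where "\<eta> = sqrt (e / (24 * (\<mu> + 1)))"
  have eta: "\<eta> > 0" using e mu0 by (simp add: \<eta>_def)
  have eta2: "3 * (2 * \<eta>)\<^sup>2 * \<mu> \<le> e / 2"
  proof -
    have "\<eta>\<^sup>2 = e / (24 * (\<mu> + 1))" unfolding \<eta>_def using e mu0 by (intro real_sqrt_pow2) simp
    then have "3 * (2 * \<eta>)\<^sup>2 * \<mu> = 12 * \<mu> * (e / (24 * (\<mu> + 1)))" by (simp only: power_mult_distrib) simp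
    also have "12 * \<mu> * (e / (24 * \<nu>)) = (e / 2) * (\<mu> / \<nu>)" for \<nu> by simp
    then have "12 * \<mu> * (e / (24 * (\<mu> + 1))) = (e / 2) * (\<mu> / (\<mu> + 1))" .
    also have "\<dots> \<le> (e / 2) * 1" using e mu0 by (intro mult_left_mono) auto
    finally show ?thesis by simp
  qed
  let ?Z = "cube_index l ` (cball (0::real^'n) R)"
  define L where "L z = lim (\<lambda>n. cube_avg l (v n) z)" for z
  have "\<forall>\<^sub>F n in sequentially. \<forall>z\<in>?Z. dist (cube_avg l (v n) z) (L z) < \<eta>"
  proof (intro eventually_ball_finite finite_cube_indices l ballI)
    fix z
    have "(\<lambda>n. cube_avg l (v n) z) \<longlonglongrightarrow> L z"
      using conv[of j z] unfolding L_def l_def by (simp add: convergent_LIMSEQ_iff)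
    then show "\<forall>\<^sub>F n in sequentially. dist (cube_avg l (v n) z) (L z) < \<eta>" using eta by (rule tendstoD)
  qed
  then obtain n0 where n0: "\<And>n z. n \<ge> n0 \<Longrightarrow> z \<in> ?Z \<Longrightarrow> dist (cube_avg l (v n) z) (L z) < \<eta>"
    unfolding eventually_sequentially by metis
  have vL: "L2 (v n)" for n using weak_grad_L2[OF w] by simp
  note [measurable] = L2_measurable[OF vL] osc_measurable[OF vL]
  have "(\<integral>\<^sup>+x. indicator (cball 0 R) x * ennreal ((norm (v m x - v n x))\<^sup>2) \<partial>lborel) \<le> ennreal e"
    if mn: "m \<ge> n0" "n \<ge> n0" for m n
  proof -
    have pt: "indicator (cball 0 R) x * ennreal ((norm (v m x - v n x))\<^sup>2)
      \<le> 3 * osc l (v m) x + (3 * osc l (v n) x + ennreal (3 * (2 * \<eta>)\<^sup>2) * indicator (cball 0 R) x)" for x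
    proof (cases "x \<in> cball 0 R")
      case True
      define z where "z = cube_index l x"
      have z: "z \<in> ?Z" using True by (simp add: z_def)
      define a where "a = v m x - cube_avg l (v m) z"
      define b where "b = cube_avg l (v n) z - v n x"
      define c where "c = cube_avg l (v m) z - cube_avg l (v n) z"
      have "norm c \<le> 2 * \<eta>"
        using n0[OF mn(1) z] n0[OF mn(2) z] dist_triangle2[of "cube_avg l (v m) z" "cube_avg l (v n) z" "L z"]
        by (simp add: c_def dist_norm)
      then have "(norm c)\<^sup>2 \<le> (2 * \<eta>)\<^sup>2" by (intro power_mono) auto
      moreover have "v m x - v n x = a + b + c" by (simp add: a_def b_def c_def)
      ultimately have "(norm (v m x - v n x))\<^sup>2 \<le> 3 * (norm a)\<^sup>2 + (3 * (norm b)\<^sup>2 + 3 * (2 * \<eta>)\<^sup>2)"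
        using norm3_square[of a b c] by simp
      then have "ennreal ((norm (v m x - v n x))\<^sup>2) \<le> ennreal (3 * (norm a)\<^sup>2 + (3 * (norm b)\<^sup>2 + 3 * (2 * \<eta>)\<^sup>2))"
        by (rule ennreal_leI)
      also have "\<dots> = 3 * ennreal ((norm a)\<^sup>2) + (3 * ennreal ((norm b)\<^sup>2) + ennreal (3 * (2 * \<eta>)\<^sup>2))"
        by (simp add: ennreal_plus ennreal_mult' del: power_mult_distrib)
      also have "\<dots> \<le> 3 * osc l (v m) x + (3 * osc l (v n) x + ennreal (3 * (2 * \<eta>)\<^sup>2))"
        using norm_diff_cube_avg_le_osc[OF vL[of m] l(1), of x] norm_diff_cube_avg_le_osc[OF vL[of n] l(1), of x]
        by (intro add_mono mult_left_mono) (auto simp: a_def b_def z_def norm_minus_commute)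
      finally show ?thesis using True by simp
    qed simp
    have o: "3 * (\<integral>\<^sup>+x. osc l (v n) x \<partial>lborel) \<le> ennreal (e / 4)" for n
    proof -
      have "3 * (\<integral>\<^sup>+x. osc l (v n) x \<partial>lborel) \<le> 3 * ennreal (?K * l\<^sup>2 * L2_sq (G n))"
        by (intro mult_left_mono nn_integral_osc_le[OF w] l) auto
      also have "\<dots> = ennreal (3 * (?K * l\<^sup>2 * L2_sq (G n)))" by (simp add: ennreal_mult')
      also have "\<dots> \<le> ennreal (e / 4)"
      proof (rule ennreal_leI)
        have "L2_sq (G n) \<le> A" using A(1)[of n] L2_sq_nonneg[of "v n"] by linarith
        then have "3 * (?K * l\<^sup>2 * L2_sq (G n)) \<le> 3 * (?K * l\<^sup>2 * A)" using K by (intro mult_left_mono) auto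
        then show "3 * (?K * l\<^sup>2 * L2_sq (G n)) \<le> e / 4" using l2 by linarith
      qed
      finally show ?thesis .
    qed
    have "(\<integral>\<^sup>+x. indicator (cball 0 R) x * ennreal ((norm (v m x - v n x))\<^sup>2) \<partial>lborel)
      \<le> (\<integral>\<^sup>+x. 3 * osc l (v m) x + (3 * osc l (v n) x + ennreal (3 * (2 * \<eta>)\<^sup>2) * indicator (cball 0 R) x) \<partial>lborel)"
      by (intro nn_integral_mono pt)
    also have "\<dots> = 3 * (\<integral>\<^sup>+x. osc l (v m) x \<partial>lborel) + (3 * (\<integral>\<^sup>+x. osc l (v n) x \<partial>lborel) + ennreal (3 * (2 * \<eta>)\<^sup>2) * ennreal \<mu>)"
    proof -
      define a where "a = osc l (v m)"
      define b where "b = osc l (v n)"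
      define c where "c = ennreal (3 * (2 * \<eta>)\<^sup>2)"
      have [measurable]: "a \<in> borel_measurable borel" "b \<in> borel_measurable borel"
        unfolding a_def b_def by (rule osc_measurable[OF vL])+
      have "(\<integral>\<^sup>+x. 3 * a x + (3 * b x + c * indicator (cball 0 R) x) \<partial>lborel)
          = 3 * (\<integral>\<^sup>+x. a x \<partial>lborel) + (3 * (\<integral>\<^sup>+x. b x \<partial>lborel) + c * ennreal \<mu>)"
        by (simp add: nn_integral_add nn_integral_cmult em)
      then show ?thesis by (simp only: a_def b_def c_def)
    qed
    also have "\<dots> \<le> ennreal (e / 4) + (ennreal (e / 4) + ennreal (e / 2))"
      using eta2 mu0 by (intro add_mono o) (simp add: ennreal_mult'[symmetric] ennreal_leI)
    also have "\<dots> = ennreal e" using e by (subst ennreal_add3) simp_all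
    finally show ?thesis .
  qed
  then show ?thesis by blast
qed

text \<open>Rellich's theorem. With the weight \<open>1/(1+|x|)\<close> the local Cauchy property becomes a Cauchy property in \<open>L\<^sup>2\<close>, and
  this gives a subsequence that converges almost everywhere.\<close>

lemma local_compactness:
  fixes v :: "nat \<Rightarrow> real^'n::finite \<Rightarrow> complex"
  assumes w: "\<And>n. weak_grad (v n) (G n)" and A: "\<And>n. L2_sq (v n) + L2_sq (G n) \<le> A" "A > 0"
  obtains r where "strict_mono r" "AE x in lborel. convergent (\<lambda>n. v (r n) x)"
    "\<And>R e. e > 0 \<Longrightarrow> \<exists>n0. \<forall>m\<ge>n0. \<forall>n\<ge>n0.
        (\<integral>\<^sup>+x. indicator (cball 0 R) x * ennreal ((norm (v (r m) x - v (r n) x))\<^sup>2) \<partial>lborel) \<le> ennreal e"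
proof -
  have vL: "L2 (v n)" for n using weak_grad_L2[OF w] by simp
  have vA: "L2_sq (v n) \<le> A" for n using A(1)[of n] L2_sq_nonneg[of "G n"] by linarith
  from cube_averages_convergent_subsequence[of v, OF vL vA] obtain r
    where r': "strict_mono r \<and> (\<forall>j z. convergent (\<lambda>n. cube_avg (1 / real (Suc j)) (v (r n)) z))" by (rule exE)
  then have r: "strict_mono r" "\<And>j z. convergent (\<lambda>n. cube_avg (1 / real (Suc j)) (v (r n)) z)" by simp_all
  have Cau: "\<exists>n0. \<forall>m\<ge>n0. \<forall>n\<ge>n0. (\<integral>\<^sup>+x. indicator (cball 0 R) x * ennreal ((norm (v (r m) x - v (r n) x))\<^sup>2) \<partial>lborel) \<le> ennreal e"
    if "e > 0" for R e
    by (rule local_L2_Cauchy[of "\<lambda>n. v (r n)" "\<lambda>n. G (r n)" A e R]) (use w A r(2) that in auto)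
  define \<phi> where "\<phi> x = 1 / (1 + norm x)" for x :: "real^'n"
  have ph: "0 < \<phi> x" "\<phi> x \<le> 1" for x
  proof -
    have "1 + norm x > 0" by (simp add: add_pos_nonneg)
    then show "0 < \<phi> x" "\<phi> x \<le> 1" by (simp_all add: \<phi>_def)
  qed
  have [measurable]: "\<phi> \<in> borel_measurable borel" unfolding \<phi>_def by measurable
  note [measurable] = L2_measurable[OF vL]
  let ?f = "\<lambda>n x. \<phi> x *\<^sub>R v (r n) x"
  have fL: "L2 (?f n)" for n
  proof (rule L2I_bound[OF _ L2_integrable[OF vL[of "r n"]] AE_I2])
    fix x
    have "(norm (?f n x))\<^sup>2 = (\<phi> x)\<^sup>2 * (norm (v (r n) x))\<^sup>2" by (simp add: power_mult_distrib)
    also have "\<dots> \<le> 1 * (norm (v (r n) x))\<^sup>2" using ph[of x] by (intro mult_right_mono power_le_one) auto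
    finally show "(norm (?f n x))\<^sup>2 \<le> (norm (v (r n) x))\<^sup>2" by simp
  qed measurable
  have "\<exists>N. \<forall>m\<ge>N. \<forall>n\<ge>N. L2_sq (\<lambda>x. ?f m x - ?f n x) \<le> e" if e: "e > 0" for e
  proof -
    obtain k :: nat where k: "8 * A / e < real k" using reals_Archimedean2 by blast
    define R where "R = real k"
    have "e / 2 > 0" using e by simp
    from Cau[OF this, of R] obtain N where N': "\<forall>m\<ge>N. \<forall>n\<ge>N.
        (\<integral>\<^sup>+x. indicator (cball 0 R) x * ennreal ((norm (v (r m) x - v (r n) x))\<^sup>2) \<partial>lborel) \<le> ennreal (e / 2)"
      by (rule exE)
    note N = N'[rule_format]
    have "L2_sq (\<lambda>x. ?f m x - ?f n x) \<le> e" if mn: "m \<ge> N" "n \<ge> N" for m n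
    proof -
      let ?d = "\<lambda>x. v (r m) x - v (r n) x"
      have dL: "L2 ?d" by (intro L2_diff vL)
      have nd: "L2_sq ?d \<le> 4 * A"
        using L2_sq_add_le[OF vL[of "r m"] L2_scaleR[OF vL[of "r n"], of "-1"]] vA[of "r m"] vA[of "r n"]
        by (simp add: L2_sq_def)
      have pt: "ennreal ((norm (?f m x - ?f n x))\<^sup>2) \<le> indicator (cball 0 R) x * ennreal ((norm (?d x))\<^sup>2)
          + ennreal (1 / (1 + R)) * ennreal ((norm (?d x))\<^sup>2)" for x
      proof -
        have eq: "(norm (?f m x - ?f n x))\<^sup>2 = (\<phi> x)\<^sup>2 * (norm (?d x))\<^sup>2"
          by (simp add: power_mult_distrib flip: scaleR_diff_right)
        have R0: "R \<ge> 0" by (simp add: R_def)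
        show ?thesis
        proof (cases "x \<in> cball 0 R")
          case True
          have "(\<phi> x)\<^sup>2 * (norm (?d x))\<^sup>2 \<le> 1 * (norm (?d x))\<^sup>2" using ph[of x] by (intro mult_right_mono power_le_one) auto
          then show ?thesis unfolding eq using True by (intro add_increasing2) (auto intro!: ennreal_leI)
        next
          case False
          have "(\<phi> x)\<^sup>2 \<le> \<phi> x * 1" unfolding power2_eq_square using ph[of x] by (intro mult_left_mono) auto
          also have "\<dots> \<le> 1 / (1 + R)" using False R0 by (auto simp: \<phi>_def intro!: divide_left_mono mult_pos_pos add_pos_nonneg)
          finally have "(\<phi> x)\<^sup>2 * (norm (?d x))\<^sup>2 \<le> 1 / (1 + R) * (norm (?d x))\<^sup>2" by (intro mult_right_mono) auto
          then show ?thesis unfolding eq using R0 by (intro add_increasing) (auto simp: ennreal_mult'[symmetric] intro!: ennreal_leI)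
        qed
      qed
      have "(\<integral>\<^sup>+x. ennreal ((norm (?f m x - ?f n x))\<^sup>2) \<partial>lborel) \<le> (\<integral>\<^sup>+x. indicator (cball 0 R) x * ennreal ((norm (?d x))\<^sup>2)
          + ennreal (1 / (1 + R)) * ennreal ((norm (?d x))\<^sup>2) \<partial>lborel)"
        by (intro nn_integral_mono pt)
      also have "\<dots> = (\<integral>\<^sup>+x. indicator (cball 0 R) x * ennreal ((norm (?d x))\<^sup>2) \<partial>lborel) + ennreal (1 / (1 + R)) * ennreal (L2_sq ?d)"
        by (subst nn_integral_add, measurable, subst nn_integral_cmult, measurable) (simp add: nn_L2_sq[OF dL])
      also have "\<dots> \<le> ennreal (e / 2) + ennreal (e / 2)"
      proof (intro add_mono N mn)
        have R0: "R \<ge> 0" by (simp add: R_def)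
        have "1 / (1 + R) * L2_sq ?d \<le> 1 / (1 + R) * (4 * A)" using nd R0 by (intro mult_left_mono) auto
        also have "\<dots> \<le> e / 2" using k e R0 by (simp add: R_def field_simps)
        finally show "ennreal (1 / (1 + R)) * ennreal (L2_sq ?d) \<le> ennreal (e / 2)"
          using R0 by (simp add: ennreal_mult'[symmetric] ennreal_leI)
      qed
      also have "\<dots> = ennreal e" using e by (simp flip: ennreal_plus)
      finally show ?thesis using e by (intro L2_sq_le_nn(2)) auto
    qed
    then show ?thesis by blast
  qed
  then obtain s where s: "strict_mono s" "\<And>i. L2_sq (\<lambda>x. ?f (s (Suc i)) x - ?f (s i) x) \<le> (1/8)^i"
    using fast_subsequence[of "\<lambda>m n. L2_sq (\<lambda>x. ?f m x - ?f n x)"] by blast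
  obtain g where g: "AE x in lborel. (\<lambda>n. ?f (s n) x) \<longlonglongrightarrow> g x"
    using L2_complete[of "\<lambda>n. ?f (s n)"] fL s(2) by metis
  show ?thesis
  proof (rule that[of "r \<circ> s"])
    show "strict_mono (r \<circ> s)" using r(1) s(1) by (rule strict_mono_o)
    show "AE x in lborel. convergent (\<lambda>n. v ((r \<circ> s) n) x)"
      using g
    proof eventually_elim
      case (elim x)
      have "(\<lambda>n. (1 / \<phi> x) *\<^sub>R ?f (s n) x) \<longlonglongrightarrow> (1 / \<phi> x) *\<^sub>R g x" by (intro tendsto_intros elim)
      then show ?case using ph(1)[of x] by (auto simp: convergent_def)
    qed
    fix R e :: real assume "e > 0"
    from Cau[OF this, of R] obtain n0 where n0': "\<forall>m\<ge>n0. \<forall>n\<ge>n0.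
        (\<integral>\<^sup>+x. indicator (cball 0 R) x * ennreal ((norm (v (r m) x - v (r n) x))\<^sup>2) \<partial>lborel) \<le> ennreal e"
      by (rule exE)
    note n0 = n0'[rule_format]
    have "s m \<ge> n0" if "m \<ge> n0" for m using seq_suble[OF s(1), of m] that by linarith
    then show "\<exists>n0. \<forall>m\<ge>n0. \<forall>n\<ge>n0. (\<integral>\<^sup>+x. indicator (cball 0 R) x * ennreal ((norm (v ((r \<circ> s) m) x - v ((r \<circ> s) n) x))\<^sup>2) \<partial>lborel) \<le> ennreal e"
      using n0 by (intro exI[of _ n0]) auto
  qed
qed

section \<open>The energy space and its quadratic forms\<close>

definition energy_pair :: "'n::finite \<Rightarrow> (real^'n \<Rightarrow> complex) \<Rightarrow> (real^'n \<Rightarrow> complex^'n) \<Rightarrow> bool" where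
  "energy_pair k v G \<longleftrightarrow> weak_grad v G \<and> L2 (\<lambda>x. (x $ k) *\<^sub>R v x)"

text \<open>For \<open>\<omega> = 1\<close> this is the square of the norm of the energy space.\<close>

definition energy_form :: "'n::finite \<Rightarrow> real \<Rightarrow> (real^'n \<Rightarrow> complex) \<Rightarrow> (real^'n \<Rightarrow> complex^'n) \<Rightarrow> real" where
  "energy_form k \<omega> v G = L2_sq G + L2_sq (\<lambda>x. (x $ k) *\<^sub>R v x) + \<omega> * L2_sq v"

definition energy_bilin :: "'n::finite \<Rightarrow> real \<Rightarrow> (real^'n \<Rightarrow> complex) \<Rightarrow> (real^'n \<Rightarrow> complex^'n)
    \<Rightarrow> (real^'n \<Rightarrow> complex) \<Rightarrow> (real^'n \<Rightarrow> complex^'n) \<Rightarrow> real" where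
  "energy_bilin k \<omega> v G w H = L2_inner G H + L2_inner (\<lambda>x. (x $ k) *\<^sub>R v x) (\<lambda>x. (x $ k) *\<^sub>R w x) + \<omega> * L2_inner v w"

lemma energy_pairD: assumes "energy_pair k v G"
  shows "weak_grad v G" "L2 v" "L2 G" "L2 (\<lambda>x. (x $ k) *\<^sub>R v x)"
  using assms weak_grad_L2[of v G] by (auto simp: energy_pair_def)

lemma weight_lincomb: "(\<lambda>x. (x $ k) *\<^sub>R (a *\<^sub>R v x + b *\<^sub>R w x)) =
    (\<lambda>x. a *\<^sub>R ((x $ k) *\<^sub>R v x) + b *\<^sub>R ((x $ k) *\<^sub>R (w x :: 'b::real_vector)))"
  by (simp add: scaleR_add_right mult.commute)

lemma energy_pair_lincomb:
  assumes "energy_pair k v G" "energy_pair k w H"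
  shows "energy_pair k (\<lambda>x. a *\<^sub>R v x + b *\<^sub>R w x) (\<lambda>x. a *\<^sub>R G x + b *\<^sub>R H x)"
  unfolding energy_pair_def weight_lincomb
  by (intro conjI weak_grad_lincomb L2_lincomb energy_pairD[OF assms(1)] energy_pairD[OF assms(2)])

lemma energy_form_lincomb:
  assumes "energy_pair k v G" "energy_pair k w H"
  shows "energy_form k \<omega> (\<lambda>x. a *\<^sub>R v x + b *\<^sub>R w x) (\<lambda>x. a *\<^sub>R G x + b *\<^sub>R H x)
    = a\<^sup>2 * energy_form k \<omega> v G + 2 * a * b * energy_bilin k \<omega> v G w H + b\<^sup>2 * energy_form k \<omega> w H"
  unfolding energy_form_def energy_bilin_def weight_lincomb L2_sq_lincomb[OF energy_pairD(2)[OF assms(1)] energy_pairD(2)[OF assms(2)]]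
    L2_sq_lincomb[OF energy_pairD(3)[OF assms(1)] energy_pairD(3)[OF assms(2)]] L2_sq_lincomb[OF energy_pairD(4)[OF assms(1)] energy_pairD(4)[OF assms(2)]]
  by (simp add: algebra_simps)

lemma energy_pair_diff: "energy_pair k v G \<Longrightarrow> energy_pair k w H \<Longrightarrow> energy_pair k (\<lambda>x. v x - w x) (\<lambda>x. G x - H x)"
  using energy_pair_lincomb[of k v G w H 1 "-1"] by simp

lemma energy_pair_add: "energy_pair k v G \<Longrightarrow> energy_pair k w H \<Longrightarrow> energy_pair k (\<lambda>x. v x + w x) (\<lambda>x. G x + H x)"
  using energy_pair_lincomb[of k v G w H 1 1] by simp

lemma energy_pair_scaleR: "energy_pair k v G \<Longrightarrow> energy_pair k (\<lambda>x. c *\<^sub>R v x) (\<lambda>x. c *\<^sub>R G x)"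
  using energy_pair_lincomb[of k v G v G c 0] by simp

lemma energy_form_scaleR: "energy_pair k v G \<Longrightarrow> energy_form k \<omega> (\<lambda>x. c *\<^sub>R v x) (\<lambda>x. c *\<^sub>R G x) = c\<^sup>2 * energy_form k \<omega> v G"
  using energy_form_lincomb[of k v G v G \<omega> c 0] by simp

lemma energy_form_diff: "energy_pair k v G \<Longrightarrow> energy_pair k w H \<Longrightarrow>
    energy_form k \<omega> (\<lambda>x. v x - w x) (\<lambda>x. G x - H x) = energy_form k \<omega> v G - 2 * energy_bilin k \<omega> v G w H + energy_form k \<omega> w H"
  using energy_form_lincomb[of k v G w H \<omega> 1 "-1"] by simp

lemma energy_form_add: "energy_pair k v G \<Longrightarrow> energy_pair k w H \<Longrightarrow>
    energy_form k \<omega> (\<lambda>x. v x + w x) (\<lambda>x. G x + H x) = energy_form k \<omega> v G + 2 * energy_bilin k \<omega> v G w H + energy_form k \<omega> w H"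
  using energy_form_lincomb[of k v G w H \<omega> 1 1] by simp

lemma energy_bilin_lincomb:
  assumes "energy_pair k v G" "energy_pair k w H" "energy_pair k u F"
  shows "energy_bilin k \<omega> (\<lambda>x. a *\<^sub>R v x + b *\<^sub>R w x) (\<lambda>x. a *\<^sub>R G x + b *\<^sub>R H x) u F
     = a * energy_bilin k \<omega> v G u F + b * energy_bilin k \<omega> w H u F"
proof -
  have l: "L2_inner (\<lambda>x. a *\<^sub>R f x + b *\<^sub>R g x) h = a * L2_inner f h + b * L2_inner g h" if "L2 f" "L2 g" "L2 h"
    for f g h :: "real^'a \<Rightarrow> 'c::euclidean_space"
    unfolding L2_inner_def using L2_inner_integrable[OF that(1,3)] L2_inner_integrable[OF that(2,3)]
    by (simp add: inner_add_left)
  show ?thesis unfolding energy_bilin_def weight_lincomb l[OF energy_pairD(2)[OF assms(1)] energy_pairD(2)[OF assms(2)] energy_pairD(2)[OF assms(3)]]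
      l[OF energy_pairD(3)[OF assms(1)] energy_pairD(3)[OF assms(2)] energy_pairD(3)[OF assms(3)]] l[OF energy_pairD(4)[OF assms(1)] energy_pairD(4)[OF assms(2)] energy_pairD(4)[OF assms(3)]]
    by (simp add: algebra_simps)
qed

text \<open>By the uncertainty principle a fraction \<open>\<theta>\<close> of the gradient and weight terms can be traded for \<open>\<theta> \<parallel>v\<parallel>\<^sup>2\<close>, which
  compensates a negative \<open>\<omega> > -1\<close>.\<close>

lemma coercive:
  assumes "-1 < \<omega>"
  obtains c where "c > 0" "\<And>v G. energy_pair k v G \<Longrightarrow> c * energy_form k 1 v G \<le> energy_form k \<omega> v G"
proof -
  \<comment> \<open>Any \<open>\<theta>\<close> with \<open>0 \<le> \<theta> < 1\<close> and \<open>\<omega> + \<theta> > 0\<close> would do.\<close>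
  define \<theta> where "\<theta> = (if \<omega> \<le> 1 then (1 - \<omega>) / 2 else 0)"
  define c where "c = min (1 - \<theta>) (\<omega> + \<theta>)"
  have th: "0 \<le> \<theta>" "\<theta> < 1" "\<omega> + \<theta> > 0" using assms by (auto simp: \<theta>_def field_simps)
  have c: "c > 0" "c \<le> 1 - \<theta>" "c \<le> \<omega> + \<theta>" using th by (auto simp: c_def)
  show ?thesis
  proof (rule that[OF c(1)])
    fix v :: "real^'a \<Rightarrow> complex" and G assume X: "energy_pair k v G"
    let ?a = "L2_sq G + L2_sq (\<lambda>x. (x $ k) *\<^sub>R v x)"
    have u: "L2_sq v \<le> ?a" using uncertainty energy_pairD[OF X] by blast
    have n: "L2_sq v \<ge> 0" "?a \<ge> 0" by (simp_all add: L2_sq_nonneg)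
    have "c * ?a \<le> (1 - \<theta>) * ?a" "c * L2_sq v \<le> (\<omega> + \<theta>) * L2_sq v" using c n by (intro mult_right_mono; simp)+
    then have "c * (?a + L2_sq v) \<le> (1 - \<theta>) * ?a + (\<omega> + \<theta>) * L2_sq v" by (simp only: distrib_left[of c ?a])
    also have "\<dots> = ?a + \<omega> * L2_sq v - \<theta> * (?a - L2_sq v)" by (simp add: algebra_simps)
    also have "\<dots> \<le> ?a + \<omega> * L2_sq v" using u th by simp
    finally show "c * energy_form k 1 v G \<le> energy_form k \<omega> v G" by (simp add: energy_form_def)
  qed
qed

lemma energy_form_1_nonneg: "energy_form k 1 v G \<ge> 0"
  by (simp add: energy_form_def L2_sq_nonneg)

lemma energy_form_1_bounds: "L2_sq v + L2_sq G \<le> energy_form k 1 v G" "L2_sq v \<le> energy_form k 1 v G"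
  by (simp_all add: energy_form_def L2_sq_nonneg)

lemma energy_form_le_form_1: "energy_form k \<omega> v G \<le> (1 + \<bar>\<omega>\<bar>) * energy_form k 1 v G"
proof -
  have "energy_form k \<omega> v G \<le> L2_sq G + L2_sq (\<lambda>x. (x $ k) *\<^sub>R v x) + \<bar>\<omega>\<bar> * L2_sq v"
    unfolding energy_form_def using L2_sq_nonneg[of v] by (intro add_left_mono mult_right_mono) auto
  also have "\<dots> \<le> (1 + \<bar>\<omega>\<bar>) * (L2_sq G + L2_sq (\<lambda>x. (x $ k) *\<^sub>R v x)) + (1 + \<bar>\<omega>\<bar>) * L2_sq v"
    using L2_sq_nonneg[of v] L2_sq_nonneg[of G] L2_sq_nonneg[of "\<lambda>x. (x $ k) *\<^sub>R v x"]
    by (intro add_mono) (simp_all add: algebra_simps)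
  finally show ?thesis by (simp add: energy_form_def algebra_simps)
qed

section \<open>Strong limits of iterated midpoints\<close>

text \<open>The iterated midpoints of the members with index at least \<open>n\<close>. They replace weak convergence: a bounded
  sequence has such midpoints that converge strongly, and every affine inequality and every pointwise limit of the
  sequence passes to them.\<close>

inductive tail_midpoint :: "(nat \<Rightarrow> 'x \<Rightarrow> 'a::real_vector) \<Rightarrow> (nat \<Rightarrow> 'x \<Rightarrow> 'b::real_vector) \<Rightarrow> nat \<Rightarrow> ('x \<Rightarrow> 'a) \<Rightarrow> ('x \<Rightarrow> 'b) \<Rightarrow> bool"
  for V :: "nat \<Rightarrow> 'x \<Rightarrow> 'a" and W :: "nat \<Rightarrow> 'x \<Rightarrow> 'b" and n :: nat where
  base: "m \<ge> n \<Longrightarrow> tail_midpoint V W n (V m) (W m)"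
| mid: "tail_midpoint V W n v G \<Longrightarrow> tail_midpoint V W n w H \<Longrightarrow>
    tail_midpoint V W n (\<lambda>x. (1/2) *\<^sub>R v x + (1/2) *\<^sub>R w x) (\<lambda>x. (1/2) *\<^sub>R G x + (1/2) *\<^sub>R H x)"

lemma tail_midpoint_mono: "tail_midpoint V W n v G \<Longrightarrow> m \<le> n \<Longrightarrow> tail_midpoint V W m v G"
  by (induction rule: tail_midpoint.induct) (auto intro: tail_midpoint.base tail_midpoint.mid)

lemma tail_midpoint_energy_pair: "tail_midpoint V W n v G \<Longrightarrow> (\<And>n. energy_pair k (V n) (W n)) \<Longrightarrow> energy_pair k v G"
  by (induction rule: tail_midpoint.induct) (auto intro: energy_pair_lincomb)

lemma tail_midpoint_pointwise:
  "tail_midpoint V W n v G \<Longrightarrow> (\<And>m. m \<ge> n \<Longrightarrow> norm (V m x - u) \<le> e) \<Longrightarrow> norm (v x - (u::'a::real_normed_vector)) \<le> e"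
proof (induction rule: tail_midpoint.induct)
  case (mid v G w H)
  have "(1/2) *\<^sub>R v x + (1/2) *\<^sub>R w x - u = (1/2) *\<^sub>R (v x - u) + (1/2) *\<^sub>R (w x - u)"
    by (simp add: algebra_simps) (simp flip: scaleR_add_left)
  then have "norm ((1/2) *\<^sub>R v x + (1/2) *\<^sub>R w x - u) \<le> (1/2) * norm (v x - u) + (1/2) * norm (w x - u)"
    using norm_triangle_ineq[of "(1/2) *\<^sub>R (v x - u)" "(1/2) *\<^sub>R (w x - u)"] by simp
  with mid show ?case by fastforce
qed auto

lemma energy_form_1_parallelogram:
  assumes "energy_pair k v G" "energy_pair k w H"
  shows "energy_form k 1 (\<lambda>x. v x - w x) (\<lambda>x. G x - H x) = 2 * energy_form k 1 v G + 2 * energy_form k 1 w H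
    - 4 * energy_form k 1 (\<lambda>x. (1/2) *\<^sub>R v x + (1/2) *\<^sub>R w x) (\<lambda>x. (1/2) *\<^sub>R G x + (1/2) *\<^sub>R H x)"
  unfolding energy_form_diff[OF assms] energy_form_lincomb[OF assms] by (simp add: power2_eq_square algebra_simps)

text \<open>Choose midpoints of almost minimal norm in each tail. The midpoint of two of them lies in a tail as well, hence its
  norm is not much smaller, and the parallelogram law makes the chosen midpoints a Cauchy sequence.\<close>

lemma mazur:
  fixes V :: "nat \<Rightarrow> real^'n::finite \<Rightarrow> complex"
  assumes X: "\<And>n. energy_pair k (V n) (W n)" and A: "\<And>n. energy_form k 1 (V n) (W n) \<le> A"
  obtains u F w H where "energy_pair k u F" "\<And>j. tail_midpoint V W j (w j) (H j)"
    "AE x in lborel. (\<lambda>j. w j x) \<longlonglongrightarrow> u x"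
    "(\<lambda>j. energy_form k 1 (\<lambda>x. w j x - u x) (\<lambda>x. H j x - F x)) \<longlonglongrightarrow> 0"
proof -
  define S where "S n = {energy_form k 1 v G | v G. tail_midpoint V W n v G}" for n
  define d where "d n = Inf (S n)" for n
  have ne: "S n \<noteq> {}" for n unfolding S_def using tail_midpoint.base[of n n V W] by blast
  have bb: "bdd_below (S n)" for n unfolding S_def by (rule bdd_belowI[of _ 0]) (auto simp: energy_form_1_nonneg)
  have le: "d n \<le> energy_form k 1 v G" if "tail_midpoint V W n v G" for n v G
    unfolding d_def by (rule cInf_lower[OF _ bb]) (use that in \<open>auto simp: S_def\<close>)
  have dmono: "incseq d"
  proof (rule monoI)
    fix m n :: nat assume "m \<le> n"
    then have "S n \<subseteq> S m" unfolding S_def using tail_midpoint_mono by blast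
    then show "d m \<le> d n" unfolding d_def by (rule cInf_superset_mono[OF ne bb])
  qed
  have dA: "d n \<le> A" for n using le[OF tail_midpoint.base[of n n V W]] A[of n] by simp
  have "\<exists>v G. tail_midpoint V W n v G \<and> energy_form k 1 v G < d n + 1 / real (Suc n)" for n
  proof -
    have "\<exists>y\<in>S n. y < d n + 1 / real (Suc n)" unfolding d_def by (rule cInf_lessD[OF ne]) simp
    then show ?thesis unfolding S_def by blast
  qed
  then obtain w0 H0 where wm: "\<And>n. tail_midpoint V W n (w0 n) (H0 n)" and wd: "\<And>n. energy_form k 1 (w0 n) (H0 n) < d n + 1 / real (Suc n)"
    by metis
  have wX: "energy_pair k (w0 n) (H0 n)" for n using tail_midpoint_energy_pair[OF wm X] .
  define D where "D m n = energy_form k 1 (\<lambda>x. w0 m x - w0 n x) (\<lambda>x. H0 m x - H0 n x)" for m n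
  have Dle: "D m n \<le> 2 * (d m + d n) - 4 * d (min m n) + 2 / real (Suc m) + 2 / real (Suc n)" for m n
  proof -
    have mid_m: "tail_midpoint V W (min m n) (\<lambda>x. (1/2) *\<^sub>R w0 m x + (1/2) *\<^sub>R w0 n x) (\<lambda>x. (1/2) *\<^sub>R H0 m x + (1/2) *\<^sub>R H0 n x)"
      by (intro tail_midpoint.mid tail_midpoint_mono[OF wm]) auto
    show ?thesis
    proof -
      have gen: "2 * a + 2 * b - 4 * q \<le> 2 * (d1 + d2) - 4 * d0 + R1 + R2"
        if "a < d1 + r1" "b < d2 + r2" "d0 \<le> q" "R1 = 2 * r1" "R2 = 2 * r2" for a b q d0 d1 d2 r1 r2 R1 R2 :: real
        using that by simp
      show ?thesis
        unfolding D_def energy_form_1_parallelogram[OF wX wX] by (rule gen[OF wd wd le[OF mid_m]]) simp_all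
    qed
  qed
  obtain dl where dl: "d \<longlonglongrightarrow> dl" using incseq_convergent[OF dmono, of A] dA by blast
  have dle: "d n \<le> dl" for n by (rule incseq_le[OF dmono dl])
  have "\<exists>N. \<forall>m\<ge>N. \<forall>n\<ge>N. D m n \<le> e" if e: "e > 0" for e
  proof -
    have "\<forall>\<^sub>F n in sequentially. d n > dl - e / 8" using dl e by (intro order_tendstoD) auto
    moreover have "(\<lambda>n. 2 / real (Suc n)) \<longlonglongrightarrow> 0" using tendsto_mult_right_zero[OF LIMSEQ_inverse_real_of_nat, of 2] by (simp add: divide_inverse)
    then have "\<forall>\<^sub>F n in sequentially. 2 / real (Suc n) < e / 4" using e by (intro order_tendstoD) auto
    ultimately have "\<forall>\<^sub>F n in sequentially. d n > dl - e / 8 \<and> 2 / real (Suc n) < e / 4" by eventually_elim auto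
    then obtain N where N: "\<And>n. n \<ge> N \<Longrightarrow> d n > dl - e / 8" "\<And>n. n \<ge> N \<Longrightarrow> 2 / real (Suc n) < e / 4"
      unfolding eventually_sequentially by blast
    have "D m n \<le> e" if "m \<ge> N" "n \<ge> N" for m n
    proof -
      have "d (min m n) > dl - e / 8" using N(1) that by (simp add: min_def)
      moreover have "D m n \<le> 2 * d m + 2 * d n - 4 * d (min m n) + 2 / real (Suc m) + 2 / real (Suc n)"
        using Dle[of m n] by (simp only: distrib_left)
      ultimately show ?thesis using N(2)[OF that(1)] N(2)[OF that(2)] dle[of m] dle[of n] by argo
    qed
    then show ?thesis by blast
  qed
  then obtain s where s: "strict_mono s" "\<And>i. D (s (Suc i)) (s i) \<le> (1/8)^i"
    using fast_subsequence[of D] by blast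
  define w where "w i = w0 (s i)" for i
  define H where "H i = H0 (s i)" for i
  have X': "energy_pair k (w i) (H i)" for i unfolding w_def H_def by (rule wX)
  have mi: "tail_midpoint V W i (w i) (H i)" for i
    unfolding w_def H_def by (rule tail_midpoint_mono[OF wm]) (rule seq_suble[OF s(1)])
  \<comment> \<open>Function, weighted function and gradient as one square-integrable function, so that completeness is used once.\<close>
  define f where "f i = (\<lambda>x. (w i x, (x $ k) *\<^sub>R w i x, H i x))" for i
  have trip: "L2 (\<lambda>x. (a x, b x, c x)) \<and> L2_sq (\<lambda>x. (a x, b x, c x)) = L2_sq a + L2_sq b + L2_sq c"
    if "L2 a" "L2 b" "L2 c" for a b :: "real^'n \<Rightarrow> complex" and c :: "real^'n \<Rightarrow> complex^'n"
  proof -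
    have e: "(norm (a x, b x, c x))\<^sup>2 = (norm (a x))\<^sup>2 + ((norm (b x))\<^sup>2 + (norm (c x))\<^sup>2)" for x
      by (simp add: norm_Pair)
    have m: "(\<lambda>x. (a x, b x, c x)) \<in> borel_measurable borel"
      using that by (intro borel_measurable_Pair) (auto simp: L2_def)
    show ?thesis unfolding L2_def L2_sq_def e using m that
      by (auto intro!: Bochner_Integration.integrable_add intro: L2_integrable simp: Bochner_Integration.integral_add L2_integrable)
  qed
  have fL: "L2 (f i)" for i unfolding f_def using trip energy_pairD[OF X'[of i]] by blast
  have fd: "L2_sq (\<lambda>x. f i x - f j x) = energy_form k 1 (\<lambda>x. w i x - w j x) (\<lambda>x. H i x - H j x)" for i j
  proof -
    have "L2_sq (\<lambda>x. f i x - f j x) = L2_sq (\<lambda>x. (w i x - w j x, (x $ k) *\<^sub>R (w i x - w j x), H i x - H j x))"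
      by (simp add: f_def scaleR_diff_right)
    then show ?thesis using trip energy_pairD[OF energy_pair_diff[OF X'[of i] X'[of j]]] by (simp add: energy_form_def)
  qed
  have fast: "L2_sq (\<lambda>x. f (Suc i) x - f i x) \<le> (1/8)^i" for i
    unfolding fd using s(2)[of i] by (simp add: D_def w_def H_def)
  obtain g where g: "L2 g" "AE x in lborel. (\<lambda>n. f n x) \<longlonglongrightarrow> g x" "(\<lambda>n. L2_sq (\<lambda>x. f n x - g x)) \<longlonglongrightarrow> 0"
    by (rule L2_complete[of f, OF fL fast])
  define u where "u x = fst (g x)" for x
  define F where "F x = snd (snd (g x))" for x
  have gm: "g \<in> borel_measurable borel" using g(1) by (rule L2_measurable)
  have part: "L2 (\<lambda>x. P (g x))" if P: "continuous_on UNIV P" "\<And>p. norm (P p) \<le> norm p"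
    for P :: "complex \<times> complex \<times> (complex^'n) \<Rightarrow> 'z::euclidean_space"
  proof (rule L2I_bound[OF _ L2_integrable[OF g(1)] AE_I2])
    show "(\<lambda>x. P (g x)) \<in> borel_measurable borel"
      by (rule measurable_compose[OF gm borel_measurable_continuous_onI[OF P(1)]])
    show "(norm (P (g x)))\<^sup>2 \<le> (norm (g x))\<^sup>2" for x using P(2) by (intro power_mono) auto
  qed
  have nf: "norm (fst p) \<le> norm p" for p :: "'y::real_normed_vector \<times> 'z::real_normed_vector"
    using norm_fst_le[of "fst p" "snd p"] by simp
  have ns: "norm (snd p) \<le> norm p" for p :: "'y::real_normed_vector \<times> 'z::real_normed_vector"
    using norm_snd_le[of "snd p" "fst p"] by simp
  have uL: "L2 u" unfolding u_def
    by (rule part[OF continuous_on_fst[OF continuous_on_id] nf])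
  have FL: "L2 F" unfolding F_def
    by (rule part[OF continuous_on_snd[OF continuous_on_snd[OF continuous_on_id]] order_trans[OF ns ns]])
  have gL: "L2 (\<lambda>x. fst (snd (g x)))"
    by (rule part[OF continuous_on_fst[OF continuous_on_snd[OF continuous_on_id]] order_trans[OF nf ns]])
  have wu: "AE x in lborel. (\<lambda>j. w j x) \<longlonglongrightarrow> u x"
    using g(2)
  proof eventually_elim
    case (elim x) from tendsto_fst[OF this] show ?case by (simp add: f_def u_def)
  qed
  have ku: "AE x in lborel. fst (snd (g x)) = (x $ k) *\<^sub>R u x"
    using g(2)
  proof eventually_elim
    case (elim x)
    have 1: "(\<lambda>j. (x $ k) *\<^sub>R w j x) \<longlonglongrightarrow> fst (snd (g x))" using tendsto_fst[OF tendsto_snd[OF elim]] by (simp add: f_def)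
    have "(\<lambda>j. (x $ k) *\<^sub>R w j x) \<longlonglongrightarrow> (x $ k) *\<^sub>R u x" using tendsto_fst[OF elim] by (intro tendsto_intros) (simp add: f_def u_def)
    then show ?case using 1 LIMSEQ_unique by blast
  qed
  have xm: "(\<lambda>x::real^'n. x $ k) \<in> borel_measurable borel" by (intro borel_measurable_continuous_onI continuous_intros)
  have kuL: "L2 (\<lambda>x. (x $ k) *\<^sub>R u x)"
    by (rule L2_cong_AE[OF gL _ ku]) (intro borel_measurable_scaleR xm L2_measurable uL)
  have lim: "(\<lambda>j. L2_sq (\<lambda>x. w j x - u x) + L2_sq (\<lambda>x. (x $ k) *\<^sub>R (w j x - u x)) + L2_sq (\<lambda>x. H j x - F x)) \<longlonglongrightarrow> 0"
  proof -
    have "L2_sq (\<lambda>x. f j x - g x) = L2_sq (\<lambda>x. w j x - u x) + L2_sq (\<lambda>x. (x $ k) *\<^sub>R (w j x - u x)) + L2_sq (\<lambda>x. H j x - F x)" for j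
    proof -
      let ?t = "\<lambda>x. (w j x - u x, (x $ k) *\<^sub>R (w j x - u x), H j x - F x)"
      have L: "L2 (\<lambda>x. w j x - u x)" "L2 (\<lambda>x. (x $ k) *\<^sub>R (w j x - u x))" "L2 (\<lambda>x. H j x - F x)"
        unfolding scaleR_diff_right by (intro L2_diff energy_pairD[OF X'[of j]] uL FL kuL)+
      have "L2_sq (\<lambda>x. f j x - g x) = L2_sq ?t"
      proof (rule L2_sq_cong_AE)
        show "(\<lambda>x. f j x - g x) \<in> borel_measurable borel" using L2_diff[OF fL[of j] g(1)] by (rule L2_measurable)
        show "?t \<in> borel_measurable borel" using trip[OF L] L2_measurable by blast
        show "AE x in lborel. f j x - g x = ?t x"
          using ku by eventually_elim (simp add: f_def u_def F_def prod_eq_iff scaleR_diff_right)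
      qed
      then show ?thesis using trip[OF L] by simp
    qed
    then show ?thesis using g(3) by simp
  qed
  have lims: "(\<lambda>j. L2_sq (\<lambda>x. w j x - u x)) \<longlonglongrightarrow> 0" "(\<lambda>j. L2_sq (\<lambda>x. H j x - F x)) \<longlonglongrightarrow> 0"
    by (rule tendsto_sandwich[OF _ _ tendsto_const lim]; simp add: L2_sq_nonneg)+
  have "weak_grad u F" by (rule weak_grad_closed[OF energy_pairD(1)[OF X'] uL FL lims])
  then have uX: "energy_pair k u F" using kuL by (simp add: energy_pair_def)
  have "(\<lambda>j. energy_form k 1 (\<lambda>x. w j x - u x) (\<lambda>x. H j x - F x)) \<longlonglongrightarrow> 0"
    using lim by (simp add: energy_form_def algebra_simps)
  then show ?thesis using that[OF uX mi wu] by blast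
qed

text \<open>Strong convergence \<open>w\<^sub>j \<rightarrow> u\<close> gives \<open>B(w\<^sub>j, u) \<rightarrow> Q(u)\<close>.\<close>

lemma energy_bilin_limit_le:
  assumes u: "energy_pair k u F" and w: "\<And>j. energy_pair k (w j) (H j)"
    and Q: "\<And>v G. energy_pair k v G \<Longrightarrow> energy_form k \<omega> v G \<ge> 0"
    and lim: "(\<lambda>j. energy_form k 1 (\<lambda>x. w j x - u x) (\<lambda>x. H j x - F x)) \<longlonglongrightarrow> 0"
    and le: "\<forall>\<^sub>F j in sequentially. energy_bilin k \<omega> (w j) (H j) u F \<le> K"
  shows "energy_form k \<omega> u F \<le> K"
proof -
  let ?p = "\<lambda>j x. w j x - u x" and ?P = "\<lambda>j x. H j x - F x"
  have X: "energy_pair k (?p j) (?P j)" for j by (intro energy_pair_diff w u)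
  have cs: "\<bar>energy_bilin k \<omega> (?p j) (?P j) u F\<bar> \<le> sqrt (energy_form k \<omega> (?p j) (?P j)) * sqrt (energy_form k \<omega> u F)" for j
  proof -
    have p: "a\<^sup>2 * energy_form k \<omega> (?p j) (?P j) + 2 * a * b * energy_bilin k \<omega> (?p j) (?P j) u F + b\<^sup>2 * energy_form k \<omega> u F \<ge> 0" for a b
      unfolding energy_form_lincomb[OF X u, symmetric] by (intro Q energy_pair_lincomb X u)
    have "(energy_bilin k \<omega> (?p j) (?P j) u F)\<^sup>2 \<le> energy_form k \<omega> (?p j) (?P j) * energy_form k \<omega> u F"
      by (rule quadratic_form_Cauchy_Schwarz[OF p])
    from real_sqrt_le_mono[OF this] show ?thesis by (simp add: real_sqrt_mult)
  qed
  have "(\<lambda>j. (1 + \<bar>\<omega>\<bar>) * energy_form k 1 (?p j) (?P j)) \<longlonglongrightarrow> 0" using tendsto_mult_right_zero[OF lim] by simp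
  then have q: "(\<lambda>j. energy_form k \<omega> (?p j) (?P j)) \<longlonglongrightarrow> 0"
    by (rule tendsto_sandwich[OF _ _ tendsto_const, rotated 2]) (auto intro!: always_eventually Q X energy_form_le_form_1)
  have "(\<lambda>j. sqrt (energy_form k \<omega> (?p j) (?P j)) * sqrt (energy_form k \<omega> u F)) \<longlonglongrightarrow> sqrt 0 * sqrt (energy_form k \<omega> u F)"
    by (intro tendsto_intros q)
  then have "(\<lambda>j. energy_bilin k \<omega> (?p j) (?P j) u F) \<longlonglongrightarrow> 0"
    by (intro Lim_null_comparison[OF always_eventually, OF allI, OF cs[folded real_norm_def]]) simp
  moreover have "energy_bilin k \<omega> (w j) (H j) u F = energy_bilin k \<omega> (?p j) (?P j) u F + energy_form k \<omega> u F" for j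
  proof -
    have "energy_bilin k \<omega> (\<lambda>x. 1 *\<^sub>R w j x + (-1) *\<^sub>R u x) (\<lambda>x. 1 *\<^sub>R H j x + (-1) *\<^sub>R F x) u F
        = 1 * energy_bilin k \<omega> (w j) (H j) u F + (-1) * energy_bilin k \<omega> u F u F"
      by (rule energy_bilin_lincomb[OF w u u])
    moreover have "energy_bilin k \<omega> u F u F = energy_form k \<omega> u F" by (simp only: energy_bilin_def energy_form_def L2_inner_def L2_sq_def power2_norm_eq_inner)
    ultimately show ?thesis by simp
  qed
  ultimately have "(\<lambda>j. energy_bilin k \<omega> (w j) (H j) u F) \<longlonglongrightarrow> 0 + energy_form k \<omega> u F" by (simp only:) (intro tendsto_intros)
  from tendsto_upperbound[OF this le] show ?thesis by simp
qed

section \<open>Test functions in the energy space\<close>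

lemma line_derivative:
  assumes "smooth g"
  shows "((\<lambda>s. g (x + s *\<^sub>R axis i 1)) has_real_derivative partial_deriv i g (x + s *\<^sub>R axis i 1)) (at s)"
proof -
  have "((\<lambda>s. g (x + s *\<^sub>R axis i 1)) has_derivative (\<lambda>t. \<Sum>j\<in>UNIV. (t *\<^sub>R axis i 1) $ j * partial_deriv j g (x + s *\<^sub>R axis i 1))) (at s)"
    by (rule has_derivative_compose[OF _ smooth_has_derivative[OF assms]]) (auto intro!: derivative_eq_intros)
  moreover have "(\<lambda>t. \<Sum>j\<in>UNIV. (t *\<^sub>R axis i 1) $ j * partial_deriv j g (x + s *\<^sub>R axis i 1)) = (*) (partial_deriv i g (x + s *\<^sub>R axis i 1))"
    by (auto simp: axis_def if_distrib if_distribR sum.If_cases fun_eq_iff mult.commute cong: if_cong)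
  ultimately show ?thesis by (simp add: has_field_derivative_def)
qed

lemma difference_quotient_integral:
  fixes f g :: "real^'n::finite \<Rightarrow> real"
  assumes f: "test_function f" and g: "test_function g" and t: "t \<longlonglongrightarrow> 0" "\<And>n. t n \<noteq> 0"
  shows "(\<lambda>n. \<integral>x. f x * ((g (x + t n *\<^sub>R axis i 1) - g x) / t n) \<partial>lborel) \<longlonglongrightarrow> (\<integral>x. f x * partial_deriv i g x \<partial>lborel)"
proof -
  have sg: "smooth g" using g by (simp add: test_function_def)
  have [measurable]: "f \<in> borel_measurable borel" "g \<in> borel_measurable borel" "partial_deriv i g \<in> borel_measurable borel"
    using test_function_measurable f g test_function_partial_deriv by blast+
  obtain M where M: "\<And>x. \<bar>partial_deriv i g x\<bar> \<le> M" using test_function_bounded[OF test_function_partial_deriv[OF g]] by metis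
  obtain r where r: "\<And>x. norm x \<ge> r \<Longrightarrow> f x = 0" using test_function_support[OF f] by metis
  have fi: "integrable lborel (\<lambda>x. f x * M)"
  proof -
    have "integrable lborel (\<lambda>x. f x *\<^sub>R (indicator (cball 0 r) x :: real))"
      by (intro L2_scaleR_integrable test_function_L2 f L2_indicator) auto
    moreover have "(\<lambda>x. f x *\<^sub>R (indicator (cball 0 r) x :: real)) = f"
    proof
      fix x show "f x *\<^sub>R (indicator (cball 0 r) x :: real) = f x" using r[of x] by (cases "norm x \<le> r") auto
    qed
    ultimately show ?thesis by (intro integrable_mult_left) simp
  qed
  show ?thesis
  proof (rule integral_dominated_convergence[where w="\<lambda>x. norm (f x * M)"])
    show "integrable lborel (\<lambda>x. norm (f x * M))" using fi by (rule integrable_norm)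
    show "AE x in lborel. (\<lambda>n. f x * ((g (x + t n *\<^sub>R axis i 1) - g x) / t n)) \<longlonglongrightarrow> f x * partial_deriv i g x"
    proof (rule AE_I2, rule tendsto_mult_left)
      fix x
      have "((\<lambda>h. (g (x + h *\<^sub>R axis i 1) - g x) / h) \<longlongrightarrow> partial_deriv i g x) (at 0)"
        using line_derivative[OF sg, of x i 0] by (simp add: DERIV_def)
      moreover have "filterlim t (at 0) sequentially" using t by (simp add: filterlim_at)
      ultimately show "(\<lambda>n. (g (x + t n *\<^sub>R axis i 1) - g x) / t n) \<longlonglongrightarrow> partial_deriv i g x"
        by (rule filterlim_compose)
    qed
    show "AE x in lborel. norm (f x * ((g (x + t n *\<^sub>R axis i 1) - g x) / t n)) \<le> norm (f x * M)" for n
    proof (rule AE_I2)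
      fix x
      have "norm (g (x + t n *\<^sub>R axis i 1) - g (x + 0 *\<^sub>R axis i 1)) \<le> M * norm (t n - 0)"
        by (rule field_differentiable_bound[of UNIV "\<lambda>s. g (x + s *\<^sub>R axis i 1)" "\<lambda>s. partial_deriv i g (x + s *\<^sub>R axis i 1)"])
           (use line_derivative[OF sg] M in auto)
      also have "M * norm (t n - 0) \<le> \<bar>M\<bar> * \<bar>t n\<bar>" by (simp add: mult_right_mono)
      finally have "\<bar>(g (x + t n *\<^sub>R axis i 1) - g x) / t n\<bar> \<le> \<bar>M\<bar>" using t(2)[of n] by (simp add: divide_simps)
      then show "norm (f x * ((g (x + t n *\<^sub>R axis i 1) - g x) / t n)) \<le> norm (f x * M)"
        unfolding real_norm_def abs_mult by (intro mult_left_mono) auto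
    qed
  qed measurable
qed

text \<open>A translation moves from one factor to the other, so the integrals of the two difference quotients agree up to sign,
  and both converge.\<close>

lemma test_function_integration_by_parts:
  fixes f g :: "real^'n::finite \<Rightarrow> real"
  assumes f: "test_function f" and g: "test_function g"
  shows "(\<integral>x. partial_deriv i f x * g x \<partial>lborel) = - (\<integral>x. f x * partial_deriv i g x \<partial>lborel)"
proof -
  have [measurable]: "f \<in> borel_measurable borel" "g \<in> borel_measurable borel"
    using test_function_measurable f g by blast+
  define t where "t n = 1 / real (Suc n)" for n
  have t: "t \<longlonglongrightarrow> 0" "\<And>n. t n \<noteq> 0" using LIMSEQ_inverse_real_of_nat by (simp_all add: t_def[abs_def] divide_inverse)
  have t': "(\<lambda>n. - t n) \<longlonglongrightarrow> 0" "\<And>n. - t n \<noteq> 0" using tendsto_minus[OF t(1)] t(2) by auto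
  have int: "integrable lborel (\<lambda>x. a x * b (x + c))" if "test_function a" "test_function b" for a b :: "real^'n \<Rightarrow> real" and c
    using L2_scaleR_integrable[OF test_function_L2[OF that(1)] L2_translate[OF test_function_L2[OF that(2)]]] by simp
  have q: "(\<integral>x. a x * ((b (x + s *\<^sub>R axis i 1) - b x) / s) \<partial>lborel) = ((\<integral>x. a x * b (x + s *\<^sub>R axis i 1) \<partial>lborel) - (\<integral>x. a x * b x \<partial>lborel)) / s"
    if "test_function a" "test_function b" for a b :: "real^'n \<Rightarrow> real" and s
    using int[OF that, of "s *\<^sub>R axis i 1"] int[OF that, of 0] by (simp add: right_diff_distrib)
  have swap: "(\<integral>x. g x * ((f (x + (- t n) *\<^sub>R axis i 1) - f x) / (- t n)) \<partial>lborel) = - (\<integral>x. f x * ((g (x + t n *\<^sub>R axis i 1) - g x) / t n) \<partial>lborel)" for n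
  proof -
    have "(\<integral>x. f x * g (x + t n *\<^sub>R axis i 1) \<partial>lborel) = (\<integral>x. g x * f (x + (- t n) *\<^sub>R axis i 1) \<partial>lborel)"
      using integral_translate[of "\<lambda>x. g x * f (x + (- t n) *\<^sub>R axis i 1)" "t n *\<^sub>R axis i 1"] by (simp add: mult.commute)
    moreover have "(\<integral>x. f x * g x \<partial>lborel) = (\<integral>x. g x * f x \<partial>lborel)" by (simp add: mult.commute)
    ultimately show ?thesis unfolding q[OF f g] q[OF g f] by simp
  qed
  have "(\<lambda>n. - (\<integral>x. f x * ((g (x + t n *\<^sub>R axis i 1) - g x) / t n) \<partial>lborel)) \<longlonglongrightarrow> (\<integral>x. g x * partial_deriv i f x \<partial>lborel)"
    using difference_quotient_integral[OF g f t', of i] unfolding swap .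
  moreover have "(\<lambda>n. - (\<integral>x. f x * ((g (x + t n *\<^sub>R axis i 1) - g x) / t n) \<partial>lborel)) \<longlonglongrightarrow> - (\<integral>x. f x * partial_deriv i g x \<partial>lborel)"
    by (intro tendsto_minus difference_quotient_integral f g t)
  ultimately show ?thesis using LIMSEQ_unique by (fastforce simp: mult.commute)
qed

lemma energy_pair_test_function:
  fixes f :: "real^'n::finite \<Rightarrow> real"
  assumes f: "test_function f"
  shows "energy_pair k (\<lambda>x. complex_of_real (f x)) (\<lambda>x. \<chi> i. complex_of_real (partial_deriv i f x))"
proof -
  note fL = test_function_L2[OF f]
  have [measurable]: "f \<in> borel_measurable borel" using fL by (simp add: L2_def)
  have dL: "L2 (partial_deriv i f)" for i by (intro test_function_L2 test_function_partial_deriv f)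
  have [measurable]: "partial_deriv i f \<in> borel_measurable borel" for i using dL[of i] by (simp add: L2_def)
  have v: "L2 (\<lambda>x. complex_of_real (f x))" using fL by (simp add: L2_def)
  have G: "L2 (\<lambda>x. (\<chi> i. complex_of_real (partial_deriv i f x)) :: complex^'n)"
    unfolding L2_def
  proof
    show "(\<lambda>x. (\<chi> i. complex_of_real (partial_deriv i f x)) :: complex^'n) \<in> borel_measurable borel"
      by (subst borel_measurable_euclidean_space) (auto simp: Basis_vec_def inner_axis)
    have "(norm ((\<chi> i. complex_of_real (partial_deriv i f x)) :: complex^'n))\<^sup>2 = (\<Sum>i\<in>UNIV. (norm (partial_deriv i f x))\<^sup>2)" for x
      by (simp add: norm_vec_def L2_set_def sum_nonneg)
    then show "integrable lborel (\<lambda>x. (norm ((\<chi> i. complex_of_real (partial_deriv i f x)) :: complex^'n))\<^sup>2)"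
      by (simp only:) (intro Bochner_Integration.integrable_sum L2_integrable dL)
  qed
  have "weak_grad (\<lambda>x. complex_of_real (f x)) (\<lambda>x. \<chi> i. complex_of_real (partial_deriv i f x))"
    unfolding weak_grad_def
  proof (intro conjI v G allI impI)
    fix g :: "real^'n \<Rightarrow> real" and i assume g: "test_function g"
    have "(\<integral>x. partial_deriv i g x *\<^sub>R complex_of_real (f x) \<partial>lborel) = complex_of_real (\<integral>x. partial_deriv i g x * f x \<partial>lborel)"
      by (simp add: scaleR_conv_of_real flip: of_real_mult)
    also have "\<dots> = complex_of_real (- (\<integral>x. g x * partial_deriv i f x \<partial>lborel))"
      by (simp only: test_function_integration_by_parts[OF g f])
    also have "\<dots> = - (\<integral>x. g x *\<^sub>R complex_of_real (partial_deriv i f x) \<partial>lborel)"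
      by (simp add: scaleR_conv_of_real flip: of_real_mult)
    finally show "(\<integral>x. partial_deriv i g x *\<^sub>R complex_of_real (f x) \<partial>lborel)
        = - (\<integral>x. g x *\<^sub>R ((\<chi> i. complex_of_real (partial_deriv i f x)) $ i) \<partial>lborel)" by simp
  qed
  moreover have "L2 (\<lambda>x. (x $ k) *\<^sub>R complex_of_real (f x))"
  proof -
    obtain r where r: "r > 0" "\<And>x. norm x \<ge> r \<Longrightarrow> f x = 0" using test_function_support[OF f] by metis
    have xm: "(\<lambda>x::real^'n. x $ k) \<in> borel_measurable borel" by (intro borel_measurable_continuous_onI continuous_intros)
    show ?thesis
    proof (rule L2I_bound[of _ "\<lambda>x. r\<^sup>2 * (norm (f x))\<^sup>2"])
      show "integrable lborel (\<lambda>x. r\<^sup>2 * (norm (f x))\<^sup>2)" using L2_integrable[OF fL] by (rule integrable_mult_right)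
      show "(\<lambda>x. (x $ k) *\<^sub>R complex_of_real (f x)) \<in> borel_measurable borel" using xm by measurable
      show "AE x in lborel. (norm ((x $ k) *\<^sub>R complex_of_real (f x)))\<^sup>2 \<le> r\<^sup>2 * (norm (f x))\<^sup>2"
      proof (rule AE_I2)
        fix x :: "real^'n"
        have "\<bar>x $ k\<bar>\<^sup>2 \<le> r\<^sup>2" if "norm x < r" using component_le_norm_cart[of x k] that r(1) by (intro power_mono) auto
        then show "(norm ((x $ k) *\<^sub>R complex_of_real (f x)))\<^sup>2 \<le> r\<^sup>2 * (norm (f x))\<^sup>2"
          using r(2)[of x] by (cases "norm x < r") (auto simp: power_mult_distrib intro!: mult_right_mono)
      qed
    qed
  qed
  ultimately show ?thesis by (simp add: energy_pair_def)
qed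

section \<open>The Brezis-Lieb splitting\<close>

text \<open>If \<open>|b| \<le> \<eta> |a|\<close>, continuity of the power at one gives the first term; otherwise both powers are bounded by a
  multiple of \<open>|b|\<^sup>q\<close>.\<close>

lemma norm_powr_difference_bound:
  assumes q: "q > 0" and e: "(e::real) > 0"
  obtains C where "C \<ge> 0" "\<And>a b :: 'b::real_normed_vector.
    \<bar>norm (a - b) powr q - norm a powr q\<bar> \<le> e * norm a powr q + C * norm b powr q"
proof -
  have "isCont (\<lambda>y::real. y powr q) 1" by (intro continuous_intros) auto
  then obtain d where d: "d > 0" "\<And>y. \<bar>y - 1\<bar> < d \<Longrightarrow> \<bar>y powr q - 1\<bar> < e"
    using e unfolding continuous_at_eps_delta by (auto simp: dist_real_def)
  define \<eta> where "\<eta> = min (d / 2) (1 / 2)"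
  have eta: "0 < \<eta>" "\<eta> < 1" "\<eta> < d" using d by (auto simp: \<eta>_def)
  have e1: "(1 + \<eta>) powr q - 1 \<le> e" "1 - (1 - \<eta>) powr q \<le> e"
    using d(2)[of "1 + \<eta>"] d(2)[of "1 - \<eta>"] eta by auto
  define C where "C = (1 / \<eta> + 1) powr q"
  show ?thesis
  proof (rule that[of C])
    show C0: "C \<ge> 0" by (simp add: C_def)
    fix a b :: 'b
    let ?t = "norm a" and ?s = "norm b" and ?r = "norm (a - b)"
    have r1: "?r \<le> ?t + ?s" "?r \<ge> ?t - ?s" using norm_triangle_ineq4[of a b] norm_triangle_ineq2[of a b] by auto
    show "\<bar>?r powr q - ?t powr q\<bar> \<le> e * ?t powr q + C * ?s powr q"
    proof (cases "?s \<le> \<eta> * ?t")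
      case True
      have "?r powr q \<le> ((1 + \<eta>) * ?t) powr q" using r1 True q by (intro powr_mono2) (auto simp: algebra_simps)
      then have 1: "?r powr q - ?t powr q \<le> ((1 + \<eta>) powr q - 1) * ?t powr q"
        by (subst (asm) powr_mult) (use eta in \<open>auto simp: algebra_simps\<close>)
      have "\<eta> * ?t \<le> 1 * ?t" using eta by (intro mult_right_mono) auto
      then have "((1 - \<eta>) * ?t) powr q \<le> ?r powr q" using r1 True q eta by (intro powr_mono2) (auto simp: algebra_simps)
      then have 2: "?t powr q - ?r powr q \<le> (1 - (1 - \<eta>) powr q) * ?t powr q"
        by (subst (asm) powr_mult) (use eta in \<open>auto simp: algebra_simps\<close>)
      have "((1 + \<eta>) powr q - 1) * ?t powr q \<le> e * ?t powr q" "(1 - (1 - \<eta>) powr q) * ?t powr q \<le> e * ?t powr q"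
        using e1 by (auto intro!: mult_right_mono)
      moreover have "C * ?s powr q \<ge> 0" using C0 by simp
      ultimately show ?thesis using 1 2 by linarith
    next
      case False
      then have ts: "?t \<le> ?s / \<eta>" using eta by (simp add: field_simps)
      have "?r \<le> (1 / \<eta> + 1) * ?s" using r1 ts by (simp add: algebra_simps)
      then have "?r powr q \<le> ((1 / \<eta> + 1) * ?s) powr q" using q by (intro powr_mono2) auto
      also have "\<dots> = C * ?s powr q" using eta by (simp add: C_def powr_mult)
      finally have 1: "?r powr q \<le> C * ?s powr q" .
      have "(1 / \<eta> + 1) * ?s = ?s / \<eta> + ?s" by (simp add: algebra_simps)
      then have "?t \<le> (1 / \<eta> + 1) * ?s" using ts norm_ge_zero[of b] by linarith
      then have "?t powr q \<le> ((1 / \<eta> + 1) * ?s) powr q" using q by (intro powr_mono2) auto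
      also have "\<dots> = C * ?s powr q" using eta by (simp add: C_def powr_mult)
      finally have 2: "?t powr q \<le> C * ?s powr q" .
      have "?r powr q \<ge> 0" "?t powr q \<ge> 0" "e * ?t powr q \<ge> 0" using e by auto
      then show ?thesis using 1 2 by linarith
    qed
  qed
qed

definition power_int :: "real \<Rightarrow> (real^'n::finite \<Rightarrow> complex) \<Rightarrow> real" where
  "power_int q v = (\<integral>x. norm (v x) powr q \<partial>lborel)"

abbreviation integrable_power :: "real \<Rightarrow> (real^'n::finite \<Rightarrow> complex) \<Rightarrow> bool" where
  "integrable_power q v \<equiv> integrable lborel (\<lambda>x. norm (v x) powr q)"

lemma power_int_nonneg: "power_int q v \<ge> 0"
  by (simp add: power_int_def)

text \<open>The defect \<open>| |v\<^sub>n - u|\<^sup>q - |v\<^sub>n|\<^sup>q + |u|\<^sup>q |\<close> exceeds \<open>e |v\<^sub>n|\<^sup>q\<close> by at most a multiple of \<open>|u|\<^sup>q\<close>, and it tends to zero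
  pointwise. Dominated convergence applies to the excess.\<close>

lemma brezis_lieb:
  fixes v :: "nat \<Rightarrow> real^'n::finite \<Rightarrow> complex"
  assumes q: "q > 0" and m[measurable]: "\<And>n. v n \<in> borel_measurable borel" "u \<in> borel_measurable borel"
    and iv: "\<And>n. integrable_power q (v n)" "\<And>n. power_int q (v n) = 1" and iu: "integrable_power q u"
    and ae: "AE x in lborel. (\<lambda>n. v n x) \<longlonglongrightarrow> u x"
  shows "(\<lambda>n. power_int q (\<lambda>x. v n x - u x)) \<longlonglongrightarrow> 1 - power_int q u"
proof (rule LIMSEQ_I)
  fix e0 :: real assume e0: "e0 > 0"
  define e where "e = e0 / 2"
  have e: "e > 0" using e0 by (simp add: e_def)
  obtain C where C: "C \<ge> 0" "\<And>a b :: complex. \<bar>norm (a - b) powr q - norm a powr q\<bar> \<le> e * norm a powr q + C * norm b powr q"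
    using norm_powr_difference_bound[OF q e] by metis
  have id: "integrable_power q (\<lambda>x. v n x - u x)" for n
  proof (rule Bochner_Integration.integrable_bound)
    show "integrable lborel (\<lambda>x. (1 + e) * norm (v n x) powr q + C * norm (u x) powr q)"
      by (intro Bochner_Integration.integrable_add integrable_mult_right iv iu)
    show "AE x in lborel. norm (norm (v n x - u x) powr q) \<le> norm ((1 + e) * norm (v n x) powr q + C * norm (u x) powr q)"
    proof (rule AE_I2)
      fix x
      have "norm (v n x - u x) powr q \<le> (1 + e) * norm (v n x) powr q + C * norm (u x) powr q"
        using C(2)[of "v n x" "u x"] by (simp add: algebra_simps)
      then show "norm (norm (v n x - u x) powr q) \<le> norm ((1 + e) * norm (v n x) powr q + C * norm (u x) powr q)"
        by (smt (verit) powr_ge_zero real_norm_def)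
    qed
  qed measurable
  define T where "T n x = norm (v n x - u x) powr q - norm (v n x) powr q + norm (u x) powr q" for n x
  define W where "W n x = max 0 (\<bar>T n x\<bar> - e * norm (v n x) powr q)" for n x
  have [measurable]: "T n \<in> borel_measurable borel" "W n \<in> borel_measurable borel" for n
    unfolding T_def W_def by measurable
  have iT: "integrable lborel (T n)" for n
    unfolding T_def by (intro Bochner_Integration.integrable_add Bochner_Integration.integrable_diff id iv iu)
  have Tval: "(\<integral>x. T n x \<partial>lborel) = power_int q (\<lambda>x. v n x - u x) - (1 - power_int q u)" for n
    unfolding T_def using id iv iu iv(2)[of n] by (simp add: power_int_def)
  have Wb: "W n x \<le> (C + 1) * norm (u x) powr q" for n x
  proof -
    have "\<bar>T n x\<bar> \<le> \<bar>norm (v n x - u x) powr q - norm (v n x) powr q\<bar> + norm (u x) powr q" unfolding T_def using powr_ge_zero[of "norm (u x)" q] by linarith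
    moreover have "0 \<le> (C + 1) * norm (u x) powr q" using C(1) by simp
    ultimately show ?thesis using C(2)[of "v n x" "u x"] unfolding W_def by (simp add: algebra_simps)
  qed
  have "(\<lambda>n. \<integral>x. W n x \<partial>lborel) \<longlonglongrightarrow> integral\<^sup>L lborel (\<lambda>x::real^'n. 0::real)"
  proof (rule integral_dominated_convergence[where w="\<lambda>x. (C + 1) * norm (u x) powr q"])
    show "integrable lborel (\<lambda>x. (C + 1) * norm (u x) powr q)" by (intro integrable_mult_right iu)
    show "AE x in lborel. norm (W n x) \<le> (C + 1) * norm (u x) powr q" for n
      using Wb[of n] by (auto simp: W_def)
    show "AE x in lborel. (\<lambda>n. W n x) \<longlonglongrightarrow> 0"
      using ae
    proof eventually_elim
      case (elim x)
      have t1: "(\<lambda>n. norm (v n x) powr q) \<longlonglongrightarrow> norm (u x) powr q"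
        using q by (intro tendsto_powr' tendsto_norm elim tendsto_const) auto
      have t2: "(\<lambda>n. norm (v n x - u x) powr q) \<longlonglongrightarrow> norm (u x - u x) powr q"
        using q by (intro tendsto_powr' tendsto_norm tendsto_diff elim tendsto_const) auto
      have "(\<lambda>n. W n x) \<longlonglongrightarrow> max 0 (\<bar>norm (u x - u x) powr q - norm (u x) powr q + norm (u x) powr q\<bar> - e * norm (u x) powr q)"
        unfolding W_def T_def by (intro tendsto_max tendsto_const tendsto_diff tendsto_rabs tendsto_add tendsto_mult t1 t2)
      moreover have "max 0 (\<bar>norm (u x - u x) powr q - norm (u x) powr q + norm (u x) powr q\<bar> - e * norm (u x) powr q) = 0"
      proof -
        have "0 \<le> e * norm (u x) powr q" using e by simp
        then show ?thesis using q by (simp add: max_absorb1)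
      qed
      ultimately show ?case by simp
    qed
  qed measurable
  then have "\<forall>\<^sub>F n in sequentially. (\<integral>x. W n x \<partial>lborel) < e" using e by (intro order_tendstoD) auto
  then obtain n0 where n0: "\<And>n. n \<ge> n0 \<Longrightarrow> (\<integral>x. W n x \<partial>lborel) < e" unfolding eventually_sequentially by blast
  have "norm (power_int q (\<lambda>x. v n x - u x) - (1 - power_int q u)) < e0" if "n \<ge> n0" for n
  proof -
    have iW: "integrable lborel (W n)"
      by (rule Bochner_Integration.integrable_bound[of _ "\<lambda>x. (C + 1) * norm (u x) powr q"])
         (use Wb[of n] C(1) in \<open>auto intro!: integrable_mult_right iu simp: W_def\<close>)
    have "norm (\<integral>x. T n x \<partial>lborel) \<le> (\<integral>x. norm (T n x) \<partial>lborel)" by (rule integral_norm_bound)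
    also have "\<dots> \<le> (\<integral>x. W n x + e * norm (v n x) powr q \<partial>lborel)"
      by (intro integral_mono Bochner_Integration.integrable_add integrable_mult_right iv iW integrable_norm iT) (auto simp: W_def)
    also have "\<dots> = (\<integral>x. W n x \<partial>lborel) + e" using iW iv iv(2)[of n] by (simp add: power_int_def)
    finally show ?thesis using n0[OF that] unfolding Tval e_def by linarith
  qed
  then show "\<exists>n0. \<forall>n\<ge>n0. norm (power_int q (\<lambda>x. v n x - u x) - (1 - power_int q u)) < e0" by blast
qed

section \<open>Tightness up to translation\<close>

text \<open>Only translations orthogonal to the confined direction preserve the weight.\<close>

lemma energy_pair_translate:
  fixes y :: "real^'n::finite"
  assumes X: "energy_pair k v G" and y: "y $ k = 0"
  shows "energy_pair k (\<lambda>x. v (x + y)) (\<lambda>x. G (x + y))" "energy_form k \<omega> (\<lambda>x. v (x + y)) (\<lambda>x. G (x + y)) = energy_form k \<omega> v G"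
proof -
  have e: "(\<lambda>x. (x $ k) *\<^sub>R v (x + y)) = (\<lambda>x. ((x + y) $ k) *\<^sub>R v (x + y))" using y by simp
  show "energy_pair k (\<lambda>x. v (x + y)) (\<lambda>x. G (x + y))"
    unfolding energy_pair_def e using weak_grad_translate[OF energy_pairD(1)[OF X]] L2_translate[OF energy_pairD(4)[OF X], of y] by simp
  have "L2_sq (\<lambda>x. ((x + y) $ k) *\<^sub>R v (x + y)) = L2_sq (\<lambda>x. (x $ k) *\<^sub>R v x)"
    by (rule L2_sq_translate[OF energy_pairD(4)[OF X]])
  then show "energy_form k \<omega> (\<lambda>x. v (x + y)) (\<lambda>x. G (x + y)) = energy_form k \<omega> v G"
    unfolding energy_form_def e by (simp only: L2_sq_translate[OF energy_pairD(2)[OF X]] L2_sq_translate[OF energy_pairD(3)[OF X]])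
qed

lemma power_int_translate: "v \<in> borel_measurable borel \<Longrightarrow> power_int q (\<lambda>x. v (x + y)) = power_int q v"
  unfolding power_int_def by (rule integral_translate) auto

lemma cube_avg_translate:
  fixes v :: "real^'n::finite \<Rightarrow> complex"
  assumes v[measurable]: "v \<in> borel_measurable borel" and l: "l > 0" and y: "\<And>i. y $ i = l * real_of_int (d i)"
  shows "cube_avg l (\<lambda>x. v (x + y)) z = cube_avg l v (\<lambda>i. z i + d i)"
proof -
  have "x - y \<in> cube l z \<longleftrightarrow> x \<in> cube l (\<lambda>i. z i + d i)" for x
  proof -
    have "(x - y) $ i / l = x $ i / l - real_of_int (d i)" for i using l by (simp add: y field_simps)
    then have "\<lfloor>(x - y) $ i / l\<rfloor> = \<lfloor>x $ i / l\<rfloor> - d i" for i by simp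
    then show ?thesis unfolding cube_def by (simp only: mem_Collect_eq) (auto simp: algebra_simps)
  qed
  then have ind: "indicator (cube l z) (x - y) = (indicator (cube l (\<lambda>i. z i + d i)) x :: real)" for x by (simp add: indicator_def)
  have "(\<integral>x. indicator (cube l z) x *\<^sub>R v (x + y) \<partial>lborel) = (\<integral>x. indicator (cube l z) (x - y) *\<^sub>R v x \<partial>lborel)"
    using integral_translate[of "\<lambda>x. indicator (cube l z) (x - y) *\<^sub>R v x" y] by simp
  then show ?thesis unfolding cube_avg_def ind by simp
qed

lemma cube_avg_square_le:
  fixes v :: "real^'n::finite \<Rightarrow> complex"
  assumes v[measurable]: "v \<in> borel_measurable borel" and l: "l > 0"
  shows "ennreal (l ^ CARD('n) * (norm (cube_avg l v z))\<^sup>2) \<le> (\<integral>\<^sup>+y. indicator (cube l z) y * ennreal ((norm (v y))\<^sup>2) \<partial>lborel)"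
proof -
  let ?i = "\<integral>y. indicator (cube l z) y *\<^sub>R v y \<partial>lborel" and ?n = "l ^ CARD('n)"
  have n: "?n > 0" using l by simp
  have "ennreal (?n * (norm (cube_avg l v z))\<^sup>2) = ennreal (1 / ?n) * ennreal ((norm ?i)\<^sup>2)"
  proof -
    have "?n * (norm (cube_avg l v z))\<^sup>2 = 1 / ?n * (norm ?i)\<^sup>2"
      unfolding cube_avg_def norm_scaleR power_mult_distrib using n by (simp add: power2_eq_square)
    then show ?thesis using n by (simp only: ennreal_mult') (simp add: ennreal_mult'[symmetric])
  qed
  also have "\<dots> \<le> ennreal (1 / ?n) * (emeasure lborel (cube l z) * (\<integral>\<^sup>+y. indicator (cube l z) y * ennreal ((norm (v y))\<^sup>2) \<partial>lborel))"
    by (intro mult_left_mono norm_set_integral_square_le) auto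
  also have "\<dots> = (ennreal (1 / ?n) * ennreal ?n) * (\<integral>\<^sup>+y. indicator (cube l z) y * ennreal ((norm (v y))\<^sup>2) \<partial>lborel)"
    by (simp add: emeasure_cube[OF l] mult.assoc)
  also have "ennreal (1 / ?n) * ennreal ?n = 1" using n l by (subst ennreal_mult'[symmetric]) auto
  finally show ?thesis by simp
qed

text \<open>On a cube with index \<open>z k\<close> the weight \<open>|x\<^sub>k|\<close> is at least \<open>l (|z k| - 1)\<close>, so the weighted norm bounds the mass
  in the cube, and with it the average.\<close>

lemma cube_index_bound:
  fixes v :: "real^'n::finite \<Rightarrow> complex"
  assumes vL: "L2 v" and kL: "L2 (\<lambda>x. (x $ k) *\<^sub>R v x)" and A: "L2_sq (\<lambda>x. (x $ k) *\<^sub>R v x) \<le> A"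
    and l: "l > 0" and d: "\<delta> > 0" and avg: "norm (cube_avg l v z) > \<delta>"
  shows "\<bar>real_of_int (z k)\<bar> \<le> 2 + A / (\<delta>\<^sup>2 * l ^ CARD('n) * l\<^sup>2)"
proof (rule ccontr)
  let ?n = "l ^ CARD('n)" and ?a = "\<bar>real_of_int (z k)\<bar>"
  assume "\<not> ?a \<le> 2 + A / (\<delta>\<^sup>2 * ?n * l\<^sup>2)"
  then have a: "?a - 2 > A / (\<delta>\<^sup>2 * ?n * l\<^sup>2)" by simp
  have A0: "A \<ge> 0" using A L2_sq_nonneg[of "\<lambda>x. (x $ k) *\<^sub>R v x"] by linarith
  have n: "?n > 0" using l by simp
  have D: "\<delta>\<^sup>2 * ?n * l\<^sup>2 > 0" using n d l by simp
  have a2: "?a - 2 > 0" using a A0 D by (smt (verit) divide_nonneg_pos)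
  have pt: "(l * (?a - 1))\<^sup>2 * (norm (v y))\<^sup>2 \<le> (norm ((y $ k) *\<^sub>R v y))\<^sup>2" if "y \<in> cube l z" for y
  proof -
    have "l * z k \<le> y $ k" "y $ k < l * (real_of_int (z k) + 1)" using that l by (auto simp: cube_iff)
    then have "l * (?a - 1) \<le> \<bar>y $ k\<bar>" 
    proof (cases "z k \<ge> 0")
      case True
      then have "l * (?a - 1) \<le> l * z k" using l by (intro mult_left_mono) auto
      then show ?thesis using \<open>l * z k \<le> y $ k\<close> by linarith
    next
      case False
      then have "l * (?a - 1) = - (l * (real_of_int (z k) + 1))" by (simp add: algebra_simps)
      then show ?thesis using \<open>y $ k < l * (real_of_int (z k) + 1)\<close> by linarith
    qed
    then have "(l * (?a - 1))\<^sup>2 \<le> \<bar>y $ k\<bar>\<^sup>2" using l a2 by (intro power_mono) auto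
    then show ?thesis by (simp add: power_mult_distrib mult_right_mono)
  qed
  have [measurable]: "v \<in> borel_measurable borel" using vL by (simp add: L2_def)
  let ?c = "(l * (?a - 1))\<^sup>2"
  have c: "?c > 0" using l a2 by simp
  have "ennreal ?c * ennreal (?n * (norm (cube_avg l v z))\<^sup>2)
      \<le> ennreal ?c * (\<integral>\<^sup>+y. indicator (cube l z) y * ennreal ((norm (v y))\<^sup>2) \<partial>lborel)"
    by (intro mult_left_mono cube_avg_square_le l) auto
  also have "\<dots> = (\<integral>\<^sup>+y. ennreal ?c * (indicator (cube l z) y * ennreal ((norm (v y))\<^sup>2)) \<partial>lborel)"
    by (rule nn_integral_cmult[symmetric]) measurable
  also have "\<dots> \<le> (\<integral>\<^sup>+y. ennreal ((norm ((y $ k) *\<^sub>R v y))\<^sup>2) \<partial>lborel)"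
  proof (rule nn_integral_mono)
    fix y
    show "ennreal ?c * (indicator (cube l z) y * ennreal ((norm (v y))\<^sup>2)) \<le> ennreal ((norm ((y $ k) *\<^sub>R v y))\<^sup>2)"
      using pt[of y] by (cases "y \<in> cube l z") (auto simp: ennreal_mult'[symmetric] intro!: ennreal_leI)
  qed
  also have "\<dots> \<le> ennreal A" unfolding nn_L2_sq[OF kL] by (rule ennreal_leI[OF A])
  finally have "?c * (?n * (norm (cube_avg l v z))\<^sup>2) \<le> A"
    using A0 c by (simp add: ennreal_mult'[symmetric])
  moreover have "\<delta>\<^sup>2 \<le> (norm (cube_avg l v z))\<^sup>2" using avg d by (intro power_mono) auto
  then have "?c * (?n * \<delta>\<^sup>2) \<le> ?c * (?n * (norm (cube_avg l v z))\<^sup>2)" using c n by (intro mult_left_mono) auto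
  ultimately have "(?a - 1)\<^sup>2 * (\<delta>\<^sup>2 * ?n * l\<^sup>2) \<le> A" by (simp add: power_mult_distrib mult_ac)
  then have "(?a - 1)\<^sup>2 \<le> A / (\<delta>\<^sup>2 * ?n * l\<^sup>2)" using D by (simp add: pos_le_divide_eq)
  moreover have "?a - 1 \<le> (?a - 1)\<^sup>2" unfolding power2_eq_square using a2 by simp
  ultimately show False using a by linarith
qed

lemma nn_power_int_eq_power_int:
  assumes "v \<in> borel_measurable borel" "integrable_power q v"
  shows "nn_power_int q v = ennreal (power_int q v)"
  unfolding nn_power_int_def power_int_def by (rule nn_integral_eq_integral) (use assms in auto)

lemma subcritical_integrable:
  assumes S: "sobolev_bound TYPE('n::finite) q" and q: "q > 0" and w: "weak_grad (v :: real^'n \<Rightarrow> complex) G"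
  shows "integrable_power q v"
proof -
  have m[measurable]: "v \<in> borel_measurable borel" using weak_grad_L2[OF w] by (simp add: L2_def)
  obtain C where C: "nn_power_int q v \<le> ennreal (C * (L2_sq v + L2_sq G + 1) powr (q / 2))"
    using sobolev_inequality[OF S q] w L2_sq_nonneg[of v] L2_sq_nonneg[of G] by (metis add_nonneg_nonneg add_nonneg_pos less_add_one less_imp_le zero_less_one)
  then have "nn_power_int q v < \<infinity>" by (rule le_less_trans) simp
  then show ?thesis unfolding nn_power_int_def by (intro integrableI_bounded) auto
qed

lemma power_int_scaleR: "power_int q (\<lambda>x. c *\<^sub>R v x) = \<bar>c\<bar> powr q * power_int q v"
  unfolding power_int_def by (simp add: powr_mult)

text \<open>A sequence on the constraint set that keeps a mass \<open>\<kappa>\<close> in a fixed ball and converges almost everywhere and, on that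
  ball, in the mean. Its limit is then not zero.\<close>

definition tight_sequence :: "'n::finite \<Rightarrow> real \<Rightarrow> (nat \<Rightarrow> real^'n \<Rightarrow> complex) \<Rightarrow> (nat \<Rightarrow> real^'n \<Rightarrow> complex^'n)
    \<Rightarrow> real \<Rightarrow> real \<Rightarrow> bool" where
  "tight_sequence k q V W R \<kappa> \<longleftrightarrow> \<kappa> > 0 \<and> (\<forall>n. energy_pair k (V n) (W n)) \<and> (\<forall>n. power_int q (V n) = 1)
    \<and> (\<forall>n. ennreal \<kappa> \<le> (\<integral>\<^sup>+x. indicator (cball 0 R) x * ennreal ((norm (V n x))\<^sup>2) \<partial>lborel))
    \<and> (AE x in lborel. convergent (\<lambda>n. V n x))
    \<and> (\<forall>e>0. \<exists>n0. \<forall>m\<ge>n0. \<forall>n\<ge>n0.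
          (\<integral>\<^sup>+x. indicator (cball 0 R) x * ennreal ((norm (V m x - V n x))\<^sup>2) \<partial>lborel) \<le> ennreal e)"

text \<open>Each member has a cube on which its average is not small. A translation in the free directions moves this cube to
  one whose index vanishes in these directions; the remaining index is bounded because of the weight.\<close>

lemma tight_subsequence:
  fixes v :: "nat \<Rightarrow> real^'n::finite \<Rightarrow> complex"
  assumes q: "2 < q" "q < q1" and S: "sobolev_bound TYPE('n) q" "sobolev_bound TYPE('n) q1"
    and X: "\<And>n. energy_pair k (v n) (G n)" and A: "\<And>n. energy_form k 1 (v n) (G n) \<le> A" "A > 0" and I: "\<And>n. power_int q (v n) = 1"
  obtains V W r R \<kappa> where "strict_mono (r :: nat \<Rightarrow> nat)" "tight_sequence k q V W R \<kappa>"
    "\<forall>n \<omega>. energy_form k \<omega> (V n) (W n) = energy_form k \<omega> (v (r n)) (G (r n))"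
proof -
  have vm: "v n \<in> borel_measurable borel" for n using energy_pairD(2)[OF X] by (simp add: L2_def)
  have nA: "L2_sq (v n) + L2_sq (G n) \<le> A" for n using energy_form_1_bounds(1) A(1) by (rule order_trans)
  obtain l \<delta> where l: "l > 0" and d: "\<delta> > 0" and
    nv: "\<And>(v::real^'n \<Rightarrow> complex) G. weak_grad v G \<Longrightarrow> L2_sq v + L2_sq G \<le> A \<Longrightarrow> nn_power_int q v \<ge> 1 \<Longrightarrow> \<exists>z. norm (cube_avg l v z) > \<delta>"
    by (rule nonvanishing_cube_average[OF q S(2) A(2)]) (use that in blast)
  have "\<exists>z. norm (cube_avg l (v n) z) > \<delta>" for n
  proof (rule nv[OF energy_pairD(1)[OF X] nA])
    have "nn_power_int q (v n) = ennreal (power_int q (v n))"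
      using q by (intro nn_power_int_eq_power_int vm subcritical_integrable[OF S(1) _ energy_pairD(1)[OF X]]) auto
    then show "nn_power_int q (v n) \<ge> 1" using I[of n] by simp
  qed
  then obtain z where z: "\<And>n. norm (cube_avg l (v n) (z n)) > \<delta>" by metis
  \<comment> \<open>Split the cube index into its confined part, which is kept, and its free part, which is translated away.\<close>
  define zk where "zk n i = (if i = k then z n k else 0)" for n i
  define d0 where "d0 n i = (if i = k then 0 else z n i)" for n i
  define y :: "nat \<Rightarrow> real^'n" where "y n = (\<chi> i. l * real_of_int (d0 n i))" for n
  have yk: "y n $ k = 0" for n by (simp add: y_def d0_def)
  define u where "u n = (\<lambda>x. v n (x + y n))" for n
  define U where "U n = (\<lambda>x. G n (x + y n))" for n
  have uX: "energy_pair k (u n) (U n)" and uQ: "energy_form k \<omega> (u n) (U n) = energy_form k \<omega> (v n) (G n)" for n \<omega>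
    unfolding u_def U_def by (rule energy_pair_translate[OF X yk])+
  have uI: "power_int q (u n) = 1" for n unfolding u_def using power_int_translate[OF vm[of n]] I[of n] by simp
  have um: "u n \<in> borel_measurable borel" for n using energy_pairD(2)[OF uX] by (simp add: L2_def)
  have uz: "norm (cube_avg l (u n) (zk n)) > \<delta>" for n
  proof -
    have "cube_avg l (u n) (zk n) = cube_avg l (v n) (\<lambda>i. zk n i + d0 n i)"
      unfolding u_def by (rule cube_avg_translate[OF vm l]) (simp add: y_def)
    also have "(\<lambda>i. zk n i + d0 n i) = z n" by (auto simp: zk_def d0_def)
    finally show ?thesis using z by simp
  qed
  have uA: "L2_sq (u n) + L2_sq (U n) \<le> A" for n
  proof -
    have "L2_sq (u n) + L2_sq (U n) \<le> energy_form k 1 (u n) (U n)" by (rule energy_form_1_bounds(1))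
    then show ?thesis using A(1)[of n] uQ[of 1 n] by simp
  qed
  define Z where "Z = 2 + A / (\<delta>\<^sup>2 * l ^ CARD('n) * l\<^sup>2)"
  have zZ: "\<bar>real_of_int (zk n i)\<bar> \<le> Z" for n i
  proof (cases "i = k")
    case True
    have "L2_sq (\<lambda>x. (x $ k) *\<^sub>R u n x) \<le> A"
      using A(1)[of n] uQ[of 1 n] L2_sq_nonneg[of "U n"] L2_sq_nonneg[of "u n"] by (simp add: energy_form_def)
    then show ?thesis unfolding Z_def True by (rule cube_index_bound[OF energy_pairD(2)[OF uX] energy_pairD(4)[OF uX] _ l d uz])
  next
    case False
    then show ?thesis using A(2) l d by (simp add: zk_def Z_def)
  qed
  define R where "R = real CARD('n) * (l * (Z + 1))"
  have sub: "cube l (zk n) \<subseteq> cball 0 R" for n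
  proof
    fix x :: "real^'n" assume x: "x \<in> cube l (zk n)"
    have "\<bar>x $ i\<bar> \<le> l * (Z + 1)" for i
    proof -
      have 1: "l * zk n i \<le> x $ i" "x $ i < l * (real_of_int (zk n i) + 1)" using x l by (auto simp: cube_iff)
      have "- Z \<le> real_of_int (zk n i)" "real_of_int (zk n i) \<le> Z" using zZ[of n i] by auto
      then have "l * (- Z) \<le> l * zk n i" "l * (real_of_int (zk n i) + 1) \<le> l * (Z + 1)"
        using mult_left_mono[of "- Z" "real_of_int (zk n i)" l] mult_left_mono[of "real_of_int (zk n i) + 1" "Z + 1" l] l by simp_all
      with 1 have "- (l * Z) \<le> x $ i" "x $ i \<le> l * (Z + 1)" by auto
      moreover have "l * Z \<le> l * (Z + 1)" using l by simp
      ultimately show ?thesis by linarith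
    qed
    then have "(\<Sum>i\<in>UNIV. \<bar>x $ i\<bar>) \<le> (\<Sum>i\<in>(UNIV::'n set). l * (Z + 1))" by (intro sum_mono)
    then have "norm x \<le> R" using norm_le_l1_cart[of x] by (simp add: R_def)
    then show "x \<in> cball 0 R" by simp
  qed
  define \<kappa> where "\<kappa> = l ^ CARD('n) * \<delta>\<^sup>2"
  have kap: "\<kappa> > 0" using l d by (simp add: \<kappa>_def)
  have low: "ennreal \<kappa> \<le> (\<integral>\<^sup>+x. indicator (cball 0 R) x * ennreal ((norm (u n x))\<^sup>2) \<partial>lborel)" for n
  proof -
    have "\<delta>\<^sup>2 \<le> (norm (cube_avg l (u n) (zk n)))\<^sup>2" using uz[of n] d by (intro power_mono) auto
    then have "ennreal \<kappa> \<le> ennreal (l ^ CARD('n) * (norm (cube_avg l (u n) (zk n)))\<^sup>2)"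
      unfolding \<kappa>_def using l by (intro ennreal_leI mult_left_mono) auto
    also have "\<dots> \<le> (\<integral>\<^sup>+y. indicator (cube l (zk n)) y * ennreal ((norm (u n y))\<^sup>2) \<partial>lborel)"
      by (rule cube_avg_square_le[OF um l])
    also have "\<dots> \<le> (\<integral>\<^sup>+x. indicator (cball 0 R) x * ennreal ((norm (u n x))\<^sup>2) \<partial>lborel)"
      using sub[of n] by (intro nn_integral_mono mult_right_mono) (auto simp: indicator_def)
    finally show ?thesis .
  qed
  obtain r where r: "strict_mono r" "AE x in lborel. convergent (\<lambda>n. u (r n) x)"
    "\<And>R e. e > 0 \<Longrightarrow> \<exists>n0. \<forall>m\<ge>n0. \<forall>n\<ge>n0.
        (\<integral>\<^sup>+x. indicator (cball 0 R) x * ennreal ((norm (u (r m) x - u (r n) x))\<^sup>2) \<partial>lborel) \<le> ennreal e"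
    by (rule local_compactness[of u U A]) (use energy_pairD(1)[OF uX] uA A(2) in auto)
  show ?thesis
  proof (rule that[OF r(1)])
    show "tight_sequence k q (\<lambda>n. u (r n)) (\<lambda>n. U (r n)) R \<kappa>"
      unfolding tight_sequence_def by (intro conjI allI impI r uX uI kap low)
    show "\<forall>n \<omega>. energy_form k \<omega> (u (r n)) (U (r n)) = energy_form k \<omega> (v (r n)) (G (r n))" using uQ by blast
  qed
qed

section \<open>Existence of a minimiser\<close>

lemma exists_larger_subcritical:
  assumes N: "CARD('n::finite) \<ge> 2" and q: "2 < q" "q < 2 + 2 * q / real CARD('n)"
  obtains q1 where "q < q1" "q1 < 2 + 2 * q1 / real CARD('n)"
proof -
  let ?N = "real CARD('n)"
  have Np: "?N \<ge> 2" using N by simp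
  define d where "d = (2 + 2 * q / ?N - q) / 2"
  have d: "d > 0" using q by (simp add: d_def)
  have "2 + 2 * (q + d) / ?N = 2 + 2 * q / ?N + 2 * d / ?N" by (simp add: add_divide_distrib distrib_left)
  moreover have "2 * d / ?N \<ge> 0" using d by simp
  moreover have "2 * d = 2 + 2 * q / ?N - q" unfolding d_def by simp
  ultimately have "q + d < 2 + 2 * (q + d) / ?N" using d by linarith
  then show ?thesis using that[of "q + d"] d by simp
qed

text \<open>The strict concavity that excludes splitting of the mass.\<close>

lemma strict_subadditive_power:
  fixes I a :: real
  assumes "0 < I" "I < 1" "0 < a" "a < 1"
  shows "1 < I powr a + (1 - I) powr a"
proof -
  have p: "x powr a > x" if "0 < x" "x < 1" for x :: real
    using powr_less_mono'[of x a 1] that assms by simp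
  show ?thesis using p[of I] p[of "1 - I"] assms by simp
qed

lemma unit_power_scaling:
  fixes I q :: real
  assumes "I > 0" "q > 0" shows "\<bar>I powr (- 1 / q)\<bar> powr q * I = 1"
proof -
  have "(- 1 / q) * q = - 1" using assms by simp
  then have "(I powr (- 1 / q)) powr q = I powr (- 1)" by (simp only: powr_powr)
  then have "\<bar>I powr (- 1 / q)\<bar> powr q = I powr (- 1)" by (simp only: abs_of_nonneg powr_ge_zero)
  then show ?thesis using assms by (simp add: powr_minus_divide)
qed

lemma exists_unit_power:
  assumes S: "sobolev_bound TYPE('n::finite) q" and q: "q > 0"
  obtains v :: "real^'n \<Rightarrow> complex" and G where "energy_pair k v G" "power_int q v = 1"
proof -
  define f where "f = bump 1 (0::real^'n) 1"
  have tf: "test_function f" unfolding f_def by (rule test_function_bump) simp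
  define v where "v x = complex_of_real (f x)" for x
  define G :: "real^'n \<Rightarrow> complex^'n" where "G x = (\<chi> i. complex_of_real (partial_deriv i f x))" for x
  have X: "energy_pair k v G" unfolding v_def[abs_def] G_def[abs_def] by (rule energy_pair_test_function[OF tf])
  have [measurable]: "v \<in> borel_measurable borel" using energy_pairD(2)[OF X] by (simp add: L2_def)
  have int: "integrable_power q v" by (rule subcritical_integrable[OF S q energy_pairD(1)[OF X]])
  have "power_int q v \<noteq> 0"
  proof
    assume "power_int q v = 0"
    then have "AE x in lborel. norm (v x) powr q = 0"
      unfolding power_int_def using int by (subst (asm) integral_nonneg_eq_0_iff_AE) auto
    moreover have "v x \<noteq> 0" if "x \<in> box 0 1" for x
    proof -
      have "flat_exp 1 (1 * x $ i + - (1 * (0::real^'n) $ i)) * flat_exp 1 (- 1 * x $ i + 1 * (1::real^'n) $ i) \<noteq> 0" for i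
        using that by (auto simp: mem_box_cart flat_exp_def)
      then have "f x \<noteq> 0" unfolding f_def bump_def by (simp only: prod_zero_iff finite) simp
      then show ?thesis by (simp add: v_def)
    qed
    ultimately have "AE x in lborel. x \<notin> box (0::real^'n) 1" by (auto elim!: eventually_mono)
    then have "emeasure lborel (box (0::real^'n) 1) = 0" by (subst (asm) AE_iff_measurable[where N="box 0 1"]) auto
    then show False using emeasure_scaled_box(2)[of 1 "0::real^'n"] by simp
  qed
  then have pos: "power_int q v > 0" using power_int_nonneg[of q v] by linarith
  \<comment> \<open>Normalises the power integral.\<close>
  define c where "c = power_int q v powr (- 1 / q)"
  have "\<bar>c\<bar> powr q * power_int q v = 1"
    unfolding c_def by (rule unit_power_scaling[OF pos q])
  then have "power_int q (\<lambda>x. c *\<^sub>R v x) = 1" by (simp add: power_int_scaleR)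
  then show ?thesis using that energy_pair_scaleR[OF X] by blast
qed

text \<open>Let \<open>Q\<close> be the energy form, \<open>I\<close> the power integral and \<open>m\<close> the infimum of \<open>Q\<close> over \<open>I = 1\<close>. By homogeneity
  \<open>Q \<ge> m I\<^sup>2\<^sup>/\<^sup>q\<close>. A tight minimising sequence \<open>V\<^sub>n\<close> has an almost everywhere limit \<open>u \<noteq> 0\<close>, which is also the strong limit
  of midpoints. Apply the inequality to \<open>V\<^sub>n - u\<close>, where the splitting of Brezis and Lieb gives \<open>I(V\<^sub>n - u) \<rightarrow> 1 - I(u)\<close>:
  the result is an upper bound for \<open>B(V\<^sub>n, u)\<close>, which is affine in \<open>V\<^sub>n\<close> and therefore holds for the midpoints,
  and in the limit for \<open>Q(u)\<close>. It reads \<open>Q(u) \<le> m - m (1 - I(u))\<^sup>2\<^sup>/\<^sup>q\<close>. Together with \<open>Q(u) \<ge> m I(u)\<^sup>2\<^sup>/\<^sup>q\<close> and strict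
  subadditivity this forces \<open>I(u) = 1\<close> and \<open>Q(u) = m\<close>.\<close>

theorem exists_minimiser:
  fixes k :: "'n::finite"
  assumes N: "CARD('n) \<ge> 2" and q: "2 < q" "q < 2 + 2 * q / real CARD('n)" and w: "-1 < \<omega>"
  obtains u F m where "m > 0" "energy_pair k u F" "power_int q u = 1" "energy_form k \<omega> u F = m"
    "\<And>v G. energy_pair k v G \<Longrightarrow> m * power_int q v powr (2 / q) \<le> energy_form k \<omega> v G"
proof -
  obtain q1 where q1: "q < q1" "q1 < 2 + 2 * q1 / real CARD('n)" by (rule exists_larger_subcritical[OF N q])
  have S: "sobolev_bound TYPE('n) q" by (rule sobolev_bound_subcritical[OF N]) (use q in auto)
  have S1: "sobolev_bound TYPE('n) q1" by (rule sobolev_bound_subcritical[OF N]) (use q q1 in auto)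
  have q0: "q > 0" using q by simp
  obtain c where c: "c > 0" "\<And>v G. energy_pair k v G \<Longrightarrow> c * energy_form k 1 v G \<le> energy_form k \<omega> v G" by (rule coercive[OF w, where k=k]) (use that in blast)
  have Qpos: "energy_form k \<omega> v G \<ge> 0" if "energy_pair k v G" for v G
    using c(2)[OF that] mult_nonneg_nonneg[OF less_imp_le[OF c(1)] energy_form_1_nonneg[of k v G]] by linarith
  note int = subcritical_integrable[OF S q0]
  define M where "M = {energy_form k \<omega> v G | v G. energy_pair k v G \<and> power_int q v = 1}"
  define m where "m = Inf M"
  obtain v1 :: "real^'n \<Rightarrow> complex" and G1 where v1: "energy_pair k v1 G1" "power_int q v1 = 1"
    by (rule exists_unit_power[OF S q0, of k])
  have "energy_form k \<omega> v1 G1 \<in> M" unfolding M_def using v1 by blast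
  then have Mne: "M \<noteq> {}" by blast
  have Mbb: "bdd_below M" unfolding M_def by (rule bdd_belowI[of _ 0]) (use Qpos in auto)
  have mle: "m \<le> energy_form k \<omega> v G" if "energy_pair k v G" "power_int q v = 1" for v G
    unfolding m_def by (rule cInf_lower[OF _ Mbb]) (use that in \<open>auto simp: M_def\<close>)
  have mineq: "m * power_int q v powr (2 / q) \<le> energy_form k \<omega> v G" if X: "energy_pair k v G" for v G
  proof (cases "power_int q v = 0")
    case True then show ?thesis using Qpos[OF X] by simp
  next
    case False
    then have pos: "power_int q v > 0" using power_int_nonneg[of q v] by linarith
    define t where "t = power_int q v powr (- 1 / q)"
    have "\<bar>t\<bar> powr q * power_int q v = 1" unfolding t_def by (rule unit_power_scaling[OF pos q0])
    then have "power_int q (\<lambda>x. t *\<^sub>R v x) = 1" by (simp add: power_int_scaleR)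
    then have "m \<le> t\<^sup>2 * energy_form k \<omega> v G" using mle[OF energy_pair_scaleR[OF X, of t]] by (simp add: energy_form_scaleR[OF X])
    also have "t\<^sup>2 = power_int q v powr (- (2 / q))" using pos by (simp add: t_def powr_powr flip: powr_numeral)
    finally have "m * power_int q v powr (2 / q) \<le> power_int q v powr (- (2 / q)) * energy_form k \<omega> v G * power_int q v powr (2 / q)"
      by (intro mult_right_mono) auto
    also have "\<dots> = energy_form k \<omega> v G" using pos by (simp add: powr_minus field_simps)
    finally show ?thesis .
  qed
  have mpos: "m > 0"
  proof -
    obtain C where C: "C > 0"
      "\<And>(v::real^'n \<Rightarrow> complex) G s. weak_grad v G \<Longrightarrow> s > 0 \<Longrightarrow> L2_sq v + L2_sq G \<le> s \<Longrightarrow> nn_power_int q v \<le> ennreal (C * s powr (q / 2))"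
      by (rule sobolev_inequality[OF S q0]) (use that in blast)
    define s0 where "s0 = (1 / (2 * C)) powr (2 / q)"
    have s0: "s0 > 0" using C(1) by (simp add: s0_def)
    have s0q: "C * s0 powr (q / 2) = 1 / 2" using C(1) q0 by (simp add: s0_def powr_powr)
    have "c * s0 \<le> energy_form k \<omega> v G" if X: "energy_pair k v G" and I: "power_int q v = 1" for v G
    proof -
      have "nn_power_int q v = ennreal 1" using nn_power_int_eq_power_int[OF L2_measurable[OF energy_pairD(2)[OF X]] int[OF energy_pairD(1)[OF X]]] I by simp
      moreover have "\<not> ennreal 1 \<le> ennreal (1 / 2)" by (subst ennreal_le_iff) auto
      ultimately have "\<not> nn_power_int q v \<le> ennreal (C * s0 powr (q / 2))" by (simp only: s0q not_False_eq_True)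
      then have "s0 < L2_sq v + L2_sq G" using C(2)[OF energy_pairD(1)[OF X] s0] by force
      then have "s0 \<le> energy_form k 1 v G" using energy_form_1_bounds(1)[of v G k] by linarith
      then have "c * s0 \<le> c * energy_form k 1 v G" using c(1) by simp
      then show ?thesis using c(2)[OF X] by linarith
    qed
    then have "c * s0 \<le> m" unfolding m_def by (intro cInf_greatest[OF Mne]) (auto simp: M_def)
    then show ?thesis using mult_pos_pos[OF c(1) s0] by linarith
  qed
  have "\<exists>v G. energy_pair k v G \<and> power_int q v = 1 \<and> energy_form k \<omega> v G < m + 1 / real (Suc n)" for n
  proof -
    have "\<exists>y\<in>M. y < m + 1 / real (Suc n)" unfolding m_def by (rule cInf_lessD[OF Mne]) simp
    then show ?thesis unfolding M_def by blast
  qed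
  then obtain v G where vX: "\<And>n. energy_pair k (v n) (G n)" and vI: "\<And>n. power_int q (v n) = 1"
    and vQ: "\<And>n. energy_form k \<omega> (v n) (G n) < m + 1 / real (Suc n)" by metis
  define A where "A = (m + 1) / c"
  have A0: "A > 0" using mpos c by (simp add: A_def)
  have vA: "energy_form k 1 (v n) (G n) \<le> A" for n
  proof -
    have "1 / real (Suc n) \<le> 1" by simp
    then have "c * energy_form k 1 (v n) (G n) \<le> m + 1" using c(2)[OF vX[of n]] vQ[of n] by linarith
    then show ?thesis using c(1) by (simp add: A_def pos_le_divide_eq mult.commute)
  qed
  obtain V W r R \<kappa> where r: "strict_mono (r :: nat \<Rightarrow> nat)" and tight: "tight_sequence k q V W R \<kappa>"
    and VQ': "\<forall>n \<omega>. energy_form k \<omega> (V n) (W n) = energy_form k \<omega> (v (r n)) (G (r n))"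
    by (rule tight_subsequence[where v=v and G=G and k=k, OF q(1) q1(1) S S1 vX vA A0 vI])
  note VQ = VQ'[rule_format]
  have VX: "energy_pair k (V n) (W n)" and VI: "power_int q (V n) = 1"
    and low: "ennreal \<kappa> \<le> (\<integral>\<^sup>+x. indicator (cball 0 R) x * ennreal ((norm (V n x))\<^sup>2) \<partial>lborel)" for n
    using tight unfolding tight_sequence_def by simp_all
  have kap: "\<kappa> > 0" and conv: "AE x in lborel. convergent (\<lambda>n. V n x)"
    and Cau: "\<forall>e>0. \<exists>n0. \<forall>m\<ge>n0. \<forall>n\<ge>n0. (\<integral>\<^sup>+x. indicator (cball 0 R) x * ennreal ((norm (V m x - V n x))\<^sup>2) \<partial>lborel) \<le> ennreal e"
    using tight unfolding tight_sequence_def by simp_all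
  have VA: "energy_form k 1 (V n) (W n) \<le> A" for n unfolding VQ by (rule vA)
  have VQm: "(\<lambda>n. energy_form k \<omega> (V n) (W n)) \<longlonglongrightarrow> m"
  proof (rule tendsto_sandwich[OF _ _ tendsto_const])
    show "\<forall>\<^sub>F n in sequentially. m \<le> energy_form k \<omega> (V n) (W n)" using mle[OF VX VI] by simp
    show "\<forall>\<^sub>F n in sequentially. energy_form k \<omega> (V n) (W n) \<le> m + 1 / real (Suc n)"
    proof (intro always_eventually allI)
      fix n
      have "n \<le> r n" by (rule seq_suble[OF r])
      then have "1 / real (Suc (r n)) \<le> 1 / real (Suc n)" by (intro divide_left_mono) auto
      then show "energy_form k \<omega> (V n) (W n) \<le> m + 1 / real (Suc n)" unfolding VQ using vQ[of "r n"] by linarith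
    qed
    have "(\<lambda>n. m + 1 / real (Suc n)) \<longlonglongrightarrow> m + 0"
      using LIMSEQ_inverse_real_of_nat by (intro tendsto_add tendsto_const) (simp add: divide_inverse)
    then show "(\<lambda>n. m + 1 / real (Suc n)) \<longlonglongrightarrow> m" by simp
  qed
  obtain u F w H where uX: "energy_pair k u F" and wm: "\<And>j. tail_midpoint V W j (w j) (H j)"
    and wu: "AE x in lborel. (\<lambda>j. w j x) \<longlonglongrightarrow> u x"
    and wQ: "(\<lambda>j. energy_form k 1 (\<lambda>x. w j x - u x) (\<lambda>x. H j x - F x)) \<longlonglongrightarrow> 0"
    by (rule mazur[of k V W A, OF VX VA]) (rule that, assumption, blast, assumption, assumption)
  have wX: "energy_pair k (w j) (H j)" for j by (rule tail_midpoint_energy_pair[OF wm VX])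
  \<comment> \<open>Pointwise limits pass to midpoints of tails, so the two limits agree.\<close>
  have Vu: "AE x in lborel. (\<lambda>n. V n x) \<longlonglongrightarrow> u x"
    using conv wu
  proof eventually_elim
    case (elim x)
    then obtain L where L: "(\<lambda>n. V n x) \<longlonglongrightarrow> L" by (auto simp: convergent_def)
    have "(\<lambda>j. w j x) \<longlonglongrightarrow> L"
    proof (rule LIMSEQ_I)
      fix e :: real assume "e > 0"
      then obtain n0 where n0: "\<And>n. n \<ge> n0 \<Longrightarrow> norm (V n x - L) < e / 2" using LIMSEQ_D[OF L, of "e / 2"] by auto
      have "norm (w j x - L) < e" if "j \<ge> n0" for j
      proof -
        have "norm (w j x - L) \<le> e / 2"
          by (rule tail_midpoint_pointwise[OF wm]) (use n0 that in \<open>force intro: less_imp_le\<close>)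
        then show ?thesis using \<open>e > 0\<close> by simp
      qed
      then show "\<exists>n0. \<forall>j\<ge>n0. norm (w j x - L) < e" by blast
    qed
    then have "L = u x" using elim(2) LIMSEQ_unique by blast
    then show ?case using L by simp
  qed
  have Vm: "V n \<in> borel_measurable borel" for n using energy_pairD(2)[OF VX] by (simp add: L2_def)
  have um: "u \<in> borel_measurable borel" using energy_pairD(2)[OF uX] by (simp add: L2_def)
  note [measurable] = Vm um
  have Vi: "integrable_power q (V n)" for n by (rule int[OF energy_pairD(1)[OF VX]])
  have ui: "integrable_power q u" by (rule int[OF energy_pairD(1)[OF uX]])
  \<comment> \<open>Convergence in the mean on the ball keeps the mass \<open>\<kappa>\<close>.\<close>
  have unz: "power_int q u \<noteq> 0"
  proof
    assume "power_int q u = 0"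
    then have "AE x in lborel. norm (u x) powr q = 0"
      unfolding power_int_def using ui by (subst (asm) integral_nonneg_eq_0_iff_AE) auto
    then have u0: "AE x in lborel. (\<lambda>n. V n x) \<longlonglongrightarrow> 0" using Vu by eventually_elim auto
    have "\<kappa> / 2 > 0" using kap by simp
    with Cau obtain n0 where n0: "\<forall>m\<ge>n0. \<forall>n\<ge>n0. (\<integral>\<^sup>+x. indicator (cball 0 R) x * ennreal ((norm (V m x - V n x))\<^sup>2) \<partial>lborel) \<le> ennreal (\<kappa> / 2)"
      by blast
    have "ennreal \<kappa> \<le> (\<integral>\<^sup>+x. indicator (cball 0 R) x * ennreal ((norm (V n0 x))\<^sup>2) \<partial>lborel)" by (rule low)
    also have "\<dots> = (\<integral>\<^sup>+x. liminf (\<lambda>n. indicator (cball 0 R) x * ennreal ((norm (V n0 x - V (n + n0) x))\<^sup>2)) \<partial>lborel)"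
    proof (rule nn_integral_cong_AE, use u0 in eventually_elim)
      case (elim x)
      have e: "(\<lambda>n. ennreal ((norm (V n0 x - V (n + n0) x))\<^sup>2)) \<longlonglongrightarrow> ennreal ((norm (V n0 x - 0))\<^sup>2)"
        by (intro tendsto_ennrealI tendsto_power tendsto_norm tendsto_diff tendsto_const LIMSEQ_ignore_initial_segment elim)
      have "(\<lambda>n. indicator (cball 0 R) x * ennreal ((norm (V n0 x - V (n + n0) x))\<^sup>2)) \<longlonglongrightarrow> indicator (cball 0 R) x * ennreal ((norm (V n0 x))\<^sup>2)"
        using e by (cases "x \<in> cball 0 R") auto
      then show ?case by (rule lim_imp_Liminf[symmetric, OF sequentially_bot])
    qed
    also have "\<dots> \<le> liminf (\<lambda>n. \<integral>\<^sup>+x. indicator (cball 0 R) x * ennreal ((norm (V n0 x - V (n + n0) x))\<^sup>2) \<partial>lborel)"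
      by (rule nn_integral_liminf) measurable
    also have "\<dots> \<le> liminf (\<lambda>n::nat. ennreal (\<kappa> / 2))"
      by (intro Liminf_mono always_eventually allI n0[rule_format]) auto
    also have "\<dots> = ennreal (\<kappa> / 2)" by (simp add: Liminf_const)
    finally show False using kap by (simp add: ennreal_le_iff)
  qed
  then have I0: "power_int q u > 0" using power_int_nonneg[of q u] by linarith
  have BL: "(\<lambda>n. power_int q (\<lambda>x. V n x - u x)) \<longlonglongrightarrow> 1 - power_int q u"
    by (rule brezis_lieb[OF q0 Vm um Vi VI ui Vu])
  have I1: "power_int q u \<le> 1"
    using tendsto_lowerbound[OF BL, of 0] by (simp add: power_int_nonneg)
  \<comment> \<open>The bound for \<open>B(V\<^sub>n, u)\<close> in the limit.\<close>
  let ?K = "(m + energy_form k \<omega> u F - m * (1 - power_int q u) powr (2 / q)) / 2"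
  have "energy_form k \<omega> u F \<le> ?K + e" if e: "e > 0" for e
  proof -
    have "(\<lambda>n. (energy_form k \<omega> (V n) (W n) + energy_form k \<omega> u F - m * power_int q (\<lambda>x. V n x - u x) powr (2 / q)) / 2) \<longlonglongrightarrow> ?K"
      using q0 I1 by (intro tendsto_divide tendsto_diff tendsto_add tendsto_mult tendsto_const VQm tendsto_powr' BL)
        (auto simp: power_int_nonneg)
    then have "\<forall>\<^sub>F n in sequentially. (energy_form k \<omega> (V n) (W n) + energy_form k \<omega> u F - m * power_int q (\<lambda>x. V n x - u x) powr (2 / q)) / 2 < ?K + e"
      using e by (intro order_tendstoD(2)) auto
    then obtain n0 where n0: "\<And>n. n \<ge> n0 \<Longrightarrow> (energy_form k \<omega> (V n) (W n) + energy_form k \<omega> u F - m * power_int q (\<lambda>x. V n x - u x) powr (2 / q)) / 2 < ?K + e"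
      unfolding eventually_sequentially by blast
    have BV: "energy_bilin k \<omega> (V n) (W n) u F \<le> ?K + e" if "n \<ge> n0" for n
    proof -
      have "m * power_int q (\<lambda>x. V n x - u x) powr (2 / q) \<le> energy_form k \<omega> (V n) (W n) - 2 * energy_bilin k \<omega> (V n) (W n) u F + energy_form k \<omega> u F"
        using mineq[OF energy_pair_diff[OF VX uX], of n] by (simp only: energy_form_diff[OF VX uX])
      moreover have "b \<le> K" if "x \<le> a - 2 * b + c" "(a + c - x) / 2 < K" for x a b c K :: real
        using that by argo
      ultimately show ?thesis using n0[OF that] by blast
    qed
    have Bw: "energy_bilin k \<omega> a b u F \<le> ?K + e" if "tail_midpoint V W n0 a b" for a b
      using that
    proof (induction rule: tail_midpoint.induct)
      case (base m) then show ?case by (rule BV)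
    next
      case (mid a b a' b')
      have "energy_pair k a b" "energy_pair k a' b'" using tail_midpoint_energy_pair mid VX by blast+
      then show ?case using mid by (simp only: energy_bilin_lincomb[OF _ _ uX])
    qed
    show ?thesis
    proof (rule energy_bilin_limit_le[OF uX wX Qpos wQ])
      show "\<forall>\<^sub>F j in sequentially. energy_bilin k \<omega> (w j) (H j) u F \<le> ?K + e"
        unfolding eventually_sequentially using Bw tail_midpoint_mono[OF wm] by blast
    qed
  qed
  then have "energy_form k \<omega> u F \<le> ?K" by (rule field_le_epsilon)
  then have up: "energy_form k \<omega> u F \<le> m - m * (1 - power_int q u) powr (2 / q)" by simp
  have "m * (power_int q u powr (2 / q) + (1 - power_int q u) powr (2 / q)) \<le> m * 1"
    using mineq[OF uX] up by (simp add: distrib_left)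
  then have le1: "power_int q u powr (2 / q) + (1 - power_int q u) powr (2 / q) \<le> 1" using mpos by simp
  have uI: "power_int q u = 1"
  proof (rule ccontr)
    assume "power_int q u \<noteq> 1"
    then have "power_int q u < 1" using I1 by simp
    then show False using strict_subadditive_power[OF I0 _, of "2 / q"] q le1 by simp
  qed
  then have "energy_form k \<omega> u F = m" using up mle[OF uX uI] by simp
  then show ?thesis using that[OF mpos uX uI _ mineq] by blast
qed

section \<open>Borel representatives\<close>

lemma lborel_lebesgue:
  fixes f :: "'a::euclidean_space \<Rightarrow> 'b::{banach, second_countable_topology}"
  assumes "f \<in> borel_measurable lebesgue" "g \<in> borel_measurable borel" "AE x in lborel. f x = g x"
  shows "integrable lebesgue f \<longleftrightarrow> integrable lborel g" "(\<integral>x. f x \<partial>lebesgue) = (\<integral>x. g x \<partial>lborel)"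
proof -
  have g: "g \<in> borel_measurable lebesgue" using assms(2) by (simp add: measurable_completion)
  have ae: "AE x in lebesgue. f x = g x" using assms(3) by (rule AE_completion)
  have "integrable lebesgue f \<longleftrightarrow> integrable lebesgue g" by (rule integrable_cong_AE[OF assms(1) g ae])
  then show "integrable lebesgue f \<longleftrightarrow> integrable lborel g" using integrable_completion[of g lborel] assms(2) by simp
  have "(\<integral>x. f x \<partial>lebesgue) = (\<integral>x. g x \<partial>lebesgue)" by (rule integral_cong_AE[OF assms(1) g ae])
  then show "(\<integral>x. f x \<partial>lebesgue) = (\<integral>x. g x \<partial>lborel)" using integral_completion[of g lborel] assms(2) by simp
qed

lemma in_Lp_2_iff:
  fixes f :: "'a::euclidean_space \<Rightarrow> 'b::euclidean_space"
  assumes f: "f \<in> borel_measurable lebesgue" and g: "g \<in> borel_measurable borel" and ae: "AE x in lborel. f x = g x"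
  shows "in_Lp 2 f \<longleftrightarrow> L2 g" "(Lp_norm 2 f)\<^sup>2 = L2_sq g"
proof -
  have m: "(\<lambda>x. (norm (f x))\<^sup>2) \<in> borel_measurable lebesgue" "(\<lambda>x. (norm (g x))\<^sup>2) \<in> borel_measurable borel"
    using f g by auto
  have a: "AE x in lborel. (norm (f x))\<^sup>2 = (norm (g x))\<^sup>2" using ae by eventually_elim simp
  note t = lborel_lebesgue[OF m a]
  show "in_Lp 2 f \<longleftrightarrow> L2 g" unfolding in_Lp_def L2_def using t f g by simp
  have "(\<integral>x. norm (f x) powr 2 \<partial>lebesgue) = L2_sq g" using t by (simp add: L2_sq_def)
  then show "(Lp_norm 2 f)\<^sup>2 = L2_sq g" unfolding Lp_norm_def using L2_sq_nonneg[of g] by (simp add: powr_half_sqrt)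
qed

lemma L2_imp_locally_integrable:
  fixes g :: "'a::euclidean_space \<Rightarrow> 'b::euclidean_space"
  assumes f: "f \<in> borel_measurable lebesgue" and g: "L2 g" and ae: "AE x in lborel. f x = g x"
  shows "locally_integrable f"
  unfolding locally_integrable_def set_integrable_def
proof (intro allI impI)
  fix K :: "'a set" assume K: "compact K"
  then have Kb: "K \<in> sets borel" by (simp add: compact_imp_closed borel_closed)
  have [measurable]: "g \<in> borel_measurable borel" using g by (simp add: L2_def)
  have "integrable lborel (\<lambda>x. indicator K x *\<^sub>R g x)"
    by (intro L2_scaleR_integrable L2_indicator g Kb compact_imp_bounded K)
  then show "integrable lebesgue (\<lambda>x. indicator K x *\<^sub>R f x)"
    by (subst lborel_lebesgue(1)[where g="\<lambda>x. indicator K x *\<^sub>R g x"])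
       (use f Kb ae in \<open>auto intro!: borel_measurable_scaleR borel_measurable_indicator elim!: eventually_mono\<close>)
qed

lemma locally_integrable_measurable:
  assumes "locally_integrable f" shows "f \<in> borel_measurable lebesgue"
proof (rule borel_measurable_LIMSEQ_metric)
  show "(\<lambda>x. indicator (cball 0 (real n)) x *\<^sub>R f x) \<in> borel_measurable lebesgue" for n
    using assms unfolding locally_integrable_def set_integrable_def by (auto intro: borel_measurable_integrable)
  fix x
  show "(\<lambda>n. indicator (cball 0 (real n)) x *\<^sub>R f x) \<longlonglongrightarrow> f x"
  proof (rule tendsto_eventually, rule eventually_mono[OF eventually_ge_at_top[of "nat \<lceil>norm x\<rceil>"]])
    fix n :: nat assume "nat \<lceil>norm x\<rceil> \<le> n"
    then have "norm x \<le> real n" by linarith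
    then show "indicator (cball 0 (real n)) x *\<^sub>R f x = f x" by simp
  qed
qed

lemma test_times_locally_integrable:
  assumes f: "test_function f" and v: "locally_integrable v"
  shows "integrable lebesgue (\<lambda>x. f x *\<^sub>R v x)"
proof -
  obtain r where r: "\<And>x. norm x \<ge> r \<Longrightarrow> f x = 0" using test_function_support[OF f] by metis
  obtain M where M: "M \<ge> 0" "\<And>x. \<bar>f x\<bar> \<le> M" using test_function_bounded[OF f] by metis
  have fm: "f \<in> borel_measurable lebesgue" using test_function_measurable[OF f] by (simp add: measurable_completion)
  have "integrable lebesgue (\<lambda>x. M *\<^sub>R (indicator (cball 0 r) x *\<^sub>R v x))"
    using v unfolding locally_integrable_def set_integrable_def by (intro integrable_scaleR_right) auto
  then show ?thesis
  proof (rule Bochner_Integration.integrable_bound)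
    show "(\<lambda>x. f x *\<^sub>R v x) \<in> borel_measurable lebesgue"
      by (intro borel_measurable_scaleR fm locally_integrable_measurable v)
    show "AE x in lebesgue. norm (f x *\<^sub>R v x) \<le> norm (M *\<^sub>R (indicator (cball 0 r) x *\<^sub>R v x))"
    proof (rule AE_I2)
      fix x show "norm (f x *\<^sub>R v x) \<le> norm (M *\<^sub>R (indicator (cball 0 r) x *\<^sub>R v x))"
        using r[of x] M(1) M(2)[of x] by (cases "norm x \<le> r") (auto intro: mult_right_mono)
    qed
  qed
qed

text \<open>Weak gradients are only locally integrable here, so the fundamental lemma is applied to a Borel version of each
  component of the difference.\<close>

lemma has_weak_gradient_unique:
  assumes G: "has_weak_gradient v G" and H: "has_weak_gradient v H"
  shows "AE x in lborel. G x = H x"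
proof -
  have lG: "locally_integrable G" and lH: "locally_integrable H"
    using G H by (auto simp: has_weak_gradient_def)
  define D where "D x = G x - H x" for x
  have lD: "locally_integrable D"
    using lG lH unfolding locally_integrable_def D_def by (auto intro: set_integral_diff)
  have Dm: "D \<in> borel_measurable lebesgue" by (rule locally_integrable_measurable[OF lD])
  obtain d where d: "d \<in> borel_measurable borel" "AE x in lborel. D x = d x"
    using lebesgue_measurable_borel_representative[OF Dm] by metis
  have nm: "(\<lambda>x::complex^'a. x $ i) \<in> borel_measurable borel" for i
    by (intro borel_measurable_continuous_onI linear_continuous_on bounded_linear_vec_nth)
  have "AE x in lborel. d x $ i = 0" for i
  proof (rule AE_zero_if_test_integrals_zero)
    show di: "(\<lambda>x. d x $ i) \<in> borel_measurable borel" by (rule measurable_compose[OF d(1) nm])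
    have Di: "(\<lambda>x. D x $ i) \<in> borel_measurable lebesgue" by (rule measurable_compose[OF Dm nm])
    have aei: "AE x in lborel. D x $ i = d x $ i" using d(2) by eventually_elim simp
    have lDi: "locally_integrable (\<lambda>x. D x $ i)"
      unfolding locally_integrable_def set_integrable_def
    proof (intro allI impI)
      fix K :: "(real^'a) set" assume "compact K"
      then have "integrable lebesgue (\<lambda>x. indicator K x *\<^sub>R D x)"
        using lD by (auto simp: locally_integrable_def set_integrable_def)
      from integrable_bounded_linear[OF bounded_linear_vec_nth this, of i]
      show "integrable lebesgue (\<lambda>x. indicator K x *\<^sub>R (D x $ i))" by simp
    qed
    have tr: "integrable lborel (\<lambda>x. f x *\<^sub>R (d x $ i)) = integrable lebesgue (\<lambda>x. f x *\<^sub>R (D x $ i))"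
      "(\<integral>x. f x *\<^sub>R (d x $ i) \<partial>lborel) = (\<integral>x. f x *\<^sub>R (D x $ i) \<partial>lebesgue)"
      if "f \<in> borel_measurable borel" for f :: "real^'a \<Rightarrow> real"
    proof -
      have 1: "(\<lambda>x. f x *\<^sub>R (D x $ i)) \<in> borel_measurable lebesgue"
        using that Di by (intro borel_measurable_scaleR) (simp_all add: measurable_completion)
      have 2: "(\<lambda>x. f x *\<^sub>R (d x $ i)) \<in> borel_measurable borel" using that di by simp
      have 3: "AE x in lborel. f x *\<^sub>R (D x $ i) = f x *\<^sub>R (d x $ i)" using aei by eventually_elim simp
      show "integrable lborel (\<lambda>x. f x *\<^sub>R (d x $ i)) = integrable lebesgue (\<lambda>x. f x *\<^sub>R (D x $ i))"
        "(\<integral>x. f x *\<^sub>R (d x $ i) \<partial>lborel) = (\<integral>x. f x *\<^sub>R (D x $ i) \<partial>lebesgue)"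
        using lborel_lebesgue[OF 1 2 3] by simp_all
    qed
    show "integrable lborel (\<lambda>x. indicator (cbox a b) x *\<^sub>R (d x $ i))" for a b
      using lDi by (subst tr(1)) (auto simp: locally_integrable_def set_integrable_def)
    fix f :: "real^'a \<Rightarrow> real" assume f: "test_function f"
    have "bounded_linear (\<lambda>x::complex^'a. x $ i)" by (rule bounded_linear_vec_nth)
    then have ii: "integrable lebesgue (\<lambda>x. f x *\<^sub>R (G x $ i))" "integrable lebesgue (\<lambda>x. f x *\<^sub>R (H x $ i))"
      using integrable_bounded_linear[OF bounded_linear_vec_nth test_times_locally_integrable[OF f lG], of i]
        integrable_bounded_linear[OF bounded_linear_vec_nth test_times_locally_integrable[OF f lH], of i] by simp_all
    have "(\<integral>x. f x *\<^sub>R (d x $ i) \<partial>lborel) = (\<integral>x. f x *\<^sub>R (G x $ i) - f x *\<^sub>R (H x $ i) \<partial>lebesgue)"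
      by (subst tr(2)[OF test_function_measurable[OF f]]) (simp add: D_def scaleR_diff_right)
    also have "\<dots> = (\<integral>x. f x *\<^sub>R (G x $ i) \<partial>lebesgue) - (\<integral>x. f x *\<^sub>R (H x $ i) \<partial>lebesgue)"
      by (rule Bochner_Integration.integral_diff[OF ii])
    also have "\<dots> = 0"
      using G H f unfolding has_weak_gradient_def by (metis (no_types, lifting) add.inverse_inverse cancel_comm_monoid_add_class.diff_cancel)
    finally show "(\<integral>x. f x *\<^sub>R (d x $ i) \<partial>lborel) = 0" .
  qed
  then have "AE x in lborel. \<forall>i\<in>UNIV. d x $ i = 0" by (intro AE_finite_allI) auto
  then show ?thesis using d(2) by eventually_elim (auto simp: D_def vec_eq_iff)
qed

text \<open>The pair \<open>(w, G)\<close> consists of Borel functions; \<open>v\<close> is the possibly only Lebesgue measurable element of the energy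
  space that \<open>w\<close> stands for.\<close>

definition represents :: "'n::finite \<Rightarrow> (real^'n \<Rightarrow> complex) \<Rightarrow> (real^'n \<Rightarrow> complex) \<Rightarrow> (real^'n \<Rightarrow> complex^'n) \<Rightarrow> bool" where
  "represents k v w G \<longleftrightarrow> energy_pair k w G \<and> v \<in> borel_measurable lebesgue \<and> (AE x in lborel. v x = w x)"

lemma representsD:
  assumes "represents k v w G"
  shows "energy_pair k w G" "v \<in> borel_measurable lebesgue" "AE x in lborel. v x = w x"
  using assms by (auto simp: represents_def)

lemma represents_self: "energy_pair k w G \<Longrightarrow> represents k w w G"
  using energy_pairD(2)[of k w G] by (simp add: represents_def L2_def measurable_completion)

lemma coordinate_measurable: "(\<lambda>x::real^'n::finite. x $ k) \<in> borel_measurable borel"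
  by (intro borel_measurable_continuous_onI continuous_intros)

lemma weak_integral_transfer:
  fixes f :: "real^'n::finite \<Rightarrow> real" and v :: "real^'n \<Rightarrow> 'b::euclidean_space"
  assumes f: "test_function f" and v: "v \<in> borel_measurable lebesgue" and w: "w \<in> borel_measurable borel" "AE x in lborel. v x = w x"
  shows "(\<integral>x. f x *\<^sub>R v x \<partial>lebesgue) = (\<integral>x. f x *\<^sub>R w x \<partial>lborel)"
proof (rule lborel_lebesgue(2))
  note fm = test_function_measurable[OF f]
  show "(\<lambda>x. f x *\<^sub>R v x) \<in> borel_measurable lebesgue"
    using fm v by (intro borel_measurable_scaleR) (simp_all add: measurable_completion)
  show "(\<lambda>x. f x *\<^sub>R w x) \<in> borel_measurable borel" using fm w by simp
  show "AE x in lborel. f x *\<^sub>R v x = f x *\<^sub>R w x" using w(2) by eventually_elim simp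
qed

lemma represents_has_weak_gradient:
  assumes r: "represents k v w G" shows "has_weak_gradient v G"
  unfolding has_weak_gradient_def
proof (intro conjI allI impI)
  note R = representsD[OF r] and X = energy_pairD[OF representsD(1)[OF r]]
  have Gm: "G \<in> borel_measurable borel" using X(3) by (simp add: L2_def)
  show "locally_integrable v" by (rule L2_imp_locally_integrable[OF R(2) X(2) R(3)])
  show "locally_integrable G" by (rule L2_imp_locally_integrable[OF _ X(3)]) (use Gm in \<open>auto simp: measurable_completion\<close>)
  fix f :: "real^'a \<Rightarrow> real" and i assume f: "test_function f"
  have Gi: "(\<lambda>x. G x $ i) \<in> borel_measurable borel" using L2_nth[OF X(3)] by (simp add: L2_def)
  have "(\<integral>x. partial_deriv i f x *\<^sub>R v x \<partial>lebesgue) = (\<integral>x. partial_deriv i f x *\<^sub>R w x \<partial>lborel)"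
    using X(2) by (intro weak_integral_transfer test_function_partial_deriv f R) (simp add: L2_def)
  also have "\<dots> = - (\<integral>x. f x *\<^sub>R (G x $ i) \<partial>lborel)" by (rule weak_gradD[OF X(1) f])
  also have "(\<integral>x. f x *\<^sub>R (G x $ i) \<partial>lborel) = (\<integral>x. f x *\<^sub>R (G x $ i) \<partial>lebesgue)"
    by (rule weak_integral_transfer[OF f _ Gi, symmetric]) (use Gi in \<open>auto simp: measurable_completion\<close>)
  finally show "(\<integral>x. partial_deriv i f x *\<^sub>R v x \<partial>lebesgue) = - (\<integral>x. f x *\<^sub>R (G x $ i) \<partial>lebesgue)" .
qed

lemma represents_weight:
  assumes r: "represents k v w G"
  shows "(\<lambda>x. (x $ k) *\<^sub>R v x) \<in> borel_measurable lebesgue" "(\<lambda>x. (x $ k) *\<^sub>R w x) \<in> borel_measurable borel"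
    "AE x in lborel. (x $ k) *\<^sub>R v x = (x $ k) *\<^sub>R w x"
proof -
  note R = representsD[OF r] and X = energy_pairD[OF representsD(1)[OF r]]
  show "(\<lambda>x. (x $ k) *\<^sub>R v x) \<in> borel_measurable lebesgue"
    using R(2) coordinate_measurable[of k] by (intro borel_measurable_scaleR) (simp_all add: measurable_completion)
  show "(\<lambda>x. (x $ k) *\<^sub>R w x) \<in> borel_measurable borel" using X(4) by (simp add: L2_def)
  show "AE x in lborel. (x $ k) *\<^sub>R v x = (x $ k) *\<^sub>R w x" using R(3) by eventually_elim simp
qed

lemma represents_X_space:
  assumes r: "represents k v w G" shows "v \<in> X_space k"
proof -
  note R = representsD[OF r] and X = energy_pairD[OF representsD(1)[OF r]]
  have "w \<in> borel_measurable borel" "G \<in> borel_measurable borel" using X by (auto simp: L2_def)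
  then have "in_Lp 2 v" "in_Lp 2 G"
    using in_Lp_2_iff(1)[OF R(2) _ R(3)] in_Lp_2_iff(1)[of G G] X by (auto simp: measurable_completion)
  moreover have "in_Lp 2 (\<lambda>x. (x $ k) *\<^sub>R v x)" using in_Lp_2_iff(1)[OF represents_weight[OF r]] X(4) by simp
  ultimately show ?thesis using represents_has_weak_gradient[OF r] by (auto simp: X_space_def H1_def)
qed

lemma X_space_represents:
  assumes v: "v \<in> X_space k" obtains w G where "represents k v w G"
proof -
  obtain G where G: "has_weak_gradient v G" "in_Lp 2 G" and v2: "in_Lp 2 v" and kv: "in_Lp 2 (\<lambda>x. (x $ k) *\<^sub>R v x)"
    using v by (auto simp: X_space_def H1_def)
  have vm: "v \<in> borel_measurable lebesgue" and Gm: "G \<in> borel_measurable lebesgue" using v2 G(2) by (auto simp: in_Lp_def)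
  obtain w where w: "w \<in> borel_measurable borel" "AE x in lborel. v x = w x"
    using lebesgue_measurable_borel_representative[OF vm] by metis
  obtain H where H: "H \<in> borel_measurable borel" "AE x in lborel. G x = H x"
    using lebesgue_measurable_borel_representative[OF Gm] by metis
  have wL: "L2 w" using in_Lp_2_iff(1)[OF vm w] v2 by simp
  have HL: "L2 H" using in_Lp_2_iff(1)[OF Gm H] G(2) by simp
  have nm: "(\<lambda>x::complex^'a. x $ i) \<in> borel_measurable borel" for i
    by (intro borel_measurable_continuous_onI linear_continuous_on bounded_linear_vec_nth)
  have "weak_grad w H" unfolding weak_grad_def
  proof (intro conjI wL HL allI impI)
    fix f :: "real^'a \<Rightarrow> real" and i assume f: "test_function f"
    have "(\<integral>x. partial_deriv i f x *\<^sub>R w x \<partial>lborel) = (\<integral>x. partial_deriv i f x *\<^sub>R v x \<partial>lebesgue)"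
      by (rule weak_integral_transfer[OF test_function_partial_deriv[OF f] vm w, symmetric])
    also have "\<dots> = - (\<integral>x. f x *\<^sub>R (G x $ i) \<partial>lebesgue)" using G(1) f by (auto simp: has_weak_gradient_def)
    also have "(\<integral>x. f x *\<^sub>R (G x $ i) \<partial>lebesgue) = (\<integral>x. f x *\<^sub>R (H x $ i) \<partial>lborel)"
      by (rule weak_integral_transfer[OF f measurable_compose[OF Gm nm] measurable_compose[OF H(1) nm]])
         (use H(2) in \<open>auto elim!: eventually_mono\<close>)
    finally show "(\<integral>x. partial_deriv i f x *\<^sub>R w x \<partial>lborel) = - (\<integral>x. f x *\<^sub>R (H x $ i) \<partial>lborel)" .
  qed
  moreover have "L2 (\<lambda>x. (x $ k) *\<^sub>R w x)"
  proof (subst in_Lp_2_iff(1)[symmetric, of "\<lambda>x. (x $ k) *\<^sub>R v x"])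
    show "(\<lambda>x. (x $ k) *\<^sub>R v x) \<in> borel_measurable lebesgue" using kv by (simp add: in_Lp_def)
    show "(\<lambda>x. (x $ k) *\<^sub>R w x) \<in> borel_measurable borel" by (intro borel_measurable_scaleR coordinate_measurable w)
    show "AE x in lborel. (x $ k) *\<^sub>R v x = (x $ k) *\<^sub>R w x" using w(2) by eventually_elim simp
  qed (rule kv)
  ultimately have "represents k v w H" using vm w(2) by (simp add: represents_def energy_pair_def)
  then show ?thesis by (rule that)
qed

lemma represents_weak_gradient:
  assumes r: "represents k v w G"
  shows "weak_gradient v \<in> borel_measurable lebesgue" "AE x in lborel. weak_gradient v x = G x"
proof -
  have h: "has_weak_gradient v (weak_gradient v)"
    unfolding weak_gradient_def by (rule someI[of "has_weak_gradient v", OF represents_has_weak_gradient[OF r]])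
  then show "weak_gradient v \<in> borel_measurable lebesgue"
    by (intro locally_integrable_measurable) (simp add: has_weak_gradient_def)
  show "AE x in lborel. weak_gradient v x = G x" by (rule has_weak_gradient_unique[OF h represents_has_weak_gradient[OF r]])
qed

lemma represents_norms:
  assumes r: "represents k v w G"
  shows "(Lp_norm 2 (weak_gradient v))\<^sup>2 = L2_sq G" "(Lp_norm 2 v)\<^sup>2 = L2_sq w"
    "(Lp_norm 2 (\<lambda>x. (x $ k) *\<^sub>R v x))\<^sup>2 = L2_sq (\<lambda>x. (x $ k) *\<^sub>R w x)"
proof -
  note R = representsD[OF r] and X = energy_pairD[OF representsD(1)[OF r]]
  have m: "w \<in> borel_measurable borel" "G \<in> borel_measurable borel" using X by (auto simp: L2_def)
  show "(Lp_norm 2 (weak_gradient v))\<^sup>2 = L2_sq G" by (rule in_Lp_2_iff(2)[OF represents_weak_gradient(1)[OF r] m(2) represents_weak_gradient(2)[OF r]])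
  show "(Lp_norm 2 v)\<^sup>2 = L2_sq w" by (rule in_Lp_2_iff(2)[OF R(2) m(1) R(3)])
  show "(Lp_norm 2 (\<lambda>x. (x $ k) *\<^sub>R v x))\<^sup>2 = L2_sq (\<lambda>x. (x $ k) *\<^sub>R w x)" by (rule in_Lp_2_iff(2)[OF represents_weight[OF r]])
qed

lemma represents_power:
  assumes r: "represents k v w G" and q: "q > 0"
  shows "Lp_norm q v powr q = power_int q w"
proof -
  note R = representsD[OF r] and X = energy_pairD[OF representsD(1)[OF r]]
  have m: "w \<in> borel_measurable borel" using X by (auto simp: L2_def)
  have "(\<integral>x. norm (v x) powr q \<partial>lebesgue) = power_int q w" unfolding power_int_def
  proof (rule lborel_lebesgue(2))
    show "(\<lambda>x. norm (v x) powr q) \<in> borel_measurable lebesgue" using R(2) by measurable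
    show "(\<lambda>x. norm (w x) powr q) \<in> borel_measurable borel" using m by measurable
    show "AE x in lborel. norm (v x) powr q = norm (w x) powr q" using R(3) by eventually_elim simp
  qed
  then show ?thesis unfolding Lp_norm_def using q power_int_nonneg[of q w] by (simp add: powr_powr)
qed

lemma represents_action:
  assumes r: "represents k v w G" and p: "p > 0"
  shows "action k p \<omega> v = energy_form k \<omega> w G / 2 - power_int (p + 1) w / (p + 1)"
    "nehari k p \<omega> v = energy_form k \<omega> w G - power_int (p + 1) w"
    "X_norm k v = sqrt (energy_form k 1 w G)"
  unfolding action_def nehari_def X_norm_def energy_form_def represents_norms[OF r]
  using represents_power[OF r, of "p + 1"] p by (simp_all add: algebra_simps add_divide_distrib)

lemma represents_ae_zero:
  assumes r: "represents k v w G" and q: "integrable_power q w" "q > 0"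
  shows "ae_zero v \<longleftrightarrow> power_int q w = 0"
proof -
  note R = representsD[OF r]
  have "ae_zero v \<longleftrightarrow> (AE x in lborel. v x = 0)" unfolding ae_zero_def by (rule AE_completion_iff)
  also have "\<dots> \<longleftrightarrow> (AE x in lborel. w x = 0)" using R(3) by (auto elim: eventually_elim2)
  also have "\<dots> \<longleftrightarrow> (AE x in lborel. norm (w x) powr q = 0)" by simp
  also have "\<dots> \<longleftrightarrow> power_int q w = 0" unfolding power_int_def using q by (subst integral_nonneg_eq_0_iff_AE) auto
  finally show ?thesis .
qed

lemma represents_lincomb:
  assumes r: "represents k v w G" and s: "represents k h u H"
  shows "represents k (\<lambda>x. a *\<^sub>R v x + b *\<^sub>R h x) (\<lambda>x. a *\<^sub>R w x + b *\<^sub>R u x) (\<lambda>x. a *\<^sub>R G x + b *\<^sub>R H x)"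
  unfolding represents_def
proof (intro conjI energy_pair_lincomb representsD(1)[OF r] representsD(1)[OF s])
  show "(\<lambda>x. a *\<^sub>R v x + b *\<^sub>R h x) \<in> borel_measurable lebesgue"
    using representsD(2)[OF r] representsD(2)[OF s] by simp
  show "AE x in lborel. a *\<^sub>R v x + b *\<^sub>R h x = a *\<^sub>R w x + b *\<^sub>R u x"
    using representsD(3)[OF r] representsD(3)[OF s] by eventually_elim simp
qed

lemma represents_scaleR: "represents k v w G \<Longrightarrow> represents k (\<lambda>x. a *\<^sub>R v x) (\<lambda>x. a *\<^sub>R w x) (\<lambda>x. a *\<^sub>R G x)"
  using represents_lincomb[of k v w G v w G a 0] by simp

lemma represents_add: "represents k v w G \<Longrightarrow> represents k h u H \<Longrightarrow>
    represents k (\<lambda>x. v x + h x) (\<lambda>x. w x + u x) (\<lambda>x. G x + H x)"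
  using represents_lincomb[of k v w G h u H 1 1] by simp

section \<open>Minimisers are critical points\<close>

lemma powr_pred:
  fixes s q :: real
  assumes "s > 0" shows "s powr (q - 2) * s = s powr (q - 1)" "s powr (q - 1) * s = s powr q"
  using assms by (simp_all add: powr_diff power2_eq_square)

lemma power_tangent_line:
  assumes q: "q \<ge> 1" and s: "s > 0" and t: "t \<ge> 0"
  shows "s powr q + q * s powr (q - 1) * (t - s) \<le> t powr (q::real)"
proof (cases "t = 0")
  case True
  have "q * s powr (q - 1) * (0 - s) = - (q * (s powr (q - 1) * s))" by simp
  also have "\<dots> = - (q * s powr q)" by (simp only: powr_pred(2)[OF s])
  finally have "q * s powr (q - 1) * (0 - s) = - (q * s powr q)" .
  moreover have "s powr q \<le> q * s powr q" using mult_right_mono[OF q, of "s powr q"] by simp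
  moreover have "(0::real) powr q = 0" by simp
  ultimately show ?thesis unfolding True by linarith
next
  case False
  have "q * s powr (q - 1) * (t - s) \<le> t powr q - s powr q"
  proof (rule convex_on_imp_above_tangent[of "{0<..}" "\<lambda>x. x powr q"])
    show "convex_on {0<..} (\<lambda>x. x powr q)" by (rule powr_convex[OF q])
    show "s \<in> interior {0<..}" using s by (simp add: interior_open)
    show "((\<lambda>x. x powr q) has_field_derivative q * s powr (q - 1)) (at s within {0<..})"
      using s by (auto intro!: derivative_eq_intros simp: powr_diff field_simps)
  qed (use t False in auto)
  then show ?thesis by simp
qed

text \<open>Convexity of \<open>|\<cdot>|\<^sup>q\<close>, from the tangent line of the scalar power and the Cauchy-Schwarz inequality.\<close>

lemma norm_power_tangent:
  fixes a h :: "'b::real_inner"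
  assumes q: "q \<ge> 1"
  shows "norm a powr q + q * (norm a powr (q - 2) * (a \<bullet> h)) \<le> norm (a + h) powr q"
proof (cases "a = 0")
  case False
  let ?s = "norm a"
  have s: "?s > 0" using False by simp
  have "(a + h) \<bullet> a \<le> norm (a + h) * ?s" by (rule norm_cauchy_schwarz)
  then have "(a \<bullet> h) / ?s \<le> norm (a + h) - ?s"
    using s by (simp add: inner_add_left inner_commute[of h a] power2_norm_eq_inner[symmetric] power2_eq_square field_simps)
  then have "q * ?s powr (q - 1) * ((a \<bullet> h) / ?s) \<le> q * ?s powr (q - 1) * (norm (a + h) - ?s)"
    using q by (intro mult_left_mono) auto
  moreover have "q * ?s powr (q - 1) * ((a \<bullet> h) / ?s) = q * (?s powr (q - 2) * (a \<bullet> h))"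
  proof -
    have "?s powr (q - 1) = ?s powr (q - 2) * ?s" by (rule powr_pred(1)[OF s, symmetric])
    then show ?thesis using s by simp
  qed
  ultimately show ?thesis using power_tangent_line[OF q s norm_ge_zero[of "a + h"]] by linarith
qed simp

text \<open>The derivative of the power integral at \<open>v\<close> in direction \<open>h\<close>, divided by \<open>q\<close>.\<close>

definition power_dir :: "real \<Rightarrow> (real^'n::finite \<Rightarrow> complex) \<Rightarrow> (real^'n \<Rightarrow> complex) \<Rightarrow> real" where
  "power_dir q v h = (\<integral>x. norm (v x) powr (q - 2) * (v x \<bullet> h x) \<partial>lborel)"

lemma power_dir_scaleR: "power_dir q v (\<lambda>x. t *\<^sub>R h x) = t * power_dir q v h"
  unfolding power_dir_def by (simp add: mult.left_commute)

lemma power_int_convex: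
  assumes q: "q > 1" and m: "v \<in> borel_measurable borel" "h \<in> borel_measurable borel"
    and i: "integrable_power q v" "integrable_power q h" "integrable_power q (\<lambda>x. v x + h x)"
  shows "power_int q v + q * power_dir q v h \<le> power_int q (\<lambda>x. v x + h x)"
proof -
  note [measurable] = m
  have iN: "integrable lborel (\<lambda>x. norm (v x) powr (q - 2) * (v x \<bullet> h x))"
  proof (rule Bochner_Integration.integrable_bound[OF Bochner_Integration.integrable_add[OF i(1) i(2)]])
    show "AE x in lborel. norm (norm (v x) powr (q - 2) * (v x \<bullet> h x)) \<le> norm (norm (v x) powr q + norm (h x) powr q)"
    proof (rule AE_I2)
      fix x
      have "norm (v x) powr (q - 2) * \<bar>v x \<bullet> h x\<bar> \<le> norm (v x) powr q + norm (h x) powr q"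
      proof (cases "v x = 0")
        case False
        then have s: "norm (v x) > 0" by simp
        have "norm (v x) powr (q - 2) * \<bar>v x \<bullet> h x\<bar> \<le> norm (v x) powr (q - 2) * (norm (v x) * norm (h x))"
          by (intro mult_left_mono Cauchy_Schwarz_ineq2) auto
        also have "\<dots> = norm (v x) powr (q - 1) * norm (h x)"
          by (simp only: mult.assoc[symmetric] powr_pred(1)[OF s])
        also have "\<dots> \<le> max (norm (v x)) (norm (h x)) powr (q - 1) * max (norm (v x)) (norm (h x))"
          using q by (intro mult_mono powr_mono2) auto
        also have "\<dots> = max (norm (v x)) (norm (h x)) powr q"
        proof -
          have "max (norm (v x)) (norm (h x)) > 0" by (rule less_le_trans[OF s max.cobounded1])
          then show ?thesis by (rule powr_pred(2))
        qed
        also have "\<dots> \<le> norm (v x) powr q + norm (h x) powr q" by (simp add: max_def)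
        finally show ?thesis .
      qed simp
      then show "norm (norm (v x) powr (q - 2) * (v x \<bullet> h x)) \<le> norm (norm (v x) powr q + norm (h x) powr q)"
        by (simp add: abs_mult)
    qed
  qed measurable
  have "power_int q v + q * power_dir q v h = (\<integral>x. norm (v x) powr q + q * (norm (v x) powr (q - 2) * (v x \<bullet> h x)) \<partial>lborel)"
    unfolding power_int_def power_dir_def using i(1) iN by simp
  also have "\<dots> \<le> power_int q (\<lambda>x. v x + h x)"
    unfolding power_int_def using q by (intro integral_mono Bochner_Integration.integrable_add integrable_mult_right i iN norm_power_tangent) auto
  finally show ?thesis .
qed

lemma L2_inner_scaleR_right: "L2_inner f (\<lambda>x. t *\<^sub>R g x) = t * L2_inner f g"
  by (simp add: L2_inner_def)

text \<open>The action \<open>S = Q/2 - I/q\<close> has derivative zero at a minimiser, with no Taylor expansion of \<open>I\<close>. From below,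
  \<open>I \<le> (Q/m)\<^sup>q\<^sup>/\<^sup>2\<close> gives \<open>S \<ge> \<psi>(Q)\<close> with equality at \<open>v\<close>, and \<open>\<psi>\<close> has derivative zero at \<open>Q(v)\<close>. From above, convexity of
  \<open>I\<close> gives \<open>S(v+h) \<le> S(v) + L(h) + Q(h)/2\<close> with \<open>L\<close> homogeneous in \<open>h\<close>. Both bounds are differentiable along
  every line and agree at \<open>h = 0\<close>, hence \<open>L = 0\<close>, and the two bounds enclose \<open>S\<close>.\<close>

lemma minimiser_action_estimate:
  fixes k :: "'n::finite"
  assumes q: "q > 2" and m: "m > 0"
    and int: "\<And>v G. energy_pair k v G \<Longrightarrow> integrable_power q v"
    and mineq: "\<And>v G. energy_pair k v G \<Longrightarrow> m * power_int q v powr (2 / q) \<le> energy_form k \<omega> v G"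
    and X: "energy_pair k v G" and Qy: "energy_form k \<omega> v G = m powr (q / (q - 2))" and Iy: "power_int q v = m powr (q / (q - 2))"
    and e: "\<epsilon> > 0"
  shows "\<exists>\<delta>>0. \<forall>h H. energy_pair k h H \<longrightarrow> sqrt (energy_form k 1 h H) < \<delta> \<longrightarrow>
    \<bar>(energy_form k \<omega> (\<lambda>x. v x + h x) (\<lambda>x. G x + H x) / 2 - power_int q (\<lambda>x. v x + h x) / q) - (energy_form k \<omega> v G / 2 - power_int q v / q)\<bar>
      \<le> \<epsilon> * sqrt (energy_form k 1 h H)"
proof -
  define y0 where "y0 = m powr (q / (q - 2))"
  have y0: "y0 > 0" using m by (simp add: y0_def)
  define \<psi> where "\<psi> y = y / 2 - (y / m) powr (q / 2) / q" for y
  have ym: "y0 / m = m powr (2 / (q - 2))"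
  proof -
    have "q / (q - 2) - 1 = 2 / (q - 2)" using q by (simp add: field_simps)
    moreover have "y0 / m = m powr (q / (q - 2) - 1)" using m by (simp add: y0_def powr_diff)
    ultimately show ?thesis by simp
  qed
  have ym1: "(y0 / m) powr (q / 2 - 1) = m"
  proof -
    have "2 / (q - 2) * (q / 2 - 1) = 1" using q by (simp add: field_simps)
    then show ?thesis unfolding ym powr_powr using m by simp
  qed
  have ymq: "(y0 / m) powr (q / 2) = y0"
  proof -
    have "2 / (q - 2) * (q / 2) = q / (q - 2)" using q by (simp add: divide_simps)
    then have "(y0 / m) powr (q / 2) = m powr (q / (q - 2))" by (simp only: ym powr_powr)
    then show ?thesis by (simp only: y0_def)
  qed
  have \<psi>0: "\<psi> y0 = energy_form k \<omega> v G / 2 - power_int q v / q"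
    unfolding \<psi>_def ymq Qy Iy by (simp add: y0_def)
  have d\<psi>: "(\<psi> has_real_derivative 0) (at y0)"
  proof -
    have "(\<psi> has_real_derivative (1 / 2 - (q / 2 * (y0 / m) powr (q / 2 - 1) * (1 / m)) / q)) (at y0)"
      unfolding \<psi>_def[abs_def] using y0 m q
      by (auto intro!: derivative_eq_intros simp: powr_diff) 
    then show ?thesis using m q by (simp add: ym1)
  qed
  have low: "\<psi> (energy_form k \<omega> w W) \<le> energy_form k \<omega> w W / 2 - power_int q w / q" if w: "energy_pair k w W" for w W
  proof -
    have "power_int q w powr (2 / q) \<le> energy_form k \<omega> w W / m" using mineq[OF w] m by (simp add: pos_le_divide_eq mult.commute)
    then have "(power_int q w powr (2 / q)) powr (q / 2) \<le> (energy_form k \<omega> w W / m) powr (q / 2)" using q by (intro powr_mono2) auto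
    then have "power_int q w \<le> (energy_form k \<omega> w W / m) powr (q / 2)" using q power_int_nonneg[of q w] by (simp add: powr_powr)
    then have "power_int q w / q \<le> (energy_form k \<omega> w W / m) powr (q / 2) / q" using q by (intro divide_right_mono) auto
    then show ?thesis by (simp add: \<psi>_def)
  qed
  have Qpos: "energy_form k \<omega> w W \<ge> 0" if "energy_pair k w W" for w W
  proof -
    have "0 \<le> m * power_int q w powr (2 / q)" using m by simp
    then show ?thesis using mineq[OF that] by linarith
  qed
  have Bm: "w \<in> borel_measurable borel" if "energy_pair k w W" for w W using energy_pairD(2)[OF that] by (simp add: L2_def)
  have up: "energy_form k \<omega> (\<lambda>x. v x + h x) (\<lambda>x. G x + H x) / 2 - power_int q (\<lambda>x. v x + h x) / q
      \<le> \<psi> y0 + (energy_bilin k \<omega> v G h H - power_dir q v h) + energy_form k \<omega> h H / 2" if h: "energy_pair k h H" for h H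
  proof -
    have "power_int q v + q * power_dir q v h \<le> power_int q (\<lambda>x. v x + h x)"
      by (rule power_int_convex) (use q in \<open>auto intro: Bm[OF X] Bm[OF h] int[OF X] int[OF h] int[OF energy_pair_add[OF X h]]\<close>)
    then have "(power_int q v + q * power_dir q v h) / q \<le> power_int q (\<lambda>x. v x + h x) / q" using q by (intro divide_right_mono) auto
    then have "power_int q v / q + power_dir q v h \<le> power_int q (\<lambda>x. v x + h x) / q" using q by (simp add: add_divide_distrib)
    then show ?thesis unfolding \<psi>0 energy_form_add[OF X h] by (simp add: add_divide_distrib)
  qed
  have BN: "energy_bilin k \<omega> v G h H - power_dir q v h = 0" if h: "energy_pair k h H" for h H
  proof -
    let ?B = "energy_bilin k \<omega> v G h H" and ?N = "power_dir q v h" and ?Q = "energy_form k \<omega> h H"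
    \<comment> \<open>The difference of the upper and the lower bound on the line through \<open>v\<close> in direction \<open>h\<close>; it is minimal at \<open>t = 0\<close>.\<close>
    define D where "D t = t * (?B - ?N) + t\<^sup>2 * ?Q / 2 + \<psi> y0 - \<psi> (y0 + 2 * t * ?B + t\<^sup>2 * ?Q)" for t
    have Dpos: "D t \<ge> 0" for t
    proof -
      have th: "energy_pair k (\<lambda>x. t *\<^sub>R h x) (\<lambda>x. t *\<^sub>R H x)" by (rule energy_pair_scaleR[OF h])
      have Bt: "energy_bilin k \<omega> v G (\<lambda>x. t *\<^sub>R h x) (\<lambda>x. t *\<^sub>R H x) = t * ?B"
      proof -
        have "(\<lambda>x. (x $ k) *\<^sub>R (t *\<^sub>R h x)) = (\<lambda>x. t *\<^sub>R ((x $ k) *\<^sub>R h x))" by (simp add: mult.commute)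
        then show ?thesis unfolding energy_bilin_def by (simp only: L2_inner_scaleR_right distrib_left mult.left_commute[of t])
      qed
      have Qt: "energy_form k \<omega> (\<lambda>x. v x + t *\<^sub>R h x) (\<lambda>x. G x + t *\<^sub>R H x) = y0 + 2 * t * ?B + t\<^sup>2 * ?Q"
        unfolding energy_form_add[OF X th] Bt energy_form_scaleR[OF h] Qy y0_def by simp
      have "\<psi> (y0 + 2 * t * ?B + t\<^sup>2 * ?Q) \<le> \<psi> y0 + (t * ?B - t * ?N) + t\<^sup>2 * ?Q / 2"
        using low[OF energy_pair_add[OF X th]] up[OF th] unfolding Qt Bt power_dir_scaleR energy_form_scaleR[OF h] by linarith
      then show ?thesis unfolding D_def by (simp add: right_diff_distrib)
    qed
    have D0: "D 0 = 0" by (simp add: D_def)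
    have dq: "((\<lambda>t. y0 + 2 * t * ?B + t\<^sup>2 * ?Q) has_real_derivative 2 * ?B) (at 0)"
      by (auto intro!: derivative_eq_intros)
    have "((\<lambda>t. \<psi> (y0 + 2 * t * ?B + t\<^sup>2 * ?Q)) has_real_derivative 0 * (2 * ?B)) (at 0)"
      by (rule DERIV_chain2[OF _ dq]) (use d\<psi> in simp)
    then have "(D has_real_derivative (?B - ?N)) (at 0)"
      unfolding D_def[abs_def] by (auto intro!: derivative_eq_intros)
    then show ?thesis by (rule DERIV_local_min[of D _ 0 1]) (use Dpos D0 in auto)
  qed
  define a where "a = 1 + \<bar>\<omega>\<bar>"
  have a: "a > 0" by (simp add: a_def add_pos_nonneg)
  define C where "C = 2 * sqrt y0 * sqrt a + a"
  have C: "C > 0" using y0 a by (simp add: C_def add_nonneg_pos)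
  have "\<epsilon> / C > 0" using e C by simp
  then obtain \<eta> where eta: "\<eta> > 0" "\<And>y. \<bar>y - y0\<bar> < \<eta> \<Longrightarrow> \<bar>\<psi> y - \<psi> y0\<bar> \<le> \<epsilon> / C * \<bar>y - y0\<bar>"
    using d\<psi> unfolding has_field_derivative_def has_derivative_at_alt by (auto simp: real_norm_def)
  define \<delta> where "\<delta> = min 1 (min (\<eta> / C) (\<epsilon> / a))"
  have del: "\<delta> > 0" using eta C e a by (simp add: \<delta>_def)
  show ?thesis
  proof (intro exI[of _ \<delta>] conjI allI impI del)
    fix h H assume h: "energy_pair k h H" and small: "sqrt (energy_form k 1 h H) < \<delta>"
    define n where "n = sqrt (energy_form k 1 h H)"
    have n: "0 \<le> n" "n < 1" "n < \<eta> / C" "n < \<epsilon> / a" using small by (auto simp: n_def \<delta>_def energy_form_1_nonneg)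
    have nn: "n * n = energy_form k 1 h H" by (simp add: n_def energy_form_1_nonneg)
    have Qh: "energy_form k \<omega> h H \<le> a * (n * n)" unfolding a_def nn by (rule energy_form_le_form_1)
    have nn1: "n * n \<le> n" using n by (simp add: mult_left_le_one_le)
    let ?A = "energy_form k \<omega> (\<lambda>x. v x + h x) (\<lambda>x. G x + H x) / 2 - power_int q (\<lambda>x. v x + h x) / q"
    have "?A - \<psi> y0 \<le> energy_form k \<omega> h H / 2" using up[OF h, unfolded BN[OF h]] by linarith
    also have "\<dots> \<le> a * (n * n) / 2" using Qh by simp
    also have "\<dots> \<le> \<epsilon> * n"
    proof -
      have "a * n \<le> \<epsilon>" using n a by (simp add: field_simps)
      then have "(a * n) * n \<le> \<epsilon> * n" using n by (intro mult_right_mono) auto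
      moreover have "(a * n) * n \<ge> 0" using a n by simp
      ultimately show ?thesis by (simp add: mult.assoc)
    qed
    finally have hi: "?A - \<psi> y0 \<le> \<epsilon> * n" .
    let ?y = "energy_form k \<omega> (\<lambda>x. v x + h x) (\<lambda>x. G x + H x)"
    have "\<bar>?y - y0\<bar> \<le> C * n"
    proof -
      have "(energy_bilin k \<omega> v G h H)\<^sup>2 \<le> energy_form k \<omega> v G * energy_form k \<omega> h H"
        by (rule quadratic_form_Cauchy_Schwarz) (unfold energy_form_lincomb[OF X h, symmetric], rule Qpos[OF energy_pair_lincomb[OF X h]])
      also have "\<dots> \<le> y0 * (a * (n * n))" unfolding Qy y0_def[symmetric] using Qh y0 by (intro mult_left_mono) auto
      also have "\<dots> = (sqrt y0 * sqrt a * n)\<^sup>2" using y0 a by (simp add: power_mult_distrib) (simp add: power2_eq_square)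
      finally have "\<bar>energy_bilin k \<omega> v G h H\<bar> \<le> sqrt y0 * sqrt a * n"
        using y0 a n by (subst (asm) abs_le_square_iff[symmetric]) (simp add: abs_mult)
      moreover have "energy_form k \<omega> h H \<le> a * n" using Qh mult_left_mono[OF nn1, of a] a by linarith
      moreover have "?y - y0 = 2 * energy_bilin k \<omega> v G h H + energy_form k \<omega> h H" unfolding energy_form_add[OF X h] Qy y0_def by simp
      ultimately show ?thesis using Qpos[OF h] by (simp add: C_def distrib_right abs_le_iff)
    qed
    moreover have "C * n < \<eta>" using n C by (simp add: field_simps)
    ultimately have "\<bar>\<psi> ?y - \<psi> y0\<bar> \<le> \<epsilon> / C * \<bar>?y - y0\<bar>" by (intro eta(2)) linarith
    also have "\<dots> \<le> \<epsilon> / C * (C * n)" using \<open>\<bar>?y - y0\<bar> \<le> C * n\<close> e C by (intro mult_left_mono) auto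
    also have "\<dots> = \<epsilon> * n" using C by simp
    finally have "\<psi> y0 - \<epsilon> * n \<le> \<psi> ?y" by linarith
    also have "\<dots> \<le> ?A" by (rule low[OF energy_pair_add[OF X h]])
    finally have "\<psi> y0 - \<epsilon> * n \<le> ?A" .
    with hi show "\<bar>?A - (energy_form k \<omega> v G / 2 - power_int q v / q)\<bar> \<le> \<epsilon> * sqrt (energy_form k 1 h H)"
      unfolding \<psi>0[symmetric] n_def[symmetric] by (simp add: abs_le_iff)
  qed
qed

section \<open>Ground states\<close>

text \<open>The chain rule along the ray through \<open>v\<close>; together with the next lemma it shows that critical points satisfy
  the Nehari identity.\<close>

lemma critical_point_derivative_zero:
  assumes v: "v \<in> X_space k" and crit: "X_has_derivative k F (\<lambda>_. 0) v"
  shows "((\<lambda>\<mu>. F (\<lambda>x. \<mu> *\<^sub>R v x)) has_real_derivative 0) (at 1)"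
proof -
  obtain w G where r: "represents k v w G" using X_space_represents[OF v] by metis
  have sc: "(\<lambda>x. c *\<^sub>R v x) \<in> X_space k" "X_norm k (\<lambda>x. c *\<^sub>R v x) = \<bar>c\<bar> * X_norm k v" for c
  proof -
    note rc = represents_scaleR[OF r, of c]
    show "(\<lambda>x. c *\<^sub>R v x) \<in> X_space k" by (rule represents_X_space[OF rc])
    have "X_norm k (\<lambda>x. c *\<^sub>R v x) = sqrt (energy_form k 1 (\<lambda>x. c *\<^sub>R w x) (\<lambda>x. c *\<^sub>R G x))" by (rule represents_action(3)[OF rc, of 1]) simp
    also have "\<dots> = \<bar>c\<bar> * sqrt (energy_form k 1 w G)" unfolding energy_form_scaleR[OF representsD(1)[OF r]] by (simp add: real_sqrt_mult)
    also have "sqrt (energy_form k 1 w G) = X_norm k v" by (rule represents_action(3)[OF r, of 1, symmetric]) simp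
    finally show "X_norm k (\<lambda>x. c *\<^sub>R v x) = \<bar>c\<bar> * X_norm k v" .
  qed
  have n0: "X_norm k v \<ge> 0" unfolding X_norm_def by simp
  show ?thesis unfolding has_field_derivative_def has_derivative_at_alt
  proof (intro conjI allI impI)
    show "bounded_linear ((*) (0::real))" by (rule bounded_linear_mult_right)
    fix e :: real assume e: "e > 0"
    define \<epsilon> where "\<epsilon> = e / (X_norm k v + 1)"
    have ep: "\<epsilon> > 0" using e n0 by (simp add: \<epsilon>_def)
    obtain \<delta> where del: "\<delta> > 0" and D: "\<And>h. h \<in> X_space k \<Longrightarrow> X_norm k h < \<delta> \<Longrightarrow>
        \<bar>F (\<lambda>x. v x + h x) - F v - 0\<bar> \<le> \<epsilon> * X_norm k h"
      using crit ep unfolding X_has_derivative_def by metis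
    show "\<exists>d>0. \<forall>y. norm (y - 1) < d \<longrightarrow>
        norm (F (\<lambda>x. y *\<^sub>R v x) - F (\<lambda>x. 1 *\<^sub>R v x) - 0 * (y - 1)) \<le> e * norm (y - 1)"
    proof (intro exI[of _ "\<delta> / (X_norm k v + 1)"] conjI allI impI)
      show "\<delta> / (X_norm k v + 1) > 0" using del n0 by simp
      fix y :: real assume y: "norm (y - 1) < \<delta> / (X_norm k v + 1)"
      have "\<bar>y - 1\<bar> * X_norm k v \<le> \<bar>y - 1\<bar> * (X_norm k v + 1)" by (simp add: algebra_simps)
      also have "\<dots> < \<delta>" using y n0 by (simp add: pos_less_divide_eq)
      finally have sm: "X_norm k (\<lambda>x. (y - 1) *\<^sub>R v x) < \<delta>" unfolding sc(2) .
      have eq: "(\<lambda>x. v x + (y - 1) *\<^sub>R v x) = (\<lambda>x. y *\<^sub>R v x)" by (simp add: algebra_simps)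
      have "\<bar>F (\<lambda>x. y *\<^sub>R v x) - F v\<bar> \<le> \<epsilon> * (\<bar>y - 1\<bar> * X_norm k v)"
        using D[OF sc(1) sm] unfolding eq sc(2) by simp
      also have "\<dots> \<le> \<epsilon> * (\<bar>y - 1\<bar> * (X_norm k v + 1))" using ep by (intro mult_left_mono) (auto simp: algebra_simps)
      also have "\<dots> = e * \<bar>y - 1\<bar>" using n0 by (simp add: \<epsilon>_def)
      finally show "norm (F (\<lambda>x. y *\<^sub>R v x) - F (\<lambda>x. 1 *\<^sub>R v x) - 0 * (y - 1)) \<le> e * norm (y - 1)" by simp
    qed
  qed
qed

lemma action_scale_derivative:
  assumes v: "v \<in> X_space k" and p: "p > 0"
  shows "((\<lambda>\<mu>. action k p \<omega> (\<lambda>x. \<mu> *\<^sub>R v x)) has_real_derivative nehari k p \<omega> v) (at 1)"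
proof -
  obtain w G where r: "represents k v w G" using X_space_represents[OF v] by metis
  have "action k p \<omega> (\<lambda>x. \<mu> *\<^sub>R v x) = \<mu>\<^sup>2 * energy_form k \<omega> w G / 2 - \<bar>\<mu>\<bar> powr (p + 1) * power_int (p + 1) w / (p + 1)" for \<mu>
    unfolding represents_action(1)[OF represents_scaleR[OF r] p] energy_form_scaleR[OF representsD(1)[OF r]] power_int_scaleR by simp
  moreover have "((\<lambda>\<mu>. \<mu>\<^sup>2 * energy_form k \<omega> w G / 2 - \<bar>\<mu>\<bar> powr (p + 1) * power_int (p + 1) w / (p + 1)) has_real_derivative
      energy_form k \<omega> w G - power_int (p + 1) w) (at 1)"
  proof -
    have "((\<lambda>\<mu>. \<mu>\<^sup>2 * energy_form k \<omega> w G / 2 - \<mu> powr (p + 1) * power_int (p + 1) w / (p + 1)) has_real_derivative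
      energy_form k \<omega> w G - power_int (p + 1) w) (at 1)"
      using p by (auto intro!: derivative_eq_intros)
    moreover have "\<forall>\<^sub>F \<mu> in nhds (1::real). \<mu>\<^sup>2 * energy_form k \<omega> w G / 2 - \<mu> powr (p + 1) * power_int (p + 1) w / (p + 1)
        = \<mu>\<^sup>2 * energy_form k \<omega> w G / 2 - \<bar>\<mu>\<bar> powr (p + 1) * power_int (p + 1) w / (p + 1)"
      by (rule eventually_mono[OF eventually_nhds_in_open[of "{0<..}"]]) auto
    ultimately show ?thesis by (rule DERIV_cong_ev[OF refl _ refl, THEN iffD1, rotated])
  qed
  ultimately show ?thesis by (simp add: represents_action(2)[OF r p])
qed

theorem proposition2:
  fixes k :: "'n::finite" and p \<omega> :: real
  assumes "CARD('n) \<ge> 2"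
    and "1 < p"
    and "CARD('n) > 2 \<Longrightarrow> p < 1 + 4 / (real CARD('n) - 2)"
    and "-1 < \<omega>"
  shows "(\<forall>v \<in> X_space k.
            ((\<lambda>\<mu>. action k p \<omega> (\<lambda>x. \<mu> *\<^sub>R v x)) has_real_derivative nehari k p \<omega> v) (at 1))
       \<and> ground_states k p \<omega> \<noteq> {}
       \<and> ground_states k p \<omega> =
           {v \<in> X_space k. action k p \<omega> v = least_action k p \<omega>
                         \<and> nehari k p \<omega> v = 0 \<and> \<not> ae_zero v}"
proof -
  let ?N = "real CARD('n)"
  define q where "q = p + 1"
  have p: "p > 0" and q: "q > 2" using assms(2) by (auto simp: q_def)
  have sub: "q < 2 + 2 * q / ?N"
  proof (cases "CARD('n) = 2")
    case True then show ?thesis using q by simp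
  next
    case False
    then have N: "CARD('n) > 2" using assms(1) by simp
    then have "q < 2 + 4 / (?N - 2)" using assms(3) by (simp add: q_def)
    also have "\<dots> = 2 * ?N / (?N - 2)" using N by (simp add: field_simps)
    finally have "q * (?N - 2) < 2 * ?N" using N by (simp add: pos_less_divide_eq)
    then show ?thesis using N by (simp add: field_simps)
  qed
  have S: "sobolev_bound TYPE('n) q" by (rule sobolev_bound_subcritical[OF assms(1)]) (use q sub in auto)
  have int: "integrable_power q v" if "energy_pair k v G" for v G
    by (rule subcritical_integrable[OF S _ energy_pairD(1)[OF that]]) (use q in simp)
  obtain u F m where m: "m > 0" and uX: "energy_pair k u F" and uI: "power_int q u = 1" and uQ: "energy_form k \<omega> u F = m"
    and mineq: "\<And>v G. energy_pair k v G \<Longrightarrow> m * power_int q v powr (2 / q) \<le> energy_form k \<omega> v G"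
    by (rule exists_minimiser[OF assms(1) q sub assms(4), where k=k]) (rule that, assumption, assumption, assumption, assumption, blast)
  define y0 where "y0 = m powr (q / (q - 2))"
  have y0: "y0 > 0" using m by (simp add: y0_def)
  define c where "c = 1 / 2 - 1 / q"
  have c: "c > 0" using q by (simp add: c_def field_simps)
  note act = represents_action[OF _ p, folded q_def]
  have neh: "\<exists>w G. represents k v w G \<and> energy_form k \<omega> w G = power_int q w \<and> action k p \<omega> v = c * power_int q w \<and> y0 \<le> power_int q w"
    if v: "v \<in> X_space k" "nehari k p \<omega> v = 0" "\<not> ae_zero v" for v
  proof -
    obtain w G where r: "represents k v w G" using X_space_represents[OF v(1)] by metis
    note X = representsD(1)[OF r]
    have QI: "energy_form k \<omega> w G = power_int q w" using act(2)[OF r] v(2) by simp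
    have "power_int q w \<noteq> 0" using represents_ae_zero[OF r int[OF X]] v(3) q by simp
    then have pos: "power_int q w > 0" using power_int_nonneg[of q w] by linarith
    have "m * power_int q w powr (2 / q) \<le> power_int q w" using mineq[OF X] QI by simp
    also have "power_int q w = power_int q w powr (1 - 2 / q) * power_int q w powr (2 / q)" using pos by (simp add: powr_add[symmetric])
    finally have "m \<le> power_int q w powr (1 - 2 / q)" using pos by simp
    then have "y0 \<le> (power_int q w powr (1 - 2 / q)) powr (q / (q - 2))" unfolding y0_def using m q by (intro powr_mono2) auto
    also have "(1 - 2 / q) * (q / (q - 2)) = 1" using q by (simp add: field_simps)
    then have "(power_int q w powr (1 - 2 / q)) powr (q / (q - 2)) = power_int q w" using pos by (simp only: powr_powr) simp
    finally have "y0 \<le> power_int q w" .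
    moreover have "action k p \<omega> v = c * power_int q w" unfolding act(1)[OF r] QI c_def by (simp add: left_diff_distrib)
    ultimately show ?thesis using r QI by blast
  qed
  \<comment> \<open>Scaling the minimiser by \<open>t\<close> solves \<open>t\<^sup>2 m = t\<^sup>q\<close>, which puts it on the Nehari set.\<close>
  define t where "t = m powr (1 / (q - 2))"
  define e where "e = (\<lambda>x. t *\<^sub>R u x)"
  have er: "represents k e e (\<lambda>x. t *\<^sub>R F x)" unfolding e_def by (rule represents_self[OF energy_pair_scaleR[OF uX]])
  have eI: "power_int q e = y0" unfolding e_def power_int_scaleR uI using m by (simp add: t_def y0_def powr_powr)
  have eQ: "energy_form k \<omega> e (\<lambda>x. t *\<^sub>R F x) = y0"
  proof -
    have "t\<^sup>2 * m = m powr (1 / (q - 2) * 2 + 1)"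
      using m by (simp add: t_def powr_add powr_powr flip: powr_numeral)
    also have "1 / (q - 2) * 2 + 1 = q / (q - 2)" using q by (simp add: field_simps)
    finally show ?thesis unfolding e_def energy_form_scaleR[OF uX] uQ y0_def .
  qed
  have e: "e \<in> X_space k" "nehari k p \<omega> e = 0" "\<not> ae_zero e" "action k p \<omega> e = c * y0"
    using represents_X_space[OF er] act(1,2)[OF er] represents_ae_zero[OF er int[OF representsD(1)[OF er]]] eI eQ q y0
    by (auto simp: c_def left_diff_distrib)
  have la: "least_action k p \<omega> = c * y0"
    unfolding least_action_def
  proof (rule cInf_eq_minimum)
    show "c * y0 \<in> {action k p \<omega> v |v. v \<in> X_space k \<and> nehari k p \<omega> v = 0 \<and> \<not> ae_zero v}"
      using e by (auto intro!: exI[of _ e])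
    fix x assume "x \<in> {action k p \<omega> v |v. v \<in> X_space k \<and> nehari k p \<omega> v = 0 \<and> \<not> ae_zero v}"
    then show "c * y0 \<le> x" using neh c by (auto dest!: neh)
  qed
  define R where "R = {v \<in> X_space k. action k p \<omega> v = least_action k p \<omega> \<and> nehari k p \<omega> v = 0 \<and> \<not> ae_zero v}"
  have eR: "e \<in> R" using e la by (simp add: R_def)
  have R_crit: "v \<in> critical_points k p \<omega>" if v: "v \<in> R" for v
  proof -
    have vX: "v \<in> X_space k" "\<not> ae_zero v" using v by (auto simp: R_def)
    obtain w G where r: "represents k v w G" and QI: "energy_form k \<omega> w G = power_int q w" and A: "action k p \<omega> v = c * power_int q w"
      using neh[of v] v by (auto simp: R_def)
    have I: "power_int q w = y0" using A v la c by (simp add: R_def)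
    note X = representsD(1)[OF r]
    have "X_has_derivative k (action k p \<omega>) (\<lambda>_. 0) v"
      unfolding X_has_derivative_def
    proof (intro conjI allI impI)
      show "X_bounded_linear k (\<lambda>_. 0)" unfolding X_bounded_linear_def by (auto intro!: exI[of _ 0])
      fix \<epsilon> :: real assume "\<epsilon> > 0"
      have "\<exists>\<delta>>0. \<forall>h H. energy_pair k h H \<longrightarrow> sqrt (energy_form k 1 h H) < \<delta> \<longrightarrow>
          \<bar>(energy_form k \<omega> (\<lambda>x. w x + h x) (\<lambda>x. G x + H x) / 2 - power_int q (\<lambda>x. w x + h x) / q) - (energy_form k \<omega> w G / 2 - power_int q w / q)\<bar>
          \<le> \<epsilon> * sqrt (energy_form k 1 h H)"
      proof (rule minimiser_action_estimate[OF q m _ mineq X])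
        show "integrable_power q v" if "energy_pair k v G" for v G by (rule int[OF that])
        show "energy_form k \<omega> w G = m powr (q / (q - 2))" "power_int q w = m powr (q / (q - 2))" using QI I by (simp_all add: y0_def)
      qed (use \<open>\<epsilon> > 0\<close> in simp_all)
      then obtain \<delta> where d: "\<delta> > 0" "\<And>h H. energy_pair k h H \<Longrightarrow> sqrt (energy_form k 1 h H) < \<delta> \<Longrightarrow>
          \<bar>(energy_form k \<omega> (\<lambda>x. w x + h x) (\<lambda>x. G x + H x) / 2 - power_int q (\<lambda>x. w x + h x) / q) - (energy_form k \<omega> w G / 2 - power_int q w / q)\<bar>
          \<le> \<epsilon> * sqrt (energy_form k 1 h H)"
        by blast
      show "\<exists>\<delta>>0. \<forall>h\<in>X_space k. X_norm k h < \<delta> \<longrightarrow>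
          \<bar>action k p \<omega> (\<lambda>x. v x + h x) - action k p \<omega> v - 0\<bar> \<le> \<epsilon> * X_norm k h"
      proof (intro exI[of _ \<delta>] conjI ballI impI d(1))
        fix h assume h: "h \<in> X_space k" "X_norm k h < \<delta>"
        obtain h' H where s: "represents k h h' H" using X_space_represents[OF h(1)] by metis
        show "\<bar>action k p \<omega> (\<lambda>x. v x + h x) - action k p \<omega> v - 0\<bar> \<le> \<epsilon> * X_norm k h"
          using d(2)[OF representsD(1)[OF s]] h(2) unfolding act(1)[OF represents_add[OF r s]] act(1)[OF r] act(3)[OF s] by simp
      qed
    qed
    then show ?thesis using vX by (simp add: critical_points_def)
  qed
  have crit_ge: "v \<in> X_space k \<and> nehari k p \<omega> v = 0 \<and> \<not> ae_zero v \<and> c * y0 \<le> action k p \<omega> v"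
    if v: "v \<in> critical_points k p \<omega>" for v
  proof -
    have v': "v \<in> X_space k" "\<not> ae_zero v" "X_has_derivative k (action k p \<omega>) (\<lambda>_. 0) v"
      using v by (auto simp: critical_points_def)
    have "nehari k p \<omega> v = 0"
      by (rule DERIV_unique[OF action_scale_derivative[OF v'(1) p] critical_point_derivative_zero[OF v'(1) v'(3)]])
    then show ?thesis using neh[OF v'(1) _ v'(2)] v' c by auto
  qed
  have "ground_states k p \<omega> = R"
  proof (intro set_eqI iffI)
    fix v assume "v \<in> ground_states k p \<omega>"
    then have v: "v \<in> critical_points k p \<omega>" "action k p \<omega> v \<le> action k p \<omega> e"
      using R_crit[OF eR] by (auto simp: ground_states_def)
    then show "v \<in> R" using crit_ge[OF v(1)] e(4) la by (simp add: R_def)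
  next
    fix v assume v: "v \<in> R"
    then have "action k p \<omega> v = c * y0" using la by (simp add: R_def)
    then show "v \<in> ground_states k p \<omega>" using R_crit[OF v] crit_ge by (simp add: ground_states_def)
  qed
  then show ?thesis using eR action_scale_derivative[OF _ p] by (auto simp: R_def)
qed

end
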